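(* Let $E$ and $W$ be nonzero finite-rank free abelian groups and let $\mu:E\otimes E\otimes E\to W$ be surjective, with operator discriminant $\Delta_{\mathrm{op}}(\mu)$. A prime $p$ has a nonzero characteristic defect jump if and only if $p\mid\Delta_{\mathrm{op}}(\mu)$. More precisely, the jump at $p$ is $$\#\{i:p\mid\alpha_i\}+\#\{j:p\mid\beta_j\},$$ where the $\alpha_i$ and $\beta_j$ are the nonzero Smith invariant factors of $\Theta_\mu$ and $B_\mu$, respectively.
   Context: Define $\Theta_\mu:E\otimes E\to\operatorname{Hom}_{\mathbb Z}(E,W)$ by $\Theta_\mu(a\otimes b)(c)=\mu(a,b,c)$ and $B_\mu:E^{\otimes4}\to(W\otimes E)\oplus(E\otimes W)$ by $B_\mu(a\otimes b\otimes c\otimes d)=\mu(a,b,c)\otimes d-a\otimes\mu(b,c,d)$; choosing bases of $E$ and $W$, they are regarded as integer matrices. Let $a_0=\operatorname{rank}_{\mathbb Q}\Theta_\mu$ and $b_0=\operatorname{rank}_{\mathbb Q}B_\mu$. If $a_0>0$, $\Delta_{\mathrm{vis}}(\mu)$ is the positive gcd of all nonzero $a_0\times a_0$ minors of $\Theta_\mu$; if $a_0=0$ it is $1$. $\Delta_{\mathrm{mid}}(\mu)$ is defined analogously from $B_\mu$ and $b_0$. The operator discriminant is $\Delta_{\mathrm{op}}(\mu)=\Delta_{\mathrm{vis}}(\mu)\Delta_{\mathrm{mid}}(\mu)$. For a field $k$ let $\mu_k$ be the scalar extension (or reduction) of $\mu$ to $E_k=E\otimes k$, $W_k=W\otimes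 k$, and let $T_{\mu_k}=E_k\oplus W_k$ with $\Gamma=k$ and ternary product $(x+u)\,n\,(y+v)\,m\,(z+w)=nm\,\mu_k(x,y,z)$ ($x,y,z\in E_k$; $u,v,w\in W_k$; $n,m\in k$). The operator rng $\mathcal O_k(T,\Gamma)$ is the quotient of $T\otimes_k\Gamma\otimes_kT\otimes_k\Gamma$, with multiplication $(a\otimes\alpha\otimes b\otimes\beta)(c\otimes\gamma\otimes d\otimes\delta)=(a\alpha b\beta c)\otimes\gamma\otimes d\otimes\delta$, by the two-sided ideal generated by all $(a\alpha b\beta c)\otimes\gamma\otimes d\otimes\delta-a\otimes\alpha\otimes(b\beta c\gamma d)\otimes\delta$. The operator defect $\mathfrak D(T_{\mu_k},k)$ is the kernel of the regular representation $\mathcal O_k(T_{\mu_k},k)\to\operatorname{End}_k(T_{\mu_k})$, $[a,\alpha,b,\beta]\mapsto(x\mapsto a\alpha b\beta x)$. Writing $\mu_p=\mu_{\mathbb F_p}$, the characteristic defect jump at a prime $p$ is $$\dim_{\mathbb F_p}\mathfrak D(T_{\mu_p},\mathbb F_p)-\dim_{\mathbb Q}\mathfrak D(T_{\mu_{\mathbb Q}},\mathbb Q).$$ *)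

theory Defs
  imports
    "HOL-Library.Poly_Mapping"
    "HOL-Library.Function_Algebras"
    "HOL-Library.Product_Plus"
    "Jordan_Normal_Form.DL_Rank"
    "Jordan_Normal_Form.DL_Submatrix"
    "Berlekamp_Zassenhaus.Finite_Field"
begin

section \<open>Abelian groups as modules over the integers\<close>

definition zmult :: "int \<Rightarrow> 'a::ab_group_add \<Rightarrow> 'a" where
  "zmult n x = (\<Sum>i<nat n. x) - (\<Sum>i<nat (- n). x)"

lemma zmult_0 [simp]: "zmult 0 x = 0"
  by (simp add: zmult_def)

lemma zmult_plus_1: "zmult (n + 1) x = zmult n x + x"
proof (cases "n \<ge> 0")
  case True
  then have "nat (n + 1) = Suc (nat n)" by simp
  then show ?thesis using True by (simp add: zmult_def)
next
  case False
  then have "nat (- n) = Suc (nat (- (n + 1)))" by simp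
  then show ?thesis using False by (simp add: zmult_def)
qed

lemma zmult_minus_1: "zmult (n - 1) x = zmult n x - x"
  using zmult_plus_1[of "n - 1" x] by (simp add: algebra_simps)

lemma zmult_1 [simp]: "zmult 1 x = x"
  using zmult_plus_1[of 0 x] by simp

lemma zmult_add_left: "zmult (m + n) x = zmult m x + zmult n x"
proof (induction n rule: int_induct[where k = 0])
  case base
  then show ?case by simp
next
  case (step1 i)
  have "zmult (m + (i + 1)) x = zmult (m + i) x + x"
    using zmult_plus_1[of "m + i" x] by (simp add: add.assoc)
  then show ?case using step1 by (simp add: zmult_plus_1 add.assoc)
next
  case (step2 i)
  have "zmult (m + (i - 1)) x = zmult (m + i) x - x"
    using zmult_minus_1[of "m + i" x] by (simp add: add_diff_eq)
  then show ?case using step2 by (simp add: zmult_minus_1 add_diff_eq)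
qed

lemma zmult_add_right: "zmult n (x + y) = zmult n x + zmult n y"
  by (simp add: zmult_def sum.distrib algebra_simps)

lemma zmult_zmult: "zmult m (zmult n x) = zmult (m * n) x"
proof (induction m rule: int_induct[where k = 0])
  case base
  then show ?case by simp
next
  case (step1 i)
  then show ?case by (simp add: zmult_add_left distrib_right)
next
  case (step2 i)
  have "zmult (i * n - n) x = zmult (i * n) x - zmult n x"
    using zmult_add_left[of "i * n - n" n x] by simp
  with step2 show ?case by (simp add: zmult_minus_1 left_diff_distrib)
qed

interpretation zmod: module "zmult :: int \<Rightarrow> 'a::ab_group_add \<Rightarrow> 'a"
  by standard (simp_all add: zmult_add_left zmult_add_right zmult_zmult)

definition zbasis :: "'a::ab_group_add list \<Rightarrow> bool" where
  "zbasis bs \<longleftrightarrow> distinct bs \<and> zmod.independent (set bs) \<and> zmod.span (set bs) = UNIV"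

definition zmatrix ::
    "'a::ab_group_add list \<Rightarrow> 'b::ab_group_add list \<Rightarrow> ('a \<Rightarrow> 'b) \<Rightarrow> int mat" where
  "zmatrix bs cs f =
     mat (length cs) (length bs) (\<lambda>(i, j). zmod.representation (set cs) (f (bs ! j)) (cs ! i))"

text \<open>The elementary homomorphisms sending one element of \<open>bs\<close> to one element of \<open>cs\<close> and the
  other elements of \<open>bs\<close> to zero; for bases of \<open>E\<close> and \<open>W\<close> they form a basis of the group of
  homomorphisms from \<open>E\<close> to \<open>W\<close>, regarded as a subgroup of all functions with pointwise addition.\<close>

definition hom_basis ::
    "'a::ab_group_add list \<Rightarrow> 'b::ab_group_add list \<Rightarrow> ('a \<Rightarrow> 'b) list" where
  "hom_basis bs cs = [(\<lambda>x. zmult (zmod.representation (set bs) x b) c). b \<leftarrow> bs, c \<leftarrow> cs]"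


section \<open>Tensor product of abelian groups\<close>

definition tensor_null :: "('a::ab_group_add \<times> 'b::ab_group_add \<Rightarrow>\<^sub>0 int) set" where
  "tensor_null = zmod.span
     ({frag_of (a + a', b) - frag_of (a, b) - frag_of (a', b) | a a' b. True} \<union>
      {frag_of (a, b + b') - frag_of (a, b) - frag_of (a, b') | a b b'. True})"

definition tensor_rel ::
    "('a::ab_group_add \<times> 'b::ab_group_add \<Rightarrow>\<^sub>0 int) \<Rightarrow> ('a \<times> 'b \<Rightarrow>\<^sub>0 int) \<Rightarrow> bool" where
  "tensor_rel x y \<longleftrightarrow> x - y \<in> tensor_null"

lemma subspace_tensor_null: "zmod.subspace tensor_null"
  unfolding tensor_null_def by (rule zmod.subspace_span)

lemma equivp_mod_subspace:
  assumes "zmod.subspace N"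
  shows "equivp (\<lambda>x y. x - y \<in> N)"
proof (rule equivpI)
  show "reflp (\<lambda>x y. x - y \<in> N)"
    using zmod.subspace_0[OF assms] by (simp add: reflp_def)
  show "symp (\<lambda>x y. x - y \<in> N)"
  proof (rule sympI)
    fix x y assume "x - y \<in> N"
    then show "y - x \<in> N" using zmod.subspace_neg[OF assms, of "x - y"] by simp
  qed
  show "transp (\<lambda>x y. x - y \<in> N)"
  proof (rule transpI)
    fix x y z assume "x - y \<in> N" "y - z \<in> N"
    then show "x - z \<in> N" using zmod.subspace_add[OF assms, of "x - y" "y - z"] by simp
  qed
qed

lemma mod_subspace_plus:
  assumes "zmod.subspace N" "x - x' \<in> N" "y - y' \<in> N"
  shows "(x + y) - (x' + y') \<in> N"
  using zmod.subspace_add[OF assms] by (simp add: algebra_simps)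

lemma mod_subspace_minus:
  assumes "zmod.subspace N" "x - x' \<in> N" "y - y' \<in> N"
  shows "(x - y) - (x' - y') \<in> N"
  using zmod.subspace_diff[OF assms] by (simp add: algebra_simps)

lemma mod_subspace_uminus:
  assumes "zmod.subspace N" "x - x' \<in> N"
  shows "(- x) - (- x') \<in> N"
  using zmod.subspace_neg[OF assms] by (simp add: algebra_simps)

quotient_type (overloaded) ('a, 'b) tensor =
    "'a::ab_group_add \<times> 'b::ab_group_add \<Rightarrow>\<^sub>0 int" / tensor_rel
  morphisms rep_tensor abs_tensor
  unfolding tensor_rel_def by (rule equivp_mod_subspace[OF subspace_tensor_null])

instantiation tensor :: (ab_group_add, ab_group_add) ab_group_add
begin

lift_definition zero_tensor :: "('a, 'b) tensor" is 0 .

lift_definition plus_tensor :: "('a, 'b) tensor \<Rightarrow> ('a, 'b) tensor \<Rightarrow> ('a, 'b) tensor" is "(+)"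
  unfolding tensor_rel_def by (rule mod_subspace_plus[OF subspace_tensor_null])

lift_definition minus_tensor :: "('a, 'b) tensor \<Rightarrow> ('a, 'b) tensor \<Rightarrow> ('a, 'b) tensor" is "(-)"
  unfolding tensor_rel_def by (rule mod_subspace_minus[OF subspace_tensor_null])

lift_definition uminus_tensor :: "('a, 'b) tensor \<Rightarrow> ('a, 'b) tensor" is uminus
  unfolding tensor_rel_def by (rule mod_subspace_uminus[OF subspace_tensor_null])

instance
proof
  fix a b c :: "('a, 'b) tensor"
  have refl: "tensor_rel x x" for x :: "'a \<times> 'b \<Rightarrow>\<^sub>0 int"
    by (simp add: tensor_rel_def zmod.subspace_0[OF subspace_tensor_null])
  show "a + b + c = a + (b + c)" by transfer (simp add: add.assoc refl)
  show "a + b = b + a" by transfer (simp add: add.commute refl)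
  show "0 + a = a" by transfer (simp add: refl)
  show "- a + a = 0" by transfer (simp add: refl)
  show "a - b = a + - b" by transfer (simp add: refl)
qed

end

lift_definition tens :: "'a::ab_group_add \<Rightarrow> 'b::ab_group_add \<Rightarrow> ('a, 'b) tensor"
    (infixl "\<otimes>\<^sub>\<int>" 75) is "\<lambda>a b. frag_of (a, b)" .

definition biadditive ::
    "('a::ab_group_add \<Rightarrow> 'b::ab_group_add \<Rightarrow> 'c::ab_group_add) \<Rightarrow> bool" where
  "biadditive f \<longleftrightarrow> (\<forall>a. Modules.additive (f a)) \<and> (\<forall>b. Modules.additive (\<lambda>a. f a b))"

definition frag_sum :: "('a \<Rightarrow> 'c::ab_group_add) \<Rightarrow> ('a \<Rightarrow>\<^sub>0 int) \<Rightarrow> 'c" where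
  "frag_sum f x = (\<Sum>a\<in>Poly_Mapping.keys x. zmult (Poly_Mapping.lookup x a) (f a))"

text \<open>The homomorphism induced by a biadditive map. For maps that are not biadditive the value
  depends on the choice of representatives and is meaningless.\<close>

definition tensor_lift ::
    "('a::ab_group_add \<Rightarrow> 'b::ab_group_add \<Rightarrow> 'c::ab_group_add) \<Rightarrow> ('a, 'b) tensor \<Rightarrow> 'c" where
  "tensor_lift f t = frag_sum (\<lambda>(a, b). f a b) (rep_tensor t)"

lemma frag_sum_superset:
  assumes "finite S" "Poly_Mapping.keys x \<subseteq> S"
  shows "frag_sum f x = (\<Sum>a\<in>S. zmult (Poly_Mapping.lookup x a) (f a))"
  unfolding frag_sum_def using assms by (intro sum.mono_neutral_left) (auto simp: in_keys_iff)

lemma additive_frag_sum: "frag_sum f (x + y) = frag_sum f x + frag_sum f y"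
proof -
  let ?S = "Poly_Mapping.keys x \<union> Poly_Mapping.keys y"
  have "frag_sum f z = (\<Sum>a\<in>?S. zmult (Poly_Mapping.lookup z a) (f a))"
    if "Poly_Mapping.keys z \<subseteq> ?S" for z
    by (rule frag_sum_superset) (use that in auto)
  moreover have "Poly_Mapping.keys (x + y) \<subseteq> ?S" by (rule keys_add)
  ultimately show ?thesis
    by (simp add: lookup_add zmult_add_left sum.distrib)
qed

lemma frag_sum_0 [simp]: "frag_sum f 0 = 0"
  by (simp add: frag_sum_def)

lemma frag_sum_of [simp]: "frag_sum f (frag_of a) = f a"
  by (simp add: frag_sum_def)

lemma frag_sum_diff: "frag_sum f (x - y) = frag_sum f x - frag_sum f y"
  using additive_frag_sum[of f "x - y" y] by (simp add: algebra_simps)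

lemma zmult_hom:
  assumes "Modules.additive h"
  shows "h (zmult n x) = zmult n (h x)"
proof -
  interpret Modules.additive h by fact
  show ?thesis by (simp add: zmult_def diff sum)
qed

lemma frag_sum_null:
  assumes "x \<in> zmod.span S" "\<And>s. s \<in> S \<Longrightarrow> frag_sum f s = 0"
  shows "frag_sum f x = 0"
proof -
  have h: "Modules.additive (frag_sum f)"
    by (simp add: Modules.additive_def additive_frag_sum)
  show ?thesis using assms(1)
  proof (induction rule: zmod.span_induct_alt)
    case (step c x y)
    then show ?case by (simp add: additive_frag_sum zmult_hom[OF h] assms(2))
  qed simp
qed

lemma tensor_lift_abs:
  assumes "biadditive f"
  shows "tensor_lift f (abs_tensor x) = frag_sum (\<lambda>(a, b). f a b) x"
proof -
  have "tensor_rel (rep_tensor (abs_tensor x)) x"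
    by (rule Quotient3_rep_abs[OF Quotient3_tensor]) (rule equivp_reflp[OF tensor_equivp])
  then have "rep_tensor (abs_tensor x) - x \<in> tensor_null"
    by (simp add: tensor_rel_def)
  then have "frag_sum (\<lambda>(a, b). f a b) (rep_tensor (abs_tensor x) - x) = 0"
    unfolding tensor_null_def
  proof (rule frag_sum_null, goal_cases)
    case (1 s)
    have f1: "f (a + a') b = f a b + f a' b" and f2: "f a (b + b') = f a b + f a b'" for a a' b b'
      using assms by (simp_all add: biadditive_def Modules.additive_def)
    from 1 show ?case by (elim UnE CollectE exE conjE) (simp_all add: frag_sum_diff f1 f2)
  qed
  then show ?thesis by (simp add: tensor_lift_def frag_sum_diff)
qed

lemma tensor_lift_tens: "biadditive f \<Longrightarrow> tensor_lift f (a \<otimes>\<^sub>\<int> b) = f a b"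
  by (simp add: tens.abs_eq tensor_lift_abs)

lemma additive_tensor_lift:
  assumes "biadditive f"
  shows "Modules.additive (tensor_lift f)"
proof
  fix s t :: "('a, 'b) tensor"
  obtain x y where "s = abs_tensor x" "t = abs_tensor y"
    by (rule that[OF Quotient3_abs_rep[OF Quotient3_tensor, symmetric]
          Quotient3_abs_rep[OF Quotient3_tensor, symmetric]])
  then show "tensor_lift f (s + t) = tensor_lift f s + tensor_lift f t"
    using assms by (simp add: plus_tensor.abs_eq tensor_lift_abs additive_frag_sum)
qed

definition tensor_basis ::
    "'a::ab_group_add list \<Rightarrow> 'b::ab_group_add list \<Rightarrow> ('a, 'b) tensor list" where
  "tensor_basis bs cs = [b \<otimes>\<^sub>\<int> c. b \<leftarrow> bs, c \<leftarrow> cs]"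

type_synonym 'e tensor2 = "('e, 'e) tensor"
type_synonym 'e tensor3 = "('e tensor2, 'e) tensor"
type_synonym 'e tensor4 = "('e tensor3, 'e) tensor"


section \<open>The operator discriminant\<close>

definition Theta ::
    "('e::ab_group_add tensor3 \<Rightarrow> 'w::ab_group_add) \<Rightarrow> 'e tensor2 \<Rightarrow> 'e \<Rightarrow> 'w" where
  "Theta \<mu> = tensor_lift (\<lambda>a b c. \<mu> (a \<otimes>\<^sub>\<int> b \<otimes>\<^sub>\<int> c))"

definition Bmap ::
    "('e::ab_group_add tensor3 \<Rightarrow> 'w::ab_group_add) \<Rightarrow>
      'e tensor4 \<Rightarrow> ('w, 'e) tensor \<times> ('e, 'w) tensor" where
  "Bmap \<mu> = tensor_lift (\<lambda>abc d. tensor_lift (\<lambda>ab c. tensor_lift (\<lambda>a b.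
     (\<mu> (a \<otimes>\<^sub>\<int> b \<otimes>\<^sub>\<int> c) \<otimes>\<^sub>\<int> d, - (a \<otimes>\<^sub>\<int> \<mu> (b \<otimes>\<^sub>\<int> c \<otimes>\<^sub>\<int> d)))) ab) abc)"

definition Theta_mat ::
    "'e::ab_group_add list \<Rightarrow> 'w::ab_group_add list \<Rightarrow> ('e tensor3 \<Rightarrow> 'w) \<Rightarrow> int mat" where
  "Theta_mat bE bW \<mu> = zmatrix (tensor_basis bE bE) (hom_basis bE bW) (Theta \<mu>)"

definition B_mat ::
    "'e::ab_group_add list \<Rightarrow> 'w::ab_group_add list \<Rightarrow> ('e tensor3 \<Rightarrow> 'w) \<Rightarrow> int mat" where
  "B_mat bE bW \<mu> = zmatrix
     (tensor_basis (tensor_basis (tensor_basis bE bE) bE) bE)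
     (map (\<lambda>u. (u, 0)) (tensor_basis bW bE) @ map (\<lambda>v. (0, v)) (tensor_basis bE bW))
     (Bmap \<mu>)"

definition rat_rank :: "int mat \<Rightarrow> nat" where
  "rat_rank A = vec_space.rank (dim_row A) (map_mat rat_of_int A)"

definition minors_gcd :: "int mat \<Rightarrow> int" where
  "minors_gcd A = (let r = rat_rank A in
     if r = 0 then 1
     else Gcd {det (submatrix A I J) | I J. I \<subseteq> {..<dim_row A} \<and> J \<subseteq> {..<dim_col A} \<and>
                 card I = r \<and> card J = r \<and> det (submatrix A I J) \<noteq> 0})"

definition operator_discriminant ::
    "'e::ab_group_add list \<Rightarrow> 'w::ab_group_add list \<Rightarrow> ('e tensor3 \<Rightarrow> 'w) \<Rightarrow> int" where
  "operator_discriminant bE bW \<mu> =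
     minors_gcd (Theta_mat bE bW \<mu>) * minors_gcd (B_mat bE bW \<mu>)"

text \<open>\<open>ds\<close> lists the nonzero invariant factors of \<open>A\<close>: the nonzero diagonal entries of a Smith
  normal form of \<open>A\<close> over the integers.\<close>

definition smith_invariant_factors :: "int mat \<Rightarrow> int list \<Rightarrow> bool" where
  "smith_invariant_factors A ds \<longleftrightarrow>
     (\<forall>d\<in>set ds. d > 0) \<and>
     (\<forall>i. Suc i < length ds \<longrightarrow> ds ! i dvd ds ! Suc i) \<and>
     length ds \<le> dim_row A \<and> length ds \<le> dim_col A \<and>
     (\<exists>P Q. P \<in> carrier_mat (dim_row A) (dim_row A) \<and> invertible_mat P \<and>
            Q \<in> carrier_mat (dim_col A) (dim_col A) \<and> invertible_mat Q \<and>
            P * A * Q = mat (dim_row A) (dim_col A)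
              (\<lambda>(i, j). if i = j \<and> i < length ds then ds ! i else 0))"


section \<open>Scalar extension and the ternary product\<close>

text \<open>The extension of \<open>E\<close> to a field \<open>k\<close> is the type \<open>(E, k) tensor\<close>, with the following scalar
  multiplication.\<close>

definition kscale :: "'k::field \<Rightarrow> ('e::ab_group_add, 'k) tensor \<Rightarrow> ('e, 'k) tensor" where
  "kscale c = tensor_lift (\<lambda>x a. x \<otimes>\<^sub>\<int> (c * a))"

definition scalar_extension ::
    "('e::ab_group_add tensor3 \<Rightarrow> 'w::ab_group_add) \<Rightarrow>
      ('e, 'k::field) tensor \<Rightarrow> ('e, 'k) tensor \<Rightarrow> ('e, 'k) tensor \<Rightarrow> ('w, 'k) tensor" where
  "scalar_extension \<mu> x y z =
     tensor_lift (\<lambda>x' a. tensor_lift (\<lambda>y' b. tensor_lift (\<lambda>z' c.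
       \<mu> (x' \<otimes>\<^sub>\<int> y' \<otimes>\<^sub>\<int> z') \<otimes>\<^sub>\<int> (a * b * c)) z) y) x"

type_synonym ('e, 'w, 'k) trilinear =
  "('e, 'k) tensor \<Rightarrow> ('e, 'k) tensor \<Rightarrow> ('e, 'k) tensor \<Rightarrow> ('w, 'k) tensor"

type_synonym ('e, 'w, 'k) tspace = "('e, 'k) tensor \<times> ('w, 'k) tensor"

definition tscale ::
    "'k::field \<Rightarrow> ('e::ab_group_add, 'w::ab_group_add, 'k) tspace \<Rightarrow> ('e, 'w, 'k) tspace" where
  "tscale c t = (kscale c (fst t), kscale c (snd t))"

definition tprod ::
    "('e::ab_group_add, 'w::ab_group_add, 'k::field) trilinear \<Rightarrow>
      ('e, 'w, 'k) tspace \<Rightarrow> 'k \<Rightarrow> ('e, 'w, 'k) tspace \<Rightarrow> 'k \<Rightarrow> ('e, 'w, 'k) tspace \<Rightarrow>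
      ('e, 'w, 'k) tspace" where
  "tprod \<nu> r n s m t = (0, kscale (n * m) (\<nu> (fst r) (fst s) (fst t)))"


section \<open>The tensor product of $T$, $\Gamma$, $T$, $\Gamma$ over $k$, where $\Gamma = k$\<close>

definition op_tensor_null ::
    "(('e::ab_group_add, 'w::ab_group_add, 'k::field) tspace \<times> 'k \<times>
      ('e, 'w, 'k) tspace \<times> 'k \<Rightarrow>\<^sub>0 int) set" where
  "op_tensor_null = zmod.span
     ({frag_of (a + a', \<alpha>, b, \<beta>) - frag_of (a, \<alpha>, b, \<beta>) - frag_of (a', \<alpha>, b, \<beta>) | a a' \<alpha> b \<beta>. True} \<union>
      {frag_of (a, \<alpha> + \<alpha>', b, \<beta>) - frag_of (a, \<alpha>, b, \<beta>) - frag_of (a, \<alpha>', b, \<beta>) | a \<alpha> \<alpha>' b \<beta>. True} \<union>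
      {frag_of (a, \<alpha>, b + b', \<beta>) - frag_of (a, \<alpha>, b, \<beta>) - frag_of (a, \<alpha>, b', \<beta>) | a \<alpha> b b' \<beta>. True} \<union>
      {frag_of (a, \<alpha>, b, \<beta> + \<beta>') - frag_of (a, \<alpha>, b, \<beta>) - frag_of (a, \<alpha>, b, \<beta>') | a \<alpha> b \<beta> \<beta>'. True} \<union>
      {frag_of (tscale c a, \<alpha>, b, \<beta>) - frag_of (a, c * \<alpha>, b, \<beta>) | c a \<alpha> b \<beta>. True} \<union>
      {frag_of (a, c * \<alpha>, b, \<beta>) - frag_of (a, \<alpha>, tscale c b, \<beta>) | c a \<alpha> b \<beta>. True} \<union>
      {frag_of (a, \<alpha>, tscale c b, \<beta>) - frag_of (a, \<alpha>, b, c * \<beta>) | c a \<alpha> b \<beta>. True})"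

definition op_tensor_rel ::
    "(('e::ab_group_add, 'w::ab_group_add, 'k::field) tspace \<times> 'k \<times>
      ('e, 'w, 'k) tspace \<times> 'k \<Rightarrow>\<^sub>0 int) \<Rightarrow>
     (('e, 'w, 'k) tspace \<times> 'k \<times> ('e, 'w, 'k) tspace \<times> 'k \<Rightarrow>\<^sub>0 int) \<Rightarrow> bool" where
  "op_tensor_rel x y \<longleftrightarrow> x - y \<in> op_tensor_null"

lemma subspace_op_tensor_null: "zmod.subspace op_tensor_null"
  unfolding op_tensor_null_def by (rule zmod.subspace_span)

quotient_type (overloaded) ('e, 'w, 'k) op_tensor =
    "('e::ab_group_add, 'w::ab_group_add, 'k::field) tspace \<times> 'k \<times>
      ('e, 'w, 'k) tspace \<times> 'k \<Rightarrow>\<^sub>0 int" / op_tensor_rel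
  morphisms rep_op_tensor abs_op_tensor
  unfolding op_tensor_rel_def by (rule equivp_mod_subspace[OF subspace_op_tensor_null])

instantiation op_tensor :: (ab_group_add, ab_group_add, field) ab_group_add
begin

lift_definition zero_op_tensor :: "('a, 'b, 'c) op_tensor" is 0 .

lift_definition plus_op_tensor ::
  "('a, 'b, 'c) op_tensor \<Rightarrow> ('a, 'b, 'c) op_tensor \<Rightarrow> ('a, 'b, 'c) op_tensor" is "(+)"
  unfolding op_tensor_rel_def by (rule mod_subspace_plus[OF subspace_op_tensor_null])

lift_definition minus_op_tensor ::
  "('a, 'b, 'c) op_tensor \<Rightarrow> ('a, 'b, 'c) op_tensor \<Rightarrow> ('a, 'b, 'c) op_tensor" is "(-)"
  unfolding op_tensor_rel_def by (rule mod_subspace_minus[OF subspace_op_tensor_null])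

lift_definition uminus_op_tensor ::
  "('a, 'b, 'c) op_tensor \<Rightarrow> ('a, 'b, 'c) op_tensor" is uminus
  unfolding op_tensor_rel_def by (rule mod_subspace_uminus[OF subspace_op_tensor_null])

instance
proof
  fix a b c :: "('a, 'b, 'c) op_tensor"
  have refl: "op_tensor_rel x x" for x ::
      "('a, 'b, 'c) tspace \<times> 'c \<times> ('a, 'b, 'c) tspace \<times> 'c \<Rightarrow>\<^sub>0 int"
    by (simp add: op_tensor_rel_def zmod.subspace_0[OF subspace_op_tensor_null])
  show "a + b + c = a + (b + c)" by transfer (simp add: add.assoc refl)
  show "a + b = b + a" by transfer (simp add: add.commute refl)
  show "0 + a = a" by transfer (simp add: refl)
  show "- a + a = 0" by transfer (simp add: refl)
  show "a - b = a + - b" by transfer (simp add: refl)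
qed

end

definition op_tens ::
    "('e::ab_group_add, 'w::ab_group_add, 'k::field) tspace \<Rightarrow> 'k \<Rightarrow> ('e, 'w, 'k) tspace \<Rightarrow> 'k \<Rightarrow>
      ('e, 'w, 'k) op_tensor" where
  "op_tens a \<alpha> b \<beta> = abs_op_tensor (frag_of (a, \<alpha>, b, \<beta>))"

text \<open>The homomorphism induced by a balanced multiadditive map, meaningless for other maps.\<close>

definition balanced_multiadditive ::
    "(('e::ab_group_add, 'w::ab_group_add, 'k::field) tspace \<Rightarrow> 'k \<Rightarrow> ('e, 'w, 'k) tspace \<Rightarrow> 'k \<Rightarrow>
      'c::ab_group_add) \<Rightarrow> bool" where
  "balanced_multiadditive f \<longleftrightarrow>
     (\<forall>a a' \<alpha> b \<beta>. f (a + a') \<alpha> b \<beta> = f a \<alpha> b \<beta> + f a' \<alpha> b \<beta>) \<and>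
     (\<forall>a \<alpha> \<alpha>' b \<beta>. f a (\<alpha> + \<alpha>') b \<beta> = f a \<alpha> b \<beta> + f a \<alpha>' b \<beta>) \<and>
     (\<forall>a \<alpha> b b' \<beta>. f a \<alpha> (b + b') \<beta> = f a \<alpha> b \<beta> + f a \<alpha> b' \<beta>) \<and>
     (\<forall>a \<alpha> b \<beta> \<beta>'. f a \<alpha> b (\<beta> + \<beta>') = f a \<alpha> b \<beta> + f a \<alpha> b \<beta>') \<and>
     (\<forall>c a \<alpha> b \<beta>. f (tscale c a) \<alpha> b \<beta> = f a (c * \<alpha>) b \<beta>) \<and>
     (\<forall>c a \<alpha> b \<beta>. f a (c * \<alpha>) b \<beta> = f a \<alpha> (tscale c b) \<beta>) \<and>
     (\<forall>c a \<alpha> b \<beta>. f a \<alpha> (tscale c b) \<beta> = f a \<alpha> b (c * \<beta>))"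

definition op_lift ::
    "(('e::ab_group_add, 'w::ab_group_add, 'k::field) tspace \<Rightarrow> 'k \<Rightarrow> ('e, 'w, 'k) tspace \<Rightarrow> 'k \<Rightarrow>
      'c::ab_group_add) \<Rightarrow> ('e, 'w, 'k) op_tensor \<Rightarrow> 'c" where
  "op_lift f t = frag_sum (\<lambda>(a, \<alpha>, b, \<beta>). f a \<alpha> b \<beta>) (rep_op_tensor t)"

lemma op_lift_abs:
  assumes "balanced_multiadditive f"
  shows "op_lift f (abs_op_tensor x) = frag_sum (\<lambda>(a, \<alpha>, b, \<beta>). f a \<alpha> b \<beta>) x"
proof -
  have "op_tensor_rel (rep_op_tensor (abs_op_tensor x)) x"
    by (rule Quotient3_rep_abs[OF Quotient3_op_tensor]) (rule equivp_reflp[OF op_tensor_equivp])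
  then have "rep_op_tensor (abs_op_tensor x) - x \<in> op_tensor_null"
    by (simp add: op_tensor_rel_def)
  then have "frag_sum (\<lambda>(a, \<alpha>, b, \<beta>). f a \<alpha> b \<beta>) (rep_op_tensor (abs_op_tensor x) - x) = 0"
    unfolding op_tensor_null_def
  proof (rule frag_sum_null, goal_cases)
    case (1 s)
    from 1 show ?case
      by (elim UnE CollectE exE conjE)
        (simp_all add: frag_sum_diff assms[unfolded balanced_multiadditive_def])
  qed
  then show ?thesis by (simp add: op_lift_def frag_sum_diff)
qed

lemma op_lift_tens:
  "balanced_multiadditive f \<Longrightarrow> op_lift f (op_tens a \<alpha> b \<beta>) = f a \<alpha> b \<beta>"
  by (simp add: op_tens_def op_lift_abs)

lemma additive_op_lift:
  fixes f :: "('e::ab_group_add, 'w::ab_group_add, 'k::field) tspace \<Rightarrow> 'k \<Rightarrow>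
    ('e, 'w, 'k) tspace \<Rightarrow> 'k \<Rightarrow> 'c::ab_group_add"
  assumes "balanced_multiadditive f"
  shows "Modules.additive (op_lift f)"
proof
  fix s t :: "('e, 'w, 'k) op_tensor"
  obtain x y where "s = abs_op_tensor x" "t = abs_op_tensor y"
    by (rule that[OF Quotient3_abs_rep[OF Quotient3_op_tensor, symmetric]
          Quotient3_abs_rep[OF Quotient3_op_tensor, symmetric]])
  then show "op_lift f (s + t) = op_lift f s + op_lift f t"
    using assms by (simp add: plus_op_tensor.abs_eq op_lift_abs additive_frag_sum)
qed

definition op_scale ::
    "'k::field \<Rightarrow> ('e::ab_group_add, 'w::ab_group_add, 'k) op_tensor \<Rightarrow> ('e, 'w, 'k) op_tensor" where
  "op_scale c = op_lift (\<lambda>a \<alpha> b \<beta>. op_tens (tscale c a) \<alpha> b \<beta>)"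


section \<open>The operator rng and the operator defect\<close>

definition op_mult ::
    "('e::ab_group_add, 'w::ab_group_add, 'k::field) trilinear \<Rightarrow>
      ('e, 'w, 'k) op_tensor \<Rightarrow> ('e, 'w, 'k) op_tensor \<Rightarrow> ('e, 'w, 'k) op_tensor" where
  "op_mult \<nu> s t = op_lift (\<lambda>a \<alpha> b \<beta>. op_lift (\<lambda>c \<gamma> d \<delta>.
     op_tens (tprod \<nu> a \<alpha> b \<beta> c) \<gamma> d \<delta>) t) s"

definition op_two_sided_ideal ::
    "('e::ab_group_add, 'w::ab_group_add, 'k::field) trilinear \<Rightarrow>
      ('e, 'w, 'k) op_tensor set \<Rightarrow> bool" where
  "op_two_sided_ideal \<nu> J \<longleftrightarrow>
     0 \<in> J \<and> (\<forall>x\<in>J. \<forall>y\<in>J. x + y \<in> J) \<and> (\<forall>c. \<forall>x\<in>J. op_scale c x \<in> J) \<and>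
     (\<forall>s. \<forall>x\<in>J. op_mult \<nu> s x \<in> J \<and> op_mult \<nu> x s \<in> J)"

definition op_ideal ::
    "('e::ab_group_add, 'w::ab_group_add, 'k::field) trilinear \<Rightarrow>
      ('e, 'w, 'k) op_tensor set" where
  "op_ideal \<nu> = op_two_sided_ideal \<nu> hull
     {op_tens (tprod \<nu> a \<alpha> b \<beta> c) \<gamma> d \<delta> - op_tens a \<alpha> (tprod \<nu> b \<beta> c \<gamma> d) \<delta> |
        a \<alpha> b \<beta> c \<gamma> d \<delta>. True}"

definition op_coset ::
    "('e::ab_group_add, 'w::ab_group_add, 'k::field) trilinear \<Rightarrow>
      ('e, 'w, 'k) op_tensor \<Rightarrow> ('e, 'w, 'k) op_tensor set" where
  "op_coset \<nu> t = (+) t ` op_ideal \<nu>"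

text \<open>A module record over \<open>k\<close> whose multiplication is that of the operator rng. There is no unit,
  so the field \<open>one\<close> of the record is left unspecified.\<close>

definition operator_rng ::
    "('e::ab_group_add, 'w::ab_group_add, 'k::field) trilinear \<Rightarrow>
      ('k, ('e, 'w, 'k) op_tensor set) module" where
  "operator_rng \<nu> =
     \<lparr>carrier = range (op_coset \<nu>),
      monoid.mult = (\<lambda>X Y. \<Union>s\<in>X. \<Union>t\<in>Y. op_coset \<nu> (op_mult \<nu> s t)),
      one = undefined,
      zero = op_coset \<nu> 0,
      add = (\<lambda>X Y. \<Union>s\<in>X. \<Union>t\<in>Y. op_coset \<nu> (s + t)),
      module.smult = (\<lambda>c X. \<Union>t\<in>X. op_coset \<nu> (op_scale c t))\<rparr>"

definition op_action ::
    "('e::ab_group_add, 'w::ab_group_add, 'k::field) trilinear \<Rightarrow>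
      ('e, 'w, 'k) op_tensor \<Rightarrow> ('e, 'w, 'k) tspace \<Rightarrow> ('e, 'w, 'k) tspace" where
  "op_action \<nu> = op_lift (\<lambda>a \<alpha> b \<beta> x. tprod \<nu> a \<alpha> b \<beta> x)"

definition regular_representation ::
    "('e::ab_group_add, 'w::ab_group_add, 'k::field) trilinear \<Rightarrow>
      ('e, 'w, 'k) op_tensor set \<Rightarrow> ('e, 'w, 'k) tspace \<Rightarrow> ('e, 'w, 'k) tspace" where
  "regular_representation \<nu> X = the_elem (op_action \<nu> ` X)"

definition operator_defect ::
    "('e::ab_group_add, 'w::ab_group_add, 'k::field) trilinear \<Rightarrow>
      ('k, ('e, 'w, 'k) op_tensor set) module" where
  "operator_defect \<nu> = (operator_rng \<nu>)
     \<lparr>carrier := {X \<in> carrier (operator_rng \<nu>). regular_representation \<nu> X = (\<lambda>_. 0)}\<rparr>"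

definition defect_dim ::
    "('e::ab_group_add, 'w::ab_group_add, 'k::field) trilinear \<Rightarrow> nat" where
  "defect_dim \<nu> = vectorspace.dim class_ring (operator_defect \<nu>)"

text \<open>The prime field with $p$ elements is \<open>'p mod_ring\<close>, where \<open>'p\<close> is a type with $p$ elements.\<close>

definition defect_jump ::
    "'p::prime_card itself \<Rightarrow> ('e::ab_group_add tensor3 \<Rightarrow> 'w::ab_group_add) \<Rightarrow> int" where
  "defect_jump _ \<mu> =
     int (defect_dim (scalar_extension \<mu> :: ('e, 'w, 'p mod_ring) trilinear)) -
     int (defect_dim (scalar_extension \<mu> :: ('e, 'w, rat) trilinear))"

end

theory Submission
  imports
    Defs
    "Jordan_Normal_Form.DL_Rank_Submatrix"
    "Jordan_Normal_Form.Matrix_Kernel"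
begin

text \<open>The ternary product of \<open>T = E \<oplus> W\<close> takes values in \<open>W\<close> and vanishes as soon as one argument lies
  in \<open>W\<close>. Hence the relations of the operator rng, modulo \<open>W \<otimes> W\<close>, are exactly the values of \<open>B\<close>, and
  multiplying a relation from the left yields a product of two values of \<open>\<mu>\<close>, so that the relations
  generate \<open>W \<otimes> W\<close> because \<open>\<mu>\<close> is surjective. Therefore the operator rng over a field \<open>k\<close> is
  \<open>E \<otimes> E \<oplus> coker B\<close>; it acts through \<open>\<Theta>\<close>, and the defect is \<open>ker \<Theta> \<oplus> coker B\<close>. Its dimension is
  \<open>e\<^sup>2 - rank \<Theta> + 2 e w - rank B\<close> with \<open>e\<close>, \<open>w\<close> the ranks of \<open>E\<close>, \<open>W\<close>, so the jump at \<open>p\<close> is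
  the sum of the rank drops of \<open>\<Theta>\<close> and \<open>B\<close> modulo \<open>p\<close>. A rank drop is read off the Smith form, and it
  occurs if and only if \<open>p\<close> divides all maximal nonzero minors.\<close>

section \<open>Ranks and minors\<close>

text \<open>The delicate point is the size of the ideal. Modulo W \<otimes> W the relations span the
  image of B, but closing them under multiplication could enlarge the mixed part in (W \<otimes> E)
  \<oplus> (E \<otimes> W). It does not: a product in the rng has its first tensor factor in W, and
  its W \<otimes> E coordinates depend only on the E \<otimes> E coordinates of the two factors,
  which vanish on relations. A product with a relation therefore lands in W \<otimes> W.
  Surjectivity over the integers passes to every field because each \<mu>(x, y, z) \<otimes> c is
  itself a value of the scalar extension. The objects are given as quotients of free abelian groups,
  integral representations in bases and a record of cosets. All of them are turned into coordinates:
  dual families identify the entries of both matrices with structure constants of \<mu>, and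
  functionals f \<otimes> g on T \<otimes> T turn membership in the ideal into a matrix equation.
  The dimension formula is then proved once, over an arbitrary field.\<close>

lemma rank_plus_kernel_dim:
  fixes A :: "'a::field mat"
  assumes A: "A \<in> carrier_mat nr nc"
  shows "vec_space.rank nr A + kernel_dim A = nc"
proof -
  interpret V: vec_space "TYPE('a)" nc .
  interpret W: vec_space "TYPE('a)" nr .
  have lm: "linear_map class_ring V.V W.V ((*\<^sub>v) A)"
    unfolding linear_map_def mod_hom_def mod_hom_axioms_def LinearCombinations.module_hom_def
    using A V.vectorspace_axioms W.vectorspace_axioms V.module_axioms W.module_axioms
    by (auto simp: mult_add_distrib_mat_vec mult_mat_vec)
  interpret L: linear_map class_ring V.V W.V "(*\<^sub>v) A" by (rule lm)
  have ker: "L.kerT = mat_kernel A"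
    using A by (auto simp: L.ker_def mat_kernel_def)
  have im: "L.imT = W.span (set (cols A))"
    using W.col_space_eq[OF A] A by (auto simp: L.im_def W.col_space_def)
  show ?thesis
    using L.rank_nullity[OF V.fin_dim] A
    unfolding ker im W.rank_def kernel_dim_def V.dim_is_n by simp
qed

text \<open>A left factor leaves the kernel itself unchanged, a right factor maps one kernel
  isomorphically onto the other; rank-nullity transfers this to ranks.\<close>

lemma rank_mult_invertible:
  fixes A :: "'a::field mat"
  assumes A: "A \<in> carrier_mat nr nc"
    and P: "P \<in> carrier_mat nr nr" "P' \<in> carrier_mat nr nr" "P' * P = 1\<^sub>m nr"
    and Q: "Q \<in> carrier_mat nc nc" "Q' \<in> carrier_mat nc nc" "Q * Q' = 1\<^sub>m nc"
  shows "vec_space.rank nr (P * A * Q) = vec_space.rank nr A"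
proof -
  have PA: "P * A \<in> carrier_mat nr nc" and PAQ: "P * A * Q \<in> carrier_mat nr nc"
    using A P Q by auto
  have "kernel_dim (P * A * Q) = kernel_dim (P * A)"
    using mat_kernel_dim_mult_eq_right[OF PA Q] A P Q by (simp add: kernel_dim_def)
  also have "\<dots> = kernel_dim A"
    using mat_kernel_mult_eq[OF A P] A P by (simp add: kernel_dim_def)
  finally show ?thesis
    using rank_plus_kernel_dim[OF PAQ] rank_plus_kernel_dim[OF A] by simp
qed

section \<open>Rank as the size of the largest nonzero minor\<close>

text \<open>Gaussian elimination, one equation at a time: solving equation \<open>j\<close> for an
  unknown \<open>i0\<close> leaves one equation and one unknown fewer.\<close>

lemma underdetermined_system:
  fixes f :: "'i \<Rightarrow> 'j \<Rightarrow> 'a::field"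
  assumes "finite J" "finite I" "card J < card I"
  shows "\<exists>c. (\<exists>i\<in>I. c i \<noteq> 0) \<and> (\<forall>j\<in>J. (\<Sum>i\<in>I. c i * f i j) = 0)"
  using assms
proof (induction J arbitrary: I f rule: finite_induct)
  case empty
  then have "I \<noteq> {}" by auto
  then show ?case by (intro exI[of _ "\<lambda>_. 1"]) auto
next
  case (insert j J)
  show ?case
  proof (cases "\<forall>i\<in>I. f i j = 0")
    case True
    have "card J < card I" using insert by simp
    from insert.IH[OF insert.prems(1) this, of f]
    obtain c where "\<exists>i\<in>I. c i \<noteq> 0" "\<forall>j\<in>J. (\<Sum>i\<in>I. c i * f i j) = 0" by blast
    with True show ?thesis by (intro exI[of _ c]) auto
  next
    case False
    then obtain i0 where i0: "i0 \<in> I" "f i0 j \<noteq> 0" by auto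
    define I' where "I' = I - {i0}"
    \<comment> \<open>\<open>g\<close> is the system after the unknown \<open>i0\<close> has been
      eliminated by means of equation \<open>j\<close>.\<close>
    define g where "g i k = f i k - f i j / f i0 j * f i0 k" for i k
    have I: "I = insert i0 I'" "i0 \<notin> I'" "finite I'" using i0 insert.prems by (auto simp: I'_def)
    with insert have "card J < card I'" by simp
    from insert.IH[OF I(3) this, of g]
    obtain c where c: "\<exists>i\<in>I'. c i \<noteq> 0" "\<And>k. k \<in> J \<Longrightarrow> (\<Sum>i\<in>I'. c i * g i k) = 0" by blast
    define s where "s = (\<Sum>i\<in>I'. c i * f i j)"
    \<comment> \<open>The value at \<open>i0\<close> is forced by equation \<open>j\<close>; by the
      choice of \<open>g\<close> the other equations then hold as well.\<close>
    define c' where "c' = c(i0 := - s / f i0 j)"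
    have c'I: "(\<Sum>i\<in>I'. c' i * f i k) = (\<Sum>i\<in>I'. c i * f i k)" for k
      by (intro sum.cong) (use I in \<open>auto simp: c'_def\<close>)
    have sum: "(\<Sum>i\<in>I. c' i * f i k) = (\<Sum>i\<in>I'. c i * f i k) - s / f i0 j * f i0 k" for k
      using I by (simp add: c'I) (simp add: c'_def)
    have "(\<Sum>i\<in>I. c' i * f i k) = (\<Sum>i\<in>I'. c i * g i k)" for k
      unfolding sum by (simp add: g_def s_def algebra_simps sum_subtractf sum_distrib_left sum_distrib_right sum_divide_distrib)
    moreover have "(\<Sum>i\<in>I. c' i * f i j) = 0"
      unfolding sum using i0 by (simp add: s_def)
    moreover have "\<exists>i\<in>I. c' i \<noteq> 0" using c(1) I by (auto simp: c'_def)
    ultimately show ?thesis using c(2) by (intro exI[of _ c']) auto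
  qed
qed

text \<open>Rows are discarded until as many are left as there are unknowns. A surplus of rows
  forces a linear relation between them, and a row with nonzero coefficient in it follows from the
  others, so the solutions stay trivial.\<close>

lemma square_subsystem:
  fixes f :: "'i \<Rightarrow> 'j \<Rightarrow> 'a::field"
  assumes "finite I" "finite J"
    and "\<And>v. (\<And>i. i \<in> I \<Longrightarrow> (\<Sum>j\<in>J. f i j * v j) = 0) \<Longrightarrow> \<forall>j\<in>J. v j = 0"
  shows "\<exists>I'\<subseteq>I. card I' = card J \<and>
    (\<forall>v. (\<forall>i\<in>I'. (\<Sum>j\<in>J. f i j * v j) = 0) \<longrightarrow> (\<forall>j\<in>J. v j = 0))"
  using assms
proof (induction "card I" arbitrary: I rule: less_induct)
  case less
  have "\<not> card I < card J"
  proof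
    assume "card I < card J"
    \<comment> \<open>The unknowns are the columns here: with fewer rows than columns there would be
      a nontrivial solution.\<close>
    from underdetermined_system[OF \<open>finite I\<close> \<open>finite J\<close> this, of "\<lambda>j i. f i j"]
    obtain v where "\<exists>j\<in>J. v j \<noteq> 0" "\<forall>i\<in>I. (\<Sum>j\<in>J. v j * f i j) = 0" by auto
    with less.prems(3)[of v] show False by (auto simp: mult.commute)
  qed
  then consider "card I = card J" | "card J < card I" by linarith
  then show ?case
  proof cases
    case 1
    with less.prems(3) show ?thesis by blast
  next
    case 2
    \<comment> \<open>The roles are exchanged: the unknowns are now the coefficients of a relation
      between the rows.\<close>
    from underdetermined_system[OF \<open>finite J\<close> \<open>finite I\<close> this, of f]
    obtain c i0 where c: "i0 \<in> I" "c i0 \<noteq> 0" "\<forall>j\<in>J. (\<Sum>i\<in>I. c i * f i j) = 0" by auto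
    define I' where "I' = I - {i0}"
    have I: "I = insert i0 I'" "i0 \<notin> I'" "finite I'" using c(1) less.prems(1) by (auto simp: I'_def)
    have indep: "\<forall>j\<in>J. v j = 0" if v: "\<And>i. i \<in> I' \<Longrightarrow> (\<Sum>j\<in>J. f i j * v j) = 0" for v
    proof (rule less.prems(3))
      have "0 = (\<Sum>j\<in>J. (\<Sum>i\<in>I. c i * f i j) * v j)" using c by simp
      also have "\<dots> = (\<Sum>i\<in>I. c i * (\<Sum>j\<in>J. f i j * v j))"
        by (simp add: sum_distrib_left sum_distrib_right mult.assoc) (rule sum.swap)
      also have "\<dots> = c i0 * (\<Sum>j\<in>J. f i0 j * v j)"
        using I v by simp
      finally have "(\<Sum>j\<in>J. f i0 j * v j) = 0" using c by simp
      then show "(\<Sum>j\<in>J. f i j * v j) = 0" if "i \<in> I" for i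
        using that v I by auto
    qed
    have "card I' < card I" using I by simp
    from less.hyps[OF this I(3) \<open>finite J\<close> indep]
    obtain I'' where "I'' \<subseteq> I'" "card I'' = card J"
      "\<forall>v. (\<forall>i\<in>I''. (\<Sum>j\<in>J. f i j * v j) = 0) \<longrightarrow> (\<forall>j\<in>J. v j = 0)" by blast
    moreover from this(1) have "I'' \<subseteq> I" using I(1) by blast
    ultimately show ?thesis by blast
  qed
qed

lemma bij_betw_pick: "finite S \<Longrightarrow> bij_betw (pick S) {..<card S} S"
proof (rule bij_betw_imageI)
  assume S: "finite S"
  show "inj_on (pick S) {..<card S}"
    by (rule inj_onI) (metis lessThan_iff linorder_neqE_nat nat_less_le pick_mono)
  show "pick S ` {..<card S} = S"
  proof
    show "pick S ` {..<card S} \<subseteq> S" by (auto intro: pick_in_set)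
    show "S \<subseteq> pick S ` {..<card S}"
    proof
      fix i assume "i \<in> S"
      then have "card {a \<in> S. a < i} < card S" "pick S (card {a \<in> S. a < i}) = i"
        using S by (auto intro!: psubset_card_mono simp: pick_card_in_set)
      then show "i \<in> pick S ` {..<card S}" by (intro image_eqI[of _ _ "card {a \<in> S. a < i}"]) simp_all
    qed
  qed
qed

lemma card_Collect_less: "S \<subseteq> {..<n} \<Longrightarrow> card {i. i < n \<and> i \<in> S} = card S"
  by (rule arg_cong[of _ _ card]) auto

text \<open>The rank is the size of a maximal independent set of column vectors. Different indices
  may carry equal columns, so \<open>J\<close> is chosen such that \<open>col A\<close> is injective
  on it.\<close>

lemma independent_columns:
  fixes A :: "'a::field mat"
  assumes A: "A \<in> carrier_mat nr nc"
  shows "\<exists>J\<subseteq>{..<nc}. card J = vec_space.rank nr A \<and>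
    (\<forall>v. (\<forall>i<nr. (\<Sum>j\<in>J. A $$ (i, j) * v j) = 0) \<longrightarrow> (\<forall>j\<in>J. v j = 0))"
proof -
  interpret W: vec_space "TYPE('a)" nr .
  obtain S where S: "maximal S (\<lambda>T. T \<subseteq> set (cols A) \<and> W.lin_indpt T)"
    using maximal_exists_superset[of "set (cols A)" "\<lambda>T. T \<subseteq> set (cols A) \<and> W.lin_indpt T" "{}"]
      W.finite_lin_indpt2[of "{}"] by auto
  have rank: "W.rank A = card S" by (rule W.rank_card_indpt[OF A S])
  have Sc: "S \<subseteq> set (cols A)" and li: "W.lin_indpt S"
    using S by (auto simp: maximal_def)
  have fin: "finite S" using Sc finite_subset by blast
  have "S \<subseteq> col A ` {..<nc}" using Sc A by (auto simp: cols_def)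
  then obtain J where J: "J \<subseteq> {..<nc}" "inj_on (col A) J" "S = col A ` J"
    by (metis subset_image_inj)
  have "\<forall>j\<in>J. v j = 0" if v: "\<forall>i<nr. (\<Sum>j\<in>J. A $$ (i, j) * v j) = 0" for v
  proof (rule ccontr)
    assume "\<not> ?thesis"
    then obtain j where j: "j \<in> J" "v j \<noteq> 0" by auto
    define a where "a = v \<circ> inv_into J (col A)"
    have a: "a (col A j) = v j" if "j \<in> J" for j
      using that J by (simp add: a_def)
    have SC: "S \<subseteq> carrier_vec nr" using A J by auto
    have "W.lincomb a S = 0\<^sub>v nr"
    proof (rule eq_vecI)
      show "dim_vec (W.lincomb a S) = dim_vec (0\<^sub>v nr)" using W.lincomb_dim[OF fin SC] by simp
      fix i assume "i < dim_vec (0\<^sub>v nr :: 'a vec)"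
      then have i: "i < nr" by simp
      have "W.lincomb a S $ i = (\<Sum>x\<in>S. a x * x $ i)" by (rule W.lincomb_index[OF i SC])
      also have "\<dots> = (\<Sum>j\<in>J. a (col A j) * col A j $ i)"
        unfolding J(3) using sum.reindex[OF J(2)] by simp
      also have "\<dots> = (\<Sum>j\<in>J. A $$ (i, j) * v j)"
        by (rule sum.cong) (use a i A J in \<open>auto simp: mult.commute subset_iff\<close>)
      finally show "W.lincomb a S $ i = 0\<^sub>v nr $ i" using v i by simp
    qed
    then have "W.lin_dep S"
      unfolding W.lin_dep_def
      by (intro exI[of _ S] exI[of _ a] exI[of _ "col A j"]) (use fin j a J in auto)
    with li show False by simp
  qed
  moreover have "card J = card S" using J by (simp add: card_image)
  ultimately show ?thesis using J rank by (intro exI[of _ J]) auto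
qed

text \<open>Independent columns admit only the trivial solution; keeping just enough rows for this
  gives a square matrix with trivial kernel.\<close>

lemma rank_minor_exists:
  fixes A :: "'a::field mat"
  assumes A: "A \<in> carrier_mat nr nc"
  shows "\<exists>I J. I \<subseteq> {..<nr} \<and> J \<subseteq> {..<nc} \<and> card I = vec_space.rank nr A \<and>
    card J = vec_space.rank nr A \<and> det (submatrix A I J) \<noteq> 0"
proof -
  define r where "r = vec_space.rank nr A"
  obtain J where J: "J \<subseteq> {..<nc}" "card J = r"
    "\<And>v. (\<And>i. i \<in> {..<nr} \<Longrightarrow> (\<Sum>j\<in>J. A $$ (i, j) * v j) = 0) \<Longrightarrow> \<forall>j\<in>J. v j = 0"
    using independent_columns[OF A] unfolding r_def lessThan_iff by blast
  have finJ: "finite J" using J(1) finite_subset by blast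
  from square_subsystem[of "{..<nr}" J "\<lambda>i j. A $$ (i, j)", OF finite_lessThan finJ J(3)]
  obtain I where I: "I \<subseteq> {..<nr}" "card I = r"
    and I_indep: "\<forall>v. (\<forall>i\<in>I. (\<Sum>j\<in>J. A $$ (i, j) * v j) = 0) \<longrightarrow> (\<forall>j\<in>J. v j = 0)"
    unfolding J(2) by blast
  have finI: "finite I" using I(1) finite_subset by blast
  have cI: "card {i. i < dim_row A \<and> i \<in> I} = r" and cJ: "card {i. i < dim_col A \<and> i \<in> J} = r"
    using card_Collect_less[OF I(1)] card_Collect_less[OF J(1)] A I J by auto
  have M: "submatrix A I J \<in> carrier_mat r r"
    by (rule carrier_matI) (simp_all add: dim_submatrix cI cJ)
  have "det (submatrix A I J) \<noteq> 0"
  proof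
    assume "det (submatrix A I J) = 0"
    then obtain v where v: "v \<in> carrier_vec r" "v \<noteq> 0\<^sub>v r" "submatrix A I J *\<^sub>v v = 0\<^sub>v r"
      using det_0_iff_vec_prod_zero_field[OF M] by auto
    \<comment> \<open>A kernel vector of the submatrix is carried back to the original column
      indices along the enumeration \<open>pick J\<close>.\<close>
    define u where "u = (\<lambda>j. v $ inv_into {..<r} (pick J) j)"
    have bij: "bij_betw (pick J) {..<r} J" using bij_betw_pick[OF finJ] J(2) by simp
    have u: "u (pick J l) = v $ l" if "l < r" for l
      using that bij by (simp add: u_def bij_betw_def)
    have u0: "u j = 0" if "j \<in> J" for j
      using that
    proof (rule I_indep[rule_format, rotated])
      fix i assume "i \<in> I"
      then obtain l where l: "l < r" "i = pick I l"
        using bij_betw_pick[OF finI] I(2) by (auto simp: bij_betw_def)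
      have "(\<Sum>j\<in>J. A $$ (i, j) * u j) = (\<Sum>j<r. A $$ (i, pick J j) * u (pick J j))"
        by (rule sum.reindex_bij_betw[OF bij, symmetric])
      also have "\<dots> = (\<Sum>j<r. submatrix A I J $$ (l, j) * v $ j)"
        by (rule sum.cong) (use u l cI cJ in \<open>auto simp: submatrix_index\<close>)
      also have "\<dots> = (submatrix A I J *\<^sub>v v) $ l"
        using M v(1) l by (auto simp: scalar_prod_def atLeast0LessThan intro!: sum.cong)
      also have "\<dots> = 0" using v l by simp
      finally show "(\<Sum>j\<in>J. A $$ (i, j) * u j) = 0" .
    qed
    have "v $ l = 0" if "l < r" for l
      using u[OF that] u0[of "pick J l"] bij that by (auto simp: bij_betw_def)
    then have "v = 0\<^sub>v r" using v by auto
    with v show False by simp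
  qed
  with I J show ?thesis unfolding r_def by blast
qed

lemma rank_ge_minor:
  fixes A :: "'a::field mat"
  assumes "A \<in> carrier_mat nr nc" "J \<subseteq> {..<nc}" "det (submatrix A I J) \<noteq> 0"
  shows "card J \<le> vec_space.rank nr A"
  using vec_space.rank_gt_minor[OF assms(1,3)] card_Collect_less[OF assms(2)] by simp

text \<open>Lower bound: the minor on the nonzero diagonal positions is a product of nonzero
  entries. Upper bound: a nonzero minor contains no zero row, so the rows of a minor of rank size
  lie among these positions.\<close>

lemma rank_diagonal:
  fixes d :: "nat \<Rightarrow> 'a::field"
  assumes "l \<le> nr" "l \<le> nc"
  shows "vec_space.rank nr (mat nr nc (\<lambda>(i, j). if i = j \<and> i < l then d i else 0)) =
    card {i. i < l \<and> d i \<noteq> 0}"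
proof -
  define D where "D = mat nr nc (\<lambda>(i, j). if i = j \<and> i < l then d i else 0)"
  define S where "S = {i. i < l \<and> d i \<noteq> 0}"
  have D: "D \<in> carrier_mat nr nc" by (simp add: D_def)
  have S: "S \<subseteq> {..<nr}" "S \<subseteq> {..<nc}" "finite S" using assms by (auto simp: S_def)
  have "det (submatrix D S S) \<noteq> 0"
  proof -
    have c: "card {i. i < dim_row D \<and> i \<in> S} = card S" "card {i. i < dim_col D \<and> i \<in> S} = card S"
      using card_Collect_less[OF S(1)] card_Collect_less[OF S(2)] D by auto
    have M: "submatrix D S S \<in> carrier_mat (card S) (card S)"
      by (rule carrier_matI) (simp_all add: dim_submatrix c)
    have ps: "pick S i \<in> S" if "i < card S" for i using that by (simp add: pick_in_set)
    have dps: "d (pick S i) \<noteq> 0" if "i < card S" for i using ps[OF that] by (simp add: S_def)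
    have pi: "pick S i = pick S j \<longleftrightarrow> i = j" if "i < card S" "j < card S" for i j
      using bij_betw_pick[OF S(3)] that by (auto simp: bij_betw_def inj_on_def)
    have ix: "submatrix D S S $$ (i, j) = (if i = j then d (pick S i) else 0)"
      if "i < card S" "j < card S" for i j
      using that c ps[OF that(1)] ps[OF that(2)] S pi[OF that]
      by (auto simp: submatrix_index D_def subset_iff S_def)
    have "upper_triangular (submatrix D S S)"
      using M by (auto simp: upper_triangular_def ix)
    then have "det (submatrix D S S) = prod_list (diag_mat (submatrix D S S))"
      using det_upper_triangular M by blast
    moreover have "0 \<notin> set (diag_mat (submatrix D S S))"
      using M dps by (auto simp: diag_mat_def ix)
    ultimately show ?thesis by (simp add: prod_list_zero_iff)
  qed
  then have le: "card S \<le> vec_space.rank nr D"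
    by (rule rank_ge_minor[OF D S(2)])
  obtain I J where IJ: "I \<subseteq> {..<nr}" "J \<subseteq> {..<nc}" "card I = vec_space.rank nr D"
    "card J = vec_space.rank nr D" "det (submatrix D I J) \<noteq> 0"
    using rank_minor_exists[OF D] by auto
  define r where "r = vec_space.rank nr D"
  have cI: "card {i. i < dim_row D \<and> i \<in> I} = r" and cJ: "card {i. i < dim_col D \<and> i \<in> J} = r"
    using card_Collect_less[OF IJ(1)] card_Collect_less[OF IJ(2)] D IJ unfolding r_def by auto
  have M: "submatrix D I J \<in> carrier_mat r r"
    by (rule carrier_matI) (simp_all add: dim_submatrix cI cJ)
  have "I \<subseteq> S"
  proof (rule subsetI, rule ccontr)
    fix i assume i: "i \<in> I" "i \<notin> S"
    have "finite I" using IJ finite_subset by blast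
    then obtain a where a: "a < r" "pick I a = i"
      using bij_betw_pick[of I] i(1) IJ(3) unfolding r_def bij_betw_def by force
    have "submatrix D I J $$ (a, b) = 0" if b: "b < r" for b
    proof -
      have "pick J b \<in> J" using b IJ(4) by (simp add: pick_in_set r_def)
      then have "pick J b < nc" "i < nr" using IJ(1,2) i by auto
      moreover have "submatrix D I J $$ (a, b) = D $$ (i, pick J b)"
        using a b cI cJ by (simp add: submatrix_index)
      ultimately show ?thesis using i by (auto simp: D_def S_def)
    qed
    \<comment> \<open>A zero row of the minor is a zero column of its transpose, which therefore
      kills a unit vector.\<close>
    then have "(submatrix D I J)\<^sup>T *\<^sub>v unit_vec r a = 0\<^sub>v r"
      using M a by (intro eq_vecI) auto
    moreover have "unit_vec r a \<noteq> (0\<^sub>v r :: 'a vec)" using a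
      by (metis index_unit_vec(1) index_zero_vec(1) zero_neq_one)
    ultimately have "det (submatrix D I J)\<^sup>T = 0"
      using det_0_iff_vec_prod_zero_field[of "(submatrix D I J)\<^sup>T" r] M
      by (metis transpose_carrier_mat unit_vec_carrier)
    with IJ(5) M det_transpose show False by metis
  qed
  then have "card I \<le> card S" using S(3) card_mono by blast
  with le IJ(3) show ?thesis unfolding D_def S_def by simp
qed

section \<open>One integer matrix over different fields\<close>

definition field_rank :: "'k::field itself \<Rightarrow> int mat \<Rightarrow> nat" where
  "field_rank _ A = vec_space.rank (dim_row A) (map_mat (of_int :: int \<Rightarrow> 'k) A)"

lemma rat_rank_eq_field_rank: "rat_rank A = field_rank TYPE(rat) A"
  by (simp add: rat_rank_def field_rank_def)

lemma submatrix_map_mat: "submatrix (map_mat f A) I J = map_mat f (submatrix A I J)"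
  by (rule eq_matI) (auto simp: dim_submatrix submatrix_index pick_le)

lemma det_submatrix_of_int:
  "det (submatrix (map_mat of_int A) I J) = of_int (det (submatrix A I J))"
  by (simp add: submatrix_map_mat of_int_hom.hom_det)

lemma field_rank_ge_minor:
  assumes "J \<subseteq> {..<dim_col A}" "of_int (det (submatrix A I J)) \<noteq> (0::'k::field)"
  shows "card J \<le> field_rank TYPE('k) A"
  unfolding field_rank_def using assms
  by (intro rank_ge_minor[of _ _ "dim_col A" _ I]) (auto simp: det_submatrix_of_int)

lemma field_rank_minor_exists:
  "\<exists>I J. I \<subseteq> {..<dim_row A} \<and> J \<subseteq> {..<dim_col A} \<and> card I = field_rank TYPE('k::field) A \<and>
    card J = field_rank TYPE('k) A \<and> of_int (det (submatrix A I J)) \<noteq> (0::'k)"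
  using rank_minor_exists[of "map_mat (of_int :: int \<Rightarrow> 'k) A" "dim_row A" "dim_col A"]
  by (simp add: det_submatrix_of_int field_rank_def)

text \<open>A minor that survives in \<open>'k\<close> is a nonzero integer and so survives over the
  rationals.\<close>

lemma field_rank_le_rat_rank: "field_rank TYPE('k::field) A \<le> rat_rank A"
proof -
  obtain I J where "J \<subseteq> {..<dim_col A}" "card J = field_rank TYPE('k) A"
    "of_int (det (submatrix A I J)) \<noteq> (0::'k)"
    using field_rank_minor_exists[of A, where 'k = 'k] by auto
  moreover from this(3) have "of_int (det (submatrix A I J)) \<noteq> (0::rat)" by auto
  ultimately show ?thesis using field_rank_ge_minor[of J A I, where 'k = rat]
    by (simp add: rat_rank_eq_field_rank)
qed

lemma of_int_mod_ring_eq_0_iff: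
  "of_int x = (0 :: 'p::prime_card mod_ring) \<longleftrightarrow> int CARD('p) dvd x"
  unfolding of_int_of_int_mod_ring by transfer (simp add: dvd_eq_mod_eq_0)

text \<open>The rank modulo p is at most the rational rank r, and it reaches r exactly if some
  r-minor is not divisible by p.\<close>

lemma dvd_minors_gcd_iff:
  "int CARD('p::prime_card) dvd minors_gcd A \<longleftrightarrow> field_rank TYPE('p mod_ring) A < rat_rank A"
proof (cases "rat_rank A = 0")
  case True
  \<comment> \<open>For rational rank 0 the gcd is 1 by convention, and no rank lies below 0: both
    sides are false.\<close>
  have "\<not> int CARD('p) dvd 1" using prime_card[where 'a = 'p]
    by (metis of_nat_1 of_nat_dvd_iff not_prime_unit)
  with True show ?thesis by (simp add: minors_gcd_def)
next
  case False
  let ?r = "rat_rank A" and ?p = "int CARD('p)"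
  let ?M = "{det (submatrix A I J) | I J. I \<subseteq> {..<dim_row A} \<and> J \<subseteq> {..<dim_col A} \<and>
                 card I = ?r \<and> card J = ?r \<and> det (submatrix A I J) \<noteq> 0}"
  have "?p dvd minors_gcd A \<longleftrightarrow> (\<forall>m\<in>?M. ?p dvd m)"
    using False by (simp add: minors_gcd_def Let_def dvd_Gcd_iff)
  also have "\<dots> \<longleftrightarrow> field_rank TYPE('p mod_ring) A < ?r"
  proof
    assume *: "\<forall>m\<in>?M. ?p dvd m"
    obtain I J where IJ: "I \<subseteq> {..<dim_row A}" "J \<subseteq> {..<dim_col A}"
      "card I = field_rank TYPE('p mod_ring) A" "card J = field_rank TYPE('p mod_ring) A"
      "of_int (det (submatrix A I J)) \<noteq> (0::'p mod_ring)"
      using field_rank_minor_exists[of A, where 'k = "'p mod_ring"] by auto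
    then have "\<not> ?p dvd det (submatrix A I J)" and "det (submatrix A I J) \<noteq> 0"
      by (auto simp: of_int_mod_ring_eq_0_iff)
    have "field_rank TYPE('p mod_ring) A \<noteq> ?r"
    proof
      assume "field_rank TYPE('p mod_ring) A = ?r"
      then have "det (submatrix A I J) \<in> ?M"
        using IJ(1-4) \<open>det (submatrix A I J) \<noteq> 0\<close> by auto
      with * \<open>\<not> ?p dvd det (submatrix A I J)\<close> show False by blast
    qed
    then show "field_rank TYPE('p mod_ring) A < ?r"
      using field_rank_le_rat_rank[of A, where 'k = "'p mod_ring"] by simp
  next
    assume *: "field_rank TYPE('p mod_ring) A < ?r"
    show "\<forall>m\<in>?M. ?p dvd m"
    proof
      fix m assume "m \<in> ?M"
      then obtain I J where m: "J \<subseteq> {..<dim_col A}" "card J = ?r" "m = det (submatrix A I J)" by auto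
      show "?p dvd m"
      proof (rule ccontr)
        assume "\<not> ?p dvd m"
        then have "of_int (det (submatrix A I J)) \<noteq> (0::'p mod_ring)"
          by (simp add: of_int_mod_ring_eq_0_iff m)
        from field_rank_ge_minor[OF m(1) this] * m show False by simp
      qed
    qed
  qed
  finally show ?thesis .
qed

section \<open>Rank drop from a Smith form\<close>

lemma invertible_mat_obtain_inverse:
  assumes "invertible_mat P" "P \<in> carrier_mat n n"
  obtains P' where "P' \<in> carrier_mat n n" "P * P' = 1\<^sub>m n" "P' * P = 1\<^sub>m n"
proof -
  obtain P' where P': "P * P' = 1\<^sub>m n" "P' * P = 1\<^sub>m (dim_row P')"
    using assms by (auto simp: invertible_mat_def inverts_mat_def)
  \<comment> \<open>\<open>invertible_mat\<close> does not fix the shape of the inverse; it is read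
    off from the dimensions of the two products.\<close>
  have "dim_col (P * P') = n" "dim_col (P' * P) = dim_row P'" unfolding P' by simp_all
  then have "P' \<in> carrier_mat n n" using assms by auto
  with P' show thesis using that by auto
qed

text \<open>The transforming matrices have integral inverses, so they stay invertible when their
  entries are mapped to any field, and only the rank of the diagonal form remains to be
  found.\<close>

lemma field_rank_smith:
  assumes "smith_invariant_factors A ds"
  shows "field_rank TYPE('k::field) A = card {i. i < length ds \<and> of_int (ds ! i) \<noteq> (0::'k)}"
proof -
  let ?n = "dim_row A" and ?m = "dim_col A" and ?h = "map_mat (of_int :: int \<Rightarrow> 'k)"
  obtain P Q where P: "P \<in> carrier_mat ?n ?n" "invertible_mat P"
    and Q: "Q \<in> carrier_mat ?m ?m" "invertible_mat Q"
    and l: "length ds \<le> ?n" "length ds \<le> ?m"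
    and PAQ: "P * A * Q = mat ?n ?m (\<lambda>(i, j). if i = j \<and> i < length ds then ds ! i else 0)"
    using assms by (auto simp: smith_invariant_factors_def)
  obtain P' where P': "P' \<in> carrier_mat ?n ?n" "P' * P = 1\<^sub>m ?n"
    using invertible_mat_obtain_inverse[OF P(2,1)] by metis
  obtain Q' where Q': "Q' \<in> carrier_mat ?m ?m" "Q * Q' = 1\<^sub>m ?m"
    using invertible_mat_obtain_inverse[OF Q(2,1)] by metis
  have A: "A \<in> carrier_mat ?n ?m" by simp
  have "?h P' * ?h P = 1\<^sub>m ?n" "?h Q * ?h Q' = 1\<^sub>m ?m"
    using of_int_hom.mat_hom_mult[OF P'(1) P(1), where 'a = 'k]
      of_int_hom.mat_hom_mult[OF Q(1) Q'(1), where 'a = 'k] P' Q'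
    by (simp_all add: of_int_hom.mat_hom_one)
  then have "vec_space.rank ?n (?h P * ?h A * ?h Q) = vec_space.rank ?n (?h A)"
    using P P' Q Q' by (intro rank_mult_invertible[of _ ?n ?m _ "?h P'" _ "?h Q'"]) auto
  moreover have "?h P * ?h A * ?h Q = ?h (P * A * Q)"
    using of_int_hom.mat_hom_mult[OF P(1) A, where 'a = 'k]
      of_int_hom.mat_hom_mult[of "P * A" ?n ?m Q ?m, where 'a = 'k] P Q by simp
  moreover have "\<dots> = mat ?n ?m (\<lambda>(i, j). if i = j \<and> i < length ds then of_int (ds ! i) else 0)"
    unfolding PAQ by (rule eq_matI) auto
  ultimately show ?thesis
    using rank_diagonal[OF l, of "\<lambda>i. of_int (ds ! i) :: 'k"] by (simp add: field_rank_def)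
qed

text \<open>Invariant factors are positive, so over the rationals each of them counts towards the
  rank, while modulo p those divisible by p are lost.\<close>

lemma smith_rank_drop:
  assumes "smith_invariant_factors A ds"
  shows "rat_rank A =
    field_rank TYPE('p::prime_card mod_ring) A + card {i. i < length ds \<and> int CARD('p) dvd ds ! i}"
proof -
  have pos: "ds ! i > 0" if "i < length ds" for i
    using assms that by (auto simp: smith_invariant_factors_def)
  have "rat_rank A = card {i. i < length ds}"
    unfolding rat_rank_eq_field_rank field_rank_smith[OF assms]
    by (rule arg_cong[of _ _ card]) (use pos in fastforce)
  also have "{i. i < length ds} = {i. i < length ds \<and> \<not> int CARD('p) dvd ds ! i} \<union>
      {i. i < length ds \<and> int CARD('p) dvd ds ! i}" by auto
  also have "card \<dots> = card {i. i < length ds \<and> \<not> int CARD('p) dvd ds ! i} +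
      card {i. i < length ds \<and> int CARD('p) dvd ds ! i}"
    by (rule card_Un_disjoint) auto
  finally show ?thesis
    unfolding field_rank_smith[OF assms] by (simp add: of_int_mod_ring_eq_0_iff)
qed

section \<open>Additive maps and sums\<close>

lemma zmult_int: "zmult n x = n * (x::int)"
  by (simp add: zmult_def algebra_simps)

lemma zmult_field: "zmult n x = of_int n * (x::'k::field)"
  by (cases "n \<ge> 0") (simp_all add: zmult_def)

text \<open>Bases of tensor products and of homomorphism groups are listed in row-major order: the
  pair (i, j) has position i * n + j, decoded by \<open>div\<close> and \<open>mod\<close>.\<close>

lemma sum_div_mod:
  fixes m n :: nat
  shows "(\<Sum>k<m * n. f (k div n) (k mod n)) = (\<Sum>i<m. \<Sum>j<n. f i j)"
proof -
  have "(\<Sum>i<m. \<Sum>j<n. f i j) = (\<Sum>(i, j)\<in>{..<m} \<times> {..<n}. f i j)"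
    by (rule sum.cartesian_product)
  also have "\<dots> = (\<Sum>k<m * n. f (k div n) (k mod n))"
  proof (rule sum.reindex_bij_witness[where i = "\<lambda>k. (k div n, k mod n)" and j = "\<lambda>(i, j). i * n + j"], goal_cases)
    case (4 b)
    then have "n > 0" by (cases n) auto
    with 4 show ?case by (auto simp: less_mult_imp_div_less)
  next
    case (2 a)
    then obtain i j where a: "a = (i, j)" "i < m" "j < n" by auto
    have "i * n + j < (i + 1) * n" using a by simp
    also have "\<dots> \<le> m * n" using a by (intro mult_le_mono1) simp
    finally show ?case using a by simp
  qed auto
  finally show ?thesis by simp
qed

lemma mult_add_less: "i < m \<Longrightarrow> j < n \<Longrightarrow> i * n + j < m * (n::nat)"
proof -
  assume a: "i < m" "j < n"
  have "i * n + j < (i + 1) * n" using a by simp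
  also have "\<dots> \<le> m * n" using a by (intro mult_le_mono1) simp
  finally show ?thesis .
qed

lemma div_mod_less: "k < m * n \<Longrightarrow> k div n < m" "k < m * n \<Longrightarrow> k mod n < (n::nat)"
  by (auto simp: less_mult_imp_div_less) (cases n; simp)

lemma sum_mult_nat: "(\<Sum>k<m * n. f k) = (\<Sum>i<m. \<Sum>j<n. f (i * n + j :: nat))"
  using sum_div_mod[of "\<lambda>i j. f (i * n + j)" n m] by simp

lemma nth_concat_map:
  "k < length bs * length cs \<Longrightarrow>
    concat (map (\<lambda>b. map (f b) cs) bs) ! k = f (bs ! (k div length cs)) (cs ! (k mod length cs))"
proof (induction bs arbitrary: k)
  case (Cons b bs)
  show ?case
  proof (cases "k < length cs")
    case False
    then have "k div length cs = Suc ((k - length cs) div length cs)"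
      "k mod length cs = (k - length cs) mod length cs"
      using Cons.prems by (cases "length cs"; simp add: le_div_geq le_mod_geq)+
    with Cons False show ?thesis by (simp add: nth_append)
  qed (simp add: nth_append)
qed simp

lemma length_concat_map: "length (concat (map (\<lambda>b. map (f b) cs) bs)) = length bs * length cs"
  by (induction bs) auto

lemma additive_cmult: "Modules.additive f \<Longrightarrow> Modules.additive (\<lambda>x. c * f x :: 'a::ring)"
  by (simp add: Modules.additive_def distrib_left)

lemma mult_add_div_mod:
  assumes "b < n"
  shows "(a * n + b) div n = a" "(a * n + b) mod n = (b :: nat)"
proof -
  have "n \<noteq> 0" using assms by simp
  then show "(a * n + b) div n = a" "(a * n + b) mod n = b" using assms by simp_all
qed

lemma additive_id: "Modules.additive (\<lambda>x. x)"
  by (simp add: Modules.additive_def)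

lemma fun_sum_apply: "(\<Sum>i\<in>A. f i) x = (\<Sum>i\<in>A. f i x)"
  by (induction A rule: infinite_finite_induct) auto

lemma additive_comp: "Modules.additive f \<Longrightarrow> Modules.additive g \<Longrightarrow> Modules.additive (\<lambda>x. f (g x))"
  by (simp add: Modules.additive_def)

lemma additive_sum_fun:
  "(\<And>i. i \<in> I \<Longrightarrow> Modules.additive (f i)) \<Longrightarrow> Modules.additive (\<lambda>x. \<Sum>i\<in>I. f i x)"
  by (simp add: Modules.additive_def sum.distrib)

lemma additive_plus:
  "Modules.additive f \<Longrightarrow> Modules.additive g \<Longrightarrow> Modules.additive (\<lambda>x. f x + g x)"
  by (simp add: Modules.additive_def algebra_simps)

lemma additive_eval: "Modules.additive (\<lambda>f. f x)"
  by (simp add: Modules.additive_def)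

lemma zmult_apply: "zmult n f x = zmult n (f x)"
  by (rule zmult_hom[OF additive_eval])

section \<open>Dual families of bases\<close>

text \<open>The matrices are defined through \<open>zmod.representation\<close>, which is a choice
  of coefficients. A family of additive functionals dual to the list pins its values down.\<close>

definition zdual :: "'a::ab_group_add list \<Rightarrow> (nat \<Rightarrow> 'a \<Rightarrow> int) \<Rightarrow> bool" where
  "zdual bs \<phi> \<longleftrightarrow> (\<forall>i<length bs. Modules.additive (\<phi> i)) \<and>
     (\<forall>i<length bs. \<forall>j<length bs. \<phi> i (bs ! j) = (if i = j then 1 else 0))"

text \<open>The expansion is a property of a single element because \<open>hom_basis\<close> expands
  the additive maps only, not every element of the function type.\<close>

definition zexpand :: "'a::ab_group_add list \<Rightarrow> (nat \<Rightarrow> 'a \<Rightarrow> int) \<Rightarrow> 'a \<Rightarrow> bool" where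
  "zexpand bs \<phi> x \<longleftrightarrow> x = (\<Sum>i<length bs. zmult (\<phi> i x) (bs ! i))"

lemma zdual_distinct: "zdual bs \<phi> \<Longrightarrow> distinct bs"
  unfolding zdual_def distinct_conv_nth by (metis zero_neq_one)

lemma sum_set_nth: "distinct bs \<Longrightarrow> (\<Sum>b\<in>set bs. f b) = (\<Sum>i<length bs. f (bs ! i))"
  by (rule sum.reindex_bij_betw[OF bij_betw_nth, symmetric]) auto

lemma zdual_sum:
  assumes "zdual bs \<phi>" "i < length bs"
  shows "\<phi> i (\<Sum>j<length bs. zmult (c j) (bs ! j)) = c i"
proof -
  interpret additive "\<phi> i" using assms by (simp add: zdual_def)
  have "\<phi> i (\<Sum>j<length bs. zmult (c j) (bs ! j)) = (\<Sum>j<length bs. c j * \<phi> i (bs ! j))"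
    by (simp add: sum zmult_hom[OF additive_axioms] zmult_int)
  also have "\<dots> = (\<Sum>j<length bs. if i = j then c j else 0)"
    by (rule sum.cong) (use assms in \<open>auto simp: zdual_def\<close>)
  finally show ?thesis using assms(2) by simp
qed

lemma zdual_independent:
  assumes "zdual bs \<phi>"
  shows "zmod.independent (set bs)"
  unfolding zmod.dependent_finite[OF finite_set]
proof (safe, goal_cases)
  case (1 f x)
  then have f: "(\<Sum>x\<in>set bs. zmult (f x) x) = 0" and "x \<in> set bs" and x: "f x \<noteq> 0" by auto
  then obtain i where i: "i < length bs" "x = bs ! i" by (auto simp: in_set_conv_nth)
  have "Modules.additive (\<phi> i)" using assms i by (simp add: zdual_def)
  then have "\<phi> i 0 = 0" by (rule additive.zero)
  with f x zdual_sum[OF assms i(1), of "\<lambda>j. f (bs ! j)"] show ?case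
    by (simp add: sum_set_nth[OF zdual_distinct[OF assms]] i)
qed

text \<open>The expansion puts \<open>x\<close> into the span, outside of which the representation
  is 0 by default. Applying \<open>\<phi> i\<close> to the sum that the representation provides then
  picks out one coefficient.\<close>

lemma zdual_representation:
  assumes "zdual bs \<phi>" "zexpand bs \<phi> x" "i < length bs"
  shows "zmod.representation (set bs) x (bs ! i) = \<phi> i x"
proof -
  have ind: "zmod.independent (set bs)" by (rule zdual_independent[OF assms(1)])
  have "x \<in> zmod.span (set bs)"
    using assms(2) unfolding zexpand_def
    by (metis (no_types, lifting) lessThan_iff nth_mem zmod.span_base zmod.span_scale zmod.span_sum)
  then have "(\<Sum>b\<in>set bs. zmult (zmod.representation (set bs) x b) b) = x"
    by (intro zmod.sum_representation_eq[OF ind]) auto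
  then show ?thesis
    using zdual_sum[OF assms(1,3), of "\<lambda>j. zmod.representation (set bs) x (bs ! j)"]
    by (simp add: sum_set_nth[OF zdual_distinct[OF assms(1)]])
qed

definition crd :: "'a::ab_group_add list \<Rightarrow> nat \<Rightarrow> 'a \<Rightarrow> int" where
  "crd bs i x = zmod.representation (set bs) x (bs ! i)"

lemma zbasis_dual:
  assumes "zbasis bs"
  shows "zdual bs (crd bs)"
proof -
  have ind: "zmod.independent (set bs)" and sp: "x \<in> zmod.span (set bs)" and d: "distinct bs" for x
    using assms by (auto simp: zbasis_def)
  show ?thesis
    using d by (auto simp: zdual_def crd_def Modules.additive_def zmod.representation_add[OF ind sp sp]
        zmod.representation_basis[OF ind nth_mem] nth_eq_iff_index_eq)
qed

lemma zbasis_expand: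
  assumes "zbasis bs"
  shows "zexpand bs (crd bs) x"
proof -
  have ind: "zmod.independent (set bs)" and sp: "x \<in> zmod.span (set bs)" and d: "distinct bs" for x
    using assms by (auto simp: zbasis_def)
  have "(\<Sum>b\<in>set bs. zmult (zmod.representation (set bs) x b) b) = x"
    by (intro zmod.sum_representation_eq[OF ind sp]) auto
  then show ?thesis by (simp add: zexpand_def crd_def sum_set_nth[OF d])
qed

lemma additive_crd: "zbasis bs \<Longrightarrow> i < length bs \<Longrightarrow> Modules.additive (crd bs i)"
  using zbasis_dual by (auto simp: zdual_def)

section \<open>Tensor products\<close>

lemma biadditive_tens: "biadditive (\<otimes>\<^sub>\<int>)"
proof -
  have "(a + a') \<otimes>\<^sub>\<int> b = a \<otimes>\<^sub>\<int> b + a' \<otimes>\<^sub>\<int> b" for a a' :: 'a and b :: 'b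
    unfolding tens.abs_eq plus_tensor.abs_eq tensor.abs_eq_iff tensor_rel_def tensor_null_def
    by (rule zmod.span_base, rule UnI1) (auto simp: algebra_simps)
  moreover have "a \<otimes>\<^sub>\<int> (b + b') = a \<otimes>\<^sub>\<int> b + a \<otimes>\<^sub>\<int> b'" for a :: 'a and b b' :: 'b
    unfolding tens.abs_eq plus_tensor.abs_eq tensor.abs_eq_iff tensor_rel_def tensor_null_def
    by (rule zmod.span_base, rule UnI2) (auto simp: algebra_simps)
  ultimately show ?thesis by (simp add: biadditive_def Modules.additive_def)
qed

lemma additive_tens_left: "Modules.additive (\<lambda>a. a \<otimes>\<^sub>\<int> b)"
  and additive_tens_right: "Modules.additive (\<lambda>b. a \<otimes>\<^sub>\<int> b)"
  using biadditive_tens by (auto simp: biadditive_def)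

lemmas tens_add_left = additive.add[OF additive_tens_left]
  and tens_add_right = additive.add[OF additive_tens_right]
  and tens_zero_left [simp] = additive.zero[OF additive_tens_left]
  and tens_zero_right [simp] = additive.zero[OF additive_tens_right]
  and tens_sum_left = additive.sum[OF additive_tens_left]
  and tens_sum_right = additive.sum[OF additive_tens_right]
  and tens_zmult_left = zmult_hom[OF additive_tens_left]
  and tens_zmult_right = zmult_hom[OF additive_tens_right]

text \<open>A tensor is the class of an integer combination of symbols, and such combinations arise
  from single symbols by differences, which cover sums and negatives at once.\<close>

lemma tensor_induct [case_names zero tens diff]:
  assumes "P 0" "\<And>a b. P (a \<otimes>\<^sub>\<int> b)" "\<And>s t. P s \<Longrightarrow> P t \<Longrightarrow> P (s - t)"
  shows "P t"
proof -
  obtain x where "t = abs_tensor x"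
    by (rule that[OF Quotient3_abs_rep[OF Quotient3_tensor, symmetric]])
  moreover have "P (abs_tensor x)"
  proof (rule frag_induction[of x UNIV "\<lambda>x. P (abs_tensor x)"])
    show "P (abs_tensor 0)" using assms(1) by (simp add: zero_tensor_def)
    show "P (abs_tensor (frag_of ab))" for ab
      using assms(2) by (cases ab) (simp add: tens.abs_eq)
    show "P (abs_tensor (a - b))" if "P (abs_tensor a)" "P (abs_tensor b)" for a b
      using assms(3)[OF that] by (simp add: minus_tensor.abs_eq)
  qed simp
  ultimately show ?thesis by simp
qed

lemma tensor_ext:
  assumes "Modules.additive f" "Modules.additive g" "\<And>a b. f (a \<otimes>\<^sub>\<int> b) = g (a \<otimes>\<^sub>\<int> b)"
  shows "f t = g t"
proof -
  interpret f: additive f by fact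
  interpret g: additive g by fact
  show ?thesis
    by (induction t rule: tensor_induct) (simp_all add: f.zero g.zero f.diff g.diff assms(3))
qed

lemma biadditiveI:
  assumes "\<And>a a' b. f (a + a') b = f a b + f a' b" "\<And>a b b'. f a (b + b') = f a b + f a b'"
  shows "biadditive f"
  using assms by (simp add: biadditive_def Modules.additive_def)

text \<open>\<open>tensor_lift\<close> is meaningful for biadditive maps only, so a nested lift can
  be evaluated only once its inner lift is known to be additive in the outer variables. Here two
  additive maps in \<open>t\<close> are compared on pure tensors.\<close>

lemma additive_tensor_lift_param:
  assumes "\<And>s. biadditive (f s)" "\<And>a b. Modules.additive (\<lambda>s. f s a b)"
  shows "Modules.additive (\<lambda>s. tensor_lift (f s) t)"
proof
  fix s s'
  show "tensor_lift (f (s + s')) t = tensor_lift (f s) t + tensor_lift (f s') t"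
  proof (rule tensor_ext)
    show "Modules.additive (tensor_lift (f (s + s')))"
      by (rule additive_tensor_lift[OF assms(1)])
    show "Modules.additive (\<lambda>t. tensor_lift (f s) t + tensor_lift (f s') t)"
      by (intro additive_plus additive_tensor_lift assms(1))
    show "tensor_lift (f (s + s')) (a \<otimes>\<^sub>\<int> b) =
        tensor_lift (f s) (a \<otimes>\<^sub>\<int> b) + tensor_lift (f s') (a \<otimes>\<^sub>\<int> b)" for a b
      unfolding tensor_lift_tens[OF assms(1)] by (rule additive.add[OF assms(2)])
  qed
qed

lemma biadditive_tensor_lift:
  assumes "\<And>c. biadditive (f c)" "\<And>a b. Modules.additive (\<lambda>c. f c a b)"
  shows "biadditive (\<lambda>t c. tensor_lift (f c) t)"
  using additive_tensor_lift[OF assms(1)] additive_tensor_lift_param[OF assms]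
  by (simp add: biadditive_def)

text \<open>The functional dual to a tensor of two basis elements is the product of their dual
  functionals.\<close>

lemma zdual_tensor_basis:
  assumes "zdual bs \<phi>" "zdual cs \<psi>"
  shows "zdual (tensor_basis bs cs)
    (\<lambda>k. tensor_lift (\<lambda>a b. \<phi> (k div length cs) a * \<psi> (k mod length cs) b))"
proof -
  let ?n = "length cs"
  have len: "length (tensor_basis bs cs) = length bs * ?n"
    by (simp add: tensor_basis_def length_concat_map)
  have dm: "k div ?n < length bs" "k mod ?n < ?n" if "k < length bs * ?n" for k
    using div_mod_less[OF that] by simp_all
  have bi: "biadditive (\<lambda>a b. \<phi> (k div ?n) a * \<psi> (k mod ?n) b)" if "k < length bs * ?n" for k
    using dm[OF that] assms
    by (intro biadditiveI) (auto simp: zdual_def Modules.additive_def algebra_simps)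
  have dmi: "k div ?n = l div ?n \<and> k mod ?n = l mod ?n \<longleftrightarrow> k = l" for k l
    by (metis div_mult_mod_eq)
  show ?thesis
    unfolding zdual_def len
  proof (intro conjI allI impI)
    fix k l assume kl: "k < length bs * ?n" "l < length bs * ?n"
    have "tensor_basis bs cs ! l = bs ! (l div ?n) \<otimes>\<^sub>\<int> cs ! (l mod ?n)"
      using kl by (simp add: tensor_basis_def nth_concat_map)
    with kl show "tensor_lift (\<lambda>a b. \<phi> (k div ?n) a * \<psi> (k mod ?n) b) (tensor_basis bs cs ! l) =
        (if k = l then 1 else 0)"
      using assms dm[of k] dm[of l] dmi[of k l]
      by (auto simp: tensor_lift_tens[OF bi] zdual_def)
  qed (rule additive_tensor_lift[OF bi])
qed

lemma zexpand_tensor_basis: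
  assumes "zdual bs \<phi>" "zdual cs \<psi>" "\<And>x. zexpand bs \<phi> x" "\<And>y. zexpand cs \<psi> y"
  shows "zexpand (tensor_basis bs cs)
    (\<lambda>k. tensor_lift (\<lambda>a b. \<phi> (k div length cs) a * \<psi> (k mod length cs) b)) t"
proof -
  let ?n = "length cs"
  let ?F = "\<lambda>k. tensor_lift (\<lambda>a b. \<phi> (k div ?n) a * \<psi> (k mod ?n) b)"
  have len: "length (tensor_basis bs cs) = length bs * ?n"
    by (simp add: tensor_basis_def length_concat_map)
  have dm: "k div ?n < length bs" "k mod ?n < ?n" if "k < length bs * ?n" for k
    using div_mod_less[OF that] by simp_all
  have bi: "biadditive (\<lambda>a b. \<phi> (k div ?n) a * \<psi> (k mod ?n) b)" if "k < length bs * ?n" for k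
    using dm[OF that] assms(1,2)
    by (intro biadditiveI) (auto simp: zdual_def Modules.additive_def algebra_simps)
  have add: "Modules.additive (?F k)" if "k < length bs * ?n" for k
    by (rule additive_tensor_lift[OF bi[OF that]])
  have "t = (\<Sum>k<length bs * ?n. zmult (?F k t) (tensor_basis bs cs ! k))"
  proof (rule tensor_ext[where f = "\<lambda>t. t"])
    show "Modules.additive (\<lambda>t. t :: ('a, 'b) tensor)" by (simp add: Modules.additive_def)
    show "Modules.additive (\<lambda>t. \<Sum>k<length bs * ?n. zmult (?F k t) (tensor_basis bs cs ! k))"
      by (rule additive_sum_fun) (simp add: Modules.additive_def additive.add[OF add] zmult_add_left)
    fix a b
    have "a \<otimes>\<^sub>\<int> b = (\<Sum>i<length bs. zmult (\<phi> i a) (bs ! i)) \<otimes>\<^sub>\<int> (\<Sum>j<?n. zmult (\<psi> j b) (cs ! j))"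
      using assms(3)[of a] assms(4)[of b] unfolding zexpand_def by simp
    also have "\<dots> = (\<Sum>i<length bs. \<Sum>j<?n. zmult (\<phi> i a * \<psi> j b) (bs ! i \<otimes>\<^sub>\<int> cs ! j))"
      unfolding tens_sum_left
      by (simp add: tens_sum_right tens_zmult_left tens_zmult_right zmult_zmult
          zmod.scale_sum_right mult.commute)
    also have "\<dots> = (\<Sum>k<length bs * ?n. zmult (\<phi> (k div ?n) a * \<psi> (k mod ?n) b)
        (bs ! (k div ?n) \<otimes>\<^sub>\<int> cs ! (k mod ?n)))"
      by (rule sum_div_mod[symmetric])
    also have "\<dots> = (\<Sum>k<length bs * ?n. zmult (?F k (a \<otimes>\<^sub>\<int> b)) (tensor_basis bs cs ! k))"
      by (rule sum.cong) (auto simp: tensor_lift_tens[OF bi] tensor_basis_def nth_concat_map)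
    finally show "a \<otimes>\<^sub>\<int> b = \<dots>" .
  qed
  then show ?thesis by (simp add: zexpand_def len)
qed

lemma zdual_hom_basis:
  assumes "zbasis bs" "zbasis cs"
  shows "zdual (hom_basis bs cs) (\<lambda>k f. crd cs (k mod length cs) (f (bs ! (k div length cs))))"
proof -
  let ?n = "length cs"
  have len: "length (hom_basis bs cs) = length bs * ?n"
    by (simp add: hom_basis_def length_concat_map)
  have dm: "k div ?n < length bs" "k mod ?n < ?n" if "k < length bs * ?n" for k
    using div_mod_less[OF that] by simp_all
  have dmi: "k div ?n = l div ?n \<and> k mod ?n = l mod ?n \<longleftrightarrow> k = l" for k l
    by (metis div_mult_mod_eq)
  note b = zbasis_dual[OF assms(1)] and c = zbasis_dual[OF assms(2)]
  show ?thesis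
    unfolding zdual_def len
  proof (intro conjI allI impI)
    fix k assume "k < length bs * ?n"
    then show "Modules.additive (\<lambda>f. crd cs (k mod ?n) (f (bs ! (k div ?n))))"
      using additive_crd[OF assms(2) dm(2)] by (simp add: Modules.additive_def)
  next
    fix k l assume kl: "k < length bs * ?n" "l < length bs * ?n"
    have "(hom_basis bs cs ! l) x = zmult (crd bs (l div ?n) x) (cs ! (l mod ?n))" for x
      using kl by (simp add: hom_basis_def nth_concat_map crd_def)
    then show "crd cs (k mod ?n) ((hom_basis bs cs ! l) (bs ! (k div ?n))) = (if k = l then 1 else 0)"
      using b c dm[OF kl(1)] dm[OF kl(2)] dmi[of k l]
      by (auto simp: zdual_def zmult_hom[OF additive_crd[OF assms(2)]] zmult_int)
  qed
qed

text \<open>An additive map is determined by its values on \<open>bs\<close>; expanding these values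
  in \<open>cs\<close> produces the elementary homomorphisms.\<close>

lemma zexpand_hom_basis:
  assumes "zbasis bs" "zbasis cs" "Modules.additive f"
  shows "zexpand (hom_basis bs cs) (\<lambda>k f. crd cs (k mod length cs) (f (bs ! (k div length cs)))) f"
proof -
  let ?n = "length cs"
  have len: "length (hom_basis bs cs) = length bs * ?n"
    by (simp add: hom_basis_def length_concat_map)
  have expand: "f x = (\<Sum>k<length bs * ?n.
      zmult (crd cs (k mod ?n) (f (bs ! (k div ?n)))) ((hom_basis bs cs ! k) x))" for x
  proof -
    have "f x = f (\<Sum>i<length bs. zmult (crd bs i x) (bs ! i))"
      using zbasis_expand[OF assms(1), of x] by (simp add: zexpand_def)
    also have "\<dots> = (\<Sum>i<length bs. zmult (crd bs i x) (f (bs ! i)))"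
      by (simp add: additive.sum[OF assms(3)] zmult_hom[OF assms(3)])
    also have "\<dots> = (\<Sum>i<length bs. zmult (crd bs i x)
        (\<Sum>j<?n. zmult (crd cs j (f (bs ! i))) (cs ! j)))"
      using zbasis_expand[OF assms(2)] by (simp add: zexpand_def)
    also have "\<dots> = (\<Sum>i<length bs. \<Sum>j<?n. zmult (crd cs j (f (bs ! i))) (zmult (crd bs i x) (cs ! j)))"
      by (simp add: zmod.scale_sum_right zmult_zmult mult.commute)
    also have "\<dots> = (\<Sum>k<length bs * ?n. zmult (crd cs (k mod ?n) (f (bs ! (k div ?n))))
        (zmult (crd bs (k div ?n) x) (cs ! (k mod ?n))))"
      by (rule sum_div_mod[symmetric])
    also have "\<dots> = (\<Sum>k<length bs * ?n.
      zmult (crd cs (k mod ?n) (f (bs ! (k div ?n)))) ((hom_basis bs cs ! k) x))"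
      by (rule sum.cong) (auto simp: hom_basis_def nth_concat_map crd_def)
    finally show ?thesis .
  qed
  show ?thesis
    unfolding zexpand_def len by (rule ext, unfold fun_sum_apply zmult_apply, rule expand)
qed

lemma zdual_pair:
  assumes "zdual bs \<phi>" "zdual cs \<psi>"
  shows "zdual (map (\<lambda>u. (u, 0)) bs @ map (\<lambda>v. (0, v)) cs)
    (\<lambda>k p. if k < length bs then \<phi> k (fst p) else \<psi> (k - length bs) (snd p))"
proof -
  have "\<phi> i 0 = 0" if "i < length bs" for i
    using assms(1) that by (simp add: zdual_def additive.zero)
  moreover have "\<psi> i 0 = 0" if "i < length cs" for i
    using assms(2) that by (simp add: zdual_def additive.zero)
  ultimately show ?thesis
    using assms by (auto simp: zdual_def Modules.additive_def nth_append)
qed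

lemma sum_lessThan_add: "(\<Sum>i<m + n. f i) = (\<Sum>i<m. f i) + (\<Sum>i<n. f (m + i :: nat))"
  by (induction n) (auto simp: add.assoc)

lemma zexpand_pair:
  assumes "zexpand bs \<phi> x" "zexpand cs \<psi> y"
  shows "zexpand (map (\<lambda>u. (u, 0)) bs @ map (\<lambda>v. (0, v)) cs)
    (\<lambda>k p. if k < length bs then \<phi> k (fst p) else \<psi> (k - length bs) (snd p)) (x, y)"
proof -
  have a: "Modules.additive (\<lambda>u. (u, 0) :: 'a \<times> 'b)" "Modules.additive (\<lambda>v. (0, v) :: 'a \<times> 'b)"
    by (simp_all add: Modules.additive_def)
  have "(x, 0 :: 'b) = (\<Sum>i<length bs. zmult (\<phi> i x) (bs ! i), 0)"
    using assms(1) by (simp add: zexpand_def)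
  also have "\<dots> = (\<Sum>i<length bs. zmult (\<phi> i x) (bs ! i, 0))"
    by (simp only: additive.sum[OF a(1)] zmult_hom[OF a(1)])
  finally have x: "(x, 0) = (\<Sum>i<length bs. zmult (\<phi> i x) (bs ! i, 0 :: 'b))" .
  have "(0 :: 'a, y) = (0, \<Sum>i<length cs. zmult (\<psi> i y) (cs ! i))"
    using assms(2) by (simp add: zexpand_def)
  also have "\<dots> = (\<Sum>i<length cs. zmult (\<psi> i y) (0, cs ! i))"
    by (simp only: additive.sum[OF a(2)] zmult_hom[OF a(2)])
  finally have y: "(0, y) = (\<Sum>i<length cs. zmult (\<psi> i y) (0 :: 'a, cs ! i))" .
  have "(x, y) = (x, 0) + (0, y)" by simp
  also have "\<dots> = (\<Sum>i<length bs. zmult (\<phi> i x) (bs ! i, 0)) + (\<Sum>i<length cs. zmult (\<psi> i y) (0, cs ! i))"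
    unfolding x y ..
  finally have xy: "(x, y) = \<dots>" .
  show ?thesis
    unfolding zexpand_def length_append length_map sum_lessThan_add
    by (rule trans[OF xy]) (simp add: nth_append)
qed

section \<open>Scalar extension and the matrices of the two maps\<close>

lemma biadditive_kscale: "biadditive (\<lambda>x a. x \<otimes>\<^sub>\<int> (c * a :: 'k::field))"
  by (rule biadditiveI) (simp_all add: tens_add_left tens_add_right algebra_simps)

lemma kscale_tens [simp]: "kscale c (x \<otimes>\<^sub>\<int> a) = x \<otimes>\<^sub>\<int> (c * a)"
  unfolding kscale_def by (rule tensor_lift_tens[OF biadditive_kscale])

lemma additive_kscale: "Modules.additive (kscale c)"
  unfolding kscale_def by (rule additive_tensor_lift[OF biadditive_kscale])

lemmas kscale_add_right = additive.add[OF additive_kscale]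
  and kscale_zero [simp] = additive.zero[OF additive_kscale]

lemma kscale_kscale [simp]: "kscale c (kscale d x) = kscale (c * d) x"
  by (rule tensor_ext) (simp_all add: additive_comp additive_kscale mult.assoc)

lemma kscale_1 [simp]: "kscale 1 x = x"
  by (rule tensor_ext) (simp_all add: additive_kscale additive_id)

lemma kscale_add_left: "kscale (c + d) x = kscale c x + kscale d x"
  by (rule tensor_ext)
    (simp_all add: additive_plus additive_kscale distrib_right tens_add_right)

text \<open>The coordinate functional for the basis \<open>b \<otimes>\<^sub>\<int> 1\<close> of the
  scalar extension.\<close>

definition kcrd :: "'a::ab_group_add list \<Rightarrow> nat \<Rightarrow> ('a, 'k::field) tensor \<Rightarrow> 'k" where
  "kcrd bs i = tensor_lift (\<lambda>x a. of_int (crd bs i x) * a)"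

context
  fixes bs :: "'a::ab_group_add list"
  assumes bs: "zbasis bs"
begin

lemma biadditive_kcrd: "i < length bs \<Longrightarrow> biadditive (\<lambda>x a. of_int (crd bs i x) * (a :: 'k::field))"
  using additive_crd[OF bs] by (intro biadditiveI) (simp_all add: Modules.additive_def algebra_simps)

lemma kcrd_tens: "i < length bs \<Longrightarrow> kcrd bs i (x \<otimes>\<^sub>\<int> a) = of_int (crd bs i x) * a"
  unfolding kcrd_def by (rule tensor_lift_tens[OF biadditive_kcrd])

lemma additive_kcrd: "i < length bs \<Longrightarrow> Modules.additive (kcrd bs i)"
  unfolding kcrd_def by (rule additive_tensor_lift[OF biadditive_kcrd])

lemma kcrd_kscale:
  assumes "i < length bs"
  shows "kcrd bs i (kscale c x) = c * kcrd bs i x"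
proof (rule tensor_ext)
  show "Modules.additive (\<lambda>x. kcrd bs i (kscale c x))"
    by (rule additive_comp[OF additive_kcrd[OF assms] additive_kscale])
  show "Modules.additive (\<lambda>x. c * kcrd bs i x)"
    by (rule additive_cmult[OF additive_kcrd[OF assms]])
qed (simp add: kcrd_tens assms)

lemma kcrd_expand: "x = (\<Sum>i<length bs. bs ! i \<otimes>\<^sub>\<int> kcrd bs i x)"
proof (rule tensor_ext[where f = "\<lambda>x. x"])
  show "Modules.additive (\<lambda>x. \<Sum>i<length bs. bs ! i \<otimes>\<^sub>\<int> kcrd bs i x)"
    by (rule additive_sum_fun) (simp add: additive_comp[OF additive_tens_right additive_kcrd])
  fix u :: 'a and a :: 'b
  \<comment> \<open>An integer coefficient crosses the tensor sign and becomes multiplication by its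
    image in the field.\<close>
  have zm: "zmult n b \<otimes>\<^sub>\<int> a = b \<otimes>\<^sub>\<int> (of_int n * a)" for n and b :: 'a
    by (metis tens_zmult_left tens_zmult_right zmult_field)
  have "u \<otimes>\<^sub>\<int> a = (\<Sum>i<length bs. zmult (crd bs i u) (bs ! i)) \<otimes>\<^sub>\<int> a"
    using zbasis_expand[OF bs, of u] by (simp add: zexpand_def)
  also have "\<dots> = (\<Sum>i<length bs. bs ! i \<otimes>\<^sub>\<int> kcrd bs i (u \<otimes>\<^sub>\<int> a))"
    by (simp add: tens_sum_left zm kcrd_tens)
  finally show "u \<otimes>\<^sub>\<int> a = \<dots>" .
qed (rule additive_id)

lemma kcrd_eqI:
  assumes "\<And>i. i < length bs \<Longrightarrow> kcrd bs i s = kcrd bs i t"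
  shows "s = t"
proof -
  have "(\<Sum>i<length bs. bs ! i \<otimes>\<^sub>\<int> kcrd bs i s) = (\<Sum>i<length bs. bs ! i \<otimes>\<^sub>\<int> kcrd bs i t)"
    using assms by simp
  then show ?thesis by (simp only: kcrd_expand[symmetric])
qed

lemma crd_nth: "i < length bs \<Longrightarrow> j < length bs \<Longrightarrow> crd bs i (bs ! j) = (if i = j then 1 else 0)"
  using zbasis_dual[OF bs] by (simp add: zdual_def)

end

lemma length_tensor_basis: "length (tensor_basis bs cs) = length bs * length cs"
  by (simp add: tensor_basis_def length_concat_map)

lemma tensor_basis_nth:
  "a < length bs \<Longrightarrow> b < length cs \<Longrightarrow> tensor_basis bs cs ! (a * length cs + b) = bs ! a \<otimes>\<^sub>\<int> cs ! b"
  by (simp add: tensor_basis_def nth_concat_map mult_add_less mult_add_div_mod)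

section \<open>Structure constants and the entries of the two matrices\<close>

locale ternary =
  fixes bE :: "'e::ab_group_add list" and bW :: "'w::ab_group_add list"
    and \<mu> :: "'e tensor3 \<Rightarrow> 'w"
  assumes bE: "zbasis bE" and bW: "zbasis bW" and mu: "Modules.additive \<mu>" and surj: "surj \<mu>"
begin

abbreviation "ne \<equiv> length bE"
abbreviation "nw \<equiv> length bW"

text \<open>The structure constants of \<mu>. Every entry of either matrix is 0 or one of them up to
  sign, which ties the matrices to the ternary product over any field.\<close>

definition mcoef :: "nat \<Rightarrow> nat \<Rightarrow> nat \<Rightarrow> nat \<Rightarrow> int" where
  "mcoef a b c j = crd bW j (\<mu> (bE ! a \<otimes>\<^sub>\<int> bE ! b \<otimes>\<^sub>\<int> bE ! c))"

lemmas mu_add = additive.add[OF mu]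

lemma mu_additive3: "Modules.additive (\<lambda>c. \<mu> (a \<otimes>\<^sub>\<int> b \<otimes>\<^sub>\<int> c))"
  by (simp add: Modules.additive_def tens_add_left tens_add_right mu_add)

lemma Theta_tens: "Theta \<mu> (a \<otimes>\<^sub>\<int> b) = (\<lambda>c. \<mu> (a \<otimes>\<^sub>\<int> b \<otimes>\<^sub>\<int> c))"
  unfolding Theta_def
  by (rule tensor_lift_tens, rule biadditiveI) (simp_all add: fun_eq_iff mu_add tens_add_left tens_add_right)

text \<open>Evaluation peels the lifts from the outside, so biadditivity is established for the
  innermost one first and passed outwards.\<close>

lemma Bmap_tens:
  "Bmap \<mu> (a \<otimes>\<^sub>\<int> b \<otimes>\<^sub>\<int> c \<otimes>\<^sub>\<int> d) =
    (\<mu> (a \<otimes>\<^sub>\<int> b \<otimes>\<^sub>\<int> c) \<otimes>\<^sub>\<int> d, - (a \<otimes>\<^sub>\<int> \<mu> (b \<otimes>\<^sub>\<int> c \<otimes>\<^sub>\<int> d)))"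
proof -
  let ?f = "\<lambda>c d a b. (\<mu> (a \<otimes>\<^sub>\<int> b \<otimes>\<^sub>\<int> c) \<otimes>\<^sub>\<int> d, - (a \<otimes>\<^sub>\<int> \<mu> (b \<otimes>\<^sub>\<int> c \<otimes>\<^sub>\<int> d)))"
  have 1: "biadditive (?f c d)" for c d
    by (rule biadditiveI) (simp_all add: mu_add tens_add_left tens_add_right)
  have c: "Modules.additive (\<lambda>c. ?f c d a b)" and d: "Modules.additive (\<lambda>d. ?f c d a b)" for a b c d
    by (simp_all add: Modules.additive_def mu_add tens_add_left tens_add_right)
  have 2: "biadditive (\<lambda>ab c. tensor_lift (?f c d) ab)" for d
    by (rule biadditive_tensor_lift[OF 1 c])
  have 3: "biadditive (\<lambda>abc d. tensor_lift (\<lambda>ab c. tensor_lift (?f c d) ab) abc)"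
    by (rule biadditive_tensor_lift[OF 2]) (rule additive_tensor_lift_param[OF 1 d])
  show ?thesis
    unfolding Bmap_def
    by (simp only: tensor_lift_tens[OF 3] tensor_lift_tens[OF 2] tensor_lift_tens[OF 1])
qed

lemma dim_Theta_mat [simp]: "dim_row (Theta_mat bE bW \<mu>) = ne * nw" "dim_col (Theta_mat bE bW \<mu>) = ne * ne"
  by (simp_all add: Theta_mat_def zmatrix_def length_tensor_basis hom_basis_def length_concat_map)

lemma Theta_mat_index:
  assumes "a < ne" "b < ne" "c < ne" "j < nw"
  shows "Theta_mat bE bW \<mu> $$ (c * nw + j, a * ne + b) = mcoef a b c j"
proof -
  have r: "c * nw + j < ne * nw" and s: "a * ne + b < ne * ne" using assms by (simp_all add: mult_add_less)
  have len: "length (hom_basis bE bW) = ne * nw"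
    by (simp add: hom_basis_def length_concat_map)
  have add: "Modules.additive (Theta \<mu> (bE ! a \<otimes>\<^sub>\<int> bE ! b))"
    unfolding Theta_tens by (rule mu_additive3)
  have "Theta_mat bE bW \<mu> $$ (c * nw + j, a * ne + b) =
      zmod.representation (set (hom_basis bE bW)) (Theta \<mu> (bE ! a \<otimes>\<^sub>\<int> bE ! b)) (hom_basis bE bW ! (c * nw + j))"
    using r s assms by (simp add: Theta_mat_def zmatrix_def length_tensor_basis len tensor_basis_nth)
  also have "\<dots> = crd bW ((c * nw + j) mod nw) (Theta \<mu> (bE ! a \<otimes>\<^sub>\<int> bE ! b) (bE ! ((c * nw + j) div nw)))"
    by (rule zdual_representation[OF zdual_hom_basis[OF bE bW] zexpand_hom_basis[OF bE bW add]])
      (simp add: len r)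
  also have "\<dots> = mcoef a b c j"
    using assms by (simp add: Theta_tens mcoef_def mult_add_div_mod)
  finally show ?thesis .
qed

lemma dim_B_mat [simp]: "dim_row (B_mat bE bW \<mu>) = nw * ne + ne * nw" "dim_col (B_mat bE bW \<mu>) = ne * ne * ne * ne"
  by (simp_all add: B_mat_def zmatrix_def length_tensor_basis)

text \<open>The position of a pure tensor of four basis elements in the fourfold
  \<open>tensor_basis\<close>, which is nested to the left.\<close>

definition ix4 :: "nat \<Rightarrow> nat \<Rightarrow> nat \<Rightarrow> nat \<Rightarrow> nat" where
  "ix4 a b c d = ((a * ne + b) * ne + c) * ne + d"

lemma ix4_less: "a < ne \<Longrightarrow> b < ne \<Longrightarrow> c < ne \<Longrightarrow> d < ne \<Longrightarrow> ix4 a b c d < ne * ne * ne * ne"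
  by (simp add: ix4_def mult_add_less)

text \<open>The first \<open>nw * ne\<close> rows are the coordinates on W \<otimes> E, the
  remaining ones those on E \<otimes> W; the sign in the lower block is that of the second component
  of B.\<close>

lemma B_mat_index:
  assumes "a < ne" "b < ne" "c < ne" "d < ne"
  shows "j < nw \<Longrightarrow> i < ne \<Longrightarrow> B_mat bE bW \<mu> $$ (j * ne + i, ix4 a b c d) =
      (if i = d then mcoef a b c j else 0)"
    and "j < nw \<Longrightarrow> i < ne \<Longrightarrow> B_mat bE bW \<mu> $$ (nw * ne + (i * nw + j), ix4 a b c d) =
      (if i = a then - mcoef b c d j else 0)"
proof -
  let ?rows = "map (\<lambda>u. (u, 0)) (tensor_basis bW bE) @ map (\<lambda>v. (0, v)) (tensor_basis bE bW)"
  let ?\<phi> = "\<lambda>k. tensor_lift (\<lambda>x y. crd bW (k div ne) x * crd bE (k mod ne) y)"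
  let ?\<psi> = "\<lambda>k. tensor_lift (\<lambda>x y. crd bE (k div nw) x * crd bW (k mod nw) y)"
  note dE = zbasis_dual[OF bE] and dW = zbasis_dual[OF bW]
    and eE = zbasis_expand[OF bE] and eW = zbasis_expand[OF bW]
  let ?x = "\<mu> (bE ! a \<otimes>\<^sub>\<int> bE ! b \<otimes>\<^sub>\<int> bE ! c) \<otimes>\<^sub>\<int> bE ! d"
  let ?y = "- (bE ! a \<otimes>\<^sub>\<int> \<mu> (bE ! b \<otimes>\<^sub>\<int> bE ! c \<otimes>\<^sub>\<int> bE ! d))"
  have entry: "B_mat bE bW \<mu> $$ (r, ix4 a b c d) =
      (if r < nw * ne then ?\<phi> r ?x else ?\<psi> (r - nw * ne) ?y)" if "r < nw * ne + ne * nw" for r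
  proof -
    have "tensor_basis (tensor_basis (tensor_basis bE bE) bE) bE ! ix4 a b c d =
        bE ! a \<otimes>\<^sub>\<int> bE ! b \<otimes>\<^sub>\<int> bE ! c \<otimes>\<^sub>\<int> bE ! d"
      using assms by (simp add: ix4_def tensor_basis_nth length_tensor_basis mult_add_less)
    then have "B_mat bE bW \<mu> $$ (r, ix4 a b c d) = zmod.representation (set ?rows) (?x, ?y) (?rows ! r)"
      using that ix4_less[OF assms]
      by (simp add: B_mat_def zmatrix_def length_tensor_basis Bmap_tens)
    also have "\<dots> = (if r < length (tensor_basis bW bE) then ?\<phi> r (fst (?x, ?y))
        else ?\<psi> (r - length (tensor_basis bW bE)) (snd (?x, ?y)))"
      by (rule zdual_representation[OF zdual_pair[OF zdual_tensor_basis[OF dW dE] zdual_tensor_basis[OF dE dW]]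
            zexpand_pair[OF zexpand_tensor_basis[OF dW dE eW eE] zexpand_tensor_basis[OF dE dW eE eW]]])
        (use that in \<open>simp add: length_tensor_basis\<close>)
    finally show ?thesis by (simp add: length_tensor_basis)
  qed
  have biW: "biadditive (\<lambda>x y. crd bW j x * crd bE i y)" and biE: "biadditive (\<lambda>x y. crd bE i x * crd bW j y)"
    if "j < nw" "i < ne" for i j
    using that additive_crd[OF bE, of i] additive_crd[OF bW, of j]
    by (auto intro!: biadditiveI simp: Modules.additive_def algebra_simps)
  show "B_mat bE bW \<mu> $$ (j * ne + i, ix4 a b c d) = (if i = d then mcoef a b c j else 0)"
    if "j < nw" "i < ne"
  proof -
    have lt: "j * ne + i < nw * ne" using that by (simp add: mult_add_less)
    have dm: "(j * ne + i) div ne = j" "(j * ne + i) mod ne = i" using that by (simp_all add: mult_add_div_mod)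
    show ?thesis
      using entry[of "j * ne + i"] lt that assms(4)
      by (simp only: dm if_True tensor_lift_tens[OF biW[OF that]] crd_nth[OF bE] mcoef_def) simp
  qed
  show "B_mat bE bW \<mu> $$ (nw * ne + (i * nw + j), ix4 a b c d) = (if i = a then - mcoef b c d j else 0)"
    if "j < nw" "i < ne"
  proof -
    have lt: "nw * ne + (i * nw + j) < nw * ne + ne * nw" using that by (simp add: mult_add_less)
    have dm: "(i * nw + j) div nw = i" "(i * nw + j) mod nw = j" using that by (simp_all add: mult_add_div_mod)
    have "B_mat bE bW \<mu> $$ (nw * ne + (i * nw + j), ix4 a b c d) = ?\<psi> (i * nw + j) ?y"
      using entry[OF lt] by simp
    also have "\<dots> = - (crd bE i (bE ! a) * crd bW j (\<mu> (bE ! b \<otimes>\<^sub>\<int> bE ! c \<otimes>\<^sub>\<int> bE ! d)))"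
      unfolding dm additive.minus[OF additive_tensor_lift[OF biE[OF that]]]
        tensor_lift_tens[OF biE[OF that]] ..
    finally show ?thesis
      using that assms(1) by (simp add: crd_nth[OF bE] mcoef_def)
  qed
qed

text \<open>All four facts come from one nest of lifts: \<open>?H\<close> is biadditive in the
  innermost pair and additive in each outer argument, and these properties climb through
  \<open>?G\<close> to \<open>?F\<close>.\<close>

lemma sext_facts:
  fixes x :: "('e, 'k::field) tensor"
  shows sext_additive1: "Modules.additive (\<lambda>x. scalar_extension \<mu> x y z :: ('w, 'k) tensor)"
    and sext_additive2: "Modules.additive (\<lambda>y. scalar_extension \<mu> x y z :: ('w, 'k) tensor)"
    and sext_additive3: "Modules.additive (\<lambda>z. scalar_extension \<mu> x y z :: ('w, 'k) tensor)"
    and sext_tens: "scalar_extension \<mu> (x' \<otimes>\<^sub>\<int> a) (y' \<otimes>\<^sub>\<int> b) (z' \<otimes>\<^sub>\<int> (c::'k)) =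
      \<mu> (x' \<otimes>\<^sub>\<int> y' \<otimes>\<^sub>\<int> z') \<otimes>\<^sub>\<int> (a * b * c)"
proof -
  let ?H = "\<lambda>x' (a::'k) y' b z' c. \<mu> (x' \<otimes>\<^sub>\<int> y' \<otimes>\<^sub>\<int> z') \<otimes>\<^sub>\<int> (a * b * c)"
  have H: "biadditive (?H x' a y' b)" for x' a y' b
    by (rule biadditiveI) (simp_all add: mu_add tens_add_left tens_add_right distrib_left)
  have Hx: "Modules.additive (\<lambda>x'. ?H x' a y' b z' c)" and Ha: "Modules.additive (\<lambda>a. ?H x' a y' b z' c)"
    and Hy: "Modules.additive (\<lambda>y'. ?H x' a y' b z' c)" and Hb: "Modules.additive (\<lambda>b. ?H x' a y' b z' c)"
    for x' a y' b z' c
    by (simp_all add: Modules.additive_def mu_add tens_add_left tens_add_right distrib_left distrib_right)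
  let ?G = "\<lambda>x' a y' b z. tensor_lift (?H x' a y' b) z"
  have Gz: "Modules.additive (?G x' a y' b)" for x' a y' b
    by (rule additive_tensor_lift[OF H])
  have G: "biadditive (\<lambda>y' b. ?G x' a y' b z)" for x' a z
    using additive_tensor_lift_param[OF H Hy] additive_tensor_lift_param[OF H Hb]
    by (simp add: biadditive_def)
  have Gx: "Modules.additive (\<lambda>x'. ?G x' a y' b z)" for a y' b z
    by (rule additive_tensor_lift_param[OF H Hx])
  have Ga: "Modules.additive (\<lambda>a. ?G x' a y' b z)" for x' y' b z
    by (rule additive_tensor_lift_param[OF H Ha])
  let ?F = "\<lambda>x' a y z. tensor_lift (\<lambda>y' b. ?G x' a y' b z) y"
  have F: "biadditive (\<lambda>x' a. ?F x' a y z)" for y z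
    using additive_tensor_lift_param[OF G Gx] additive_tensor_lift_param[OF G Ga]
    by (simp add: biadditive_def)
  have Fy: "Modules.additive (\<lambda>y. ?F x' a y z)" for x' a z
    by (rule additive_tensor_lift[OF G])
  have Fz: "Modules.additive (\<lambda>z. ?F x' a y z)" for x' a y
    by (rule additive_tensor_lift_param[OF G Gz])
  show "Modules.additive (\<lambda>x. scalar_extension \<mu> x y z :: ('w, 'k) tensor)"
    unfolding scalar_extension_def by (rule additive_tensor_lift[OF F])
  show "Modules.additive (\<lambda>y. scalar_extension \<mu> x y z :: ('w, 'k) tensor)"
    unfolding scalar_extension_def by (rule additive_tensor_lift_param[OF F Fy])
  show "Modules.additive (\<lambda>z. scalar_extension \<mu> x y z :: ('w, 'k) tensor)"
    unfolding scalar_extension_def by (rule additive_tensor_lift_param[OF F Fz])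
  show "scalar_extension \<mu> (x' \<otimes>\<^sub>\<int> a) (y' \<otimes>\<^sub>\<int> b) (z' \<otimes>\<^sub>\<int> (c::'k)) =
      \<mu> (x' \<otimes>\<^sub>\<int> y' \<otimes>\<^sub>\<int> z') \<otimes>\<^sub>\<int> (a * b * c)"
    unfolding scalar_extension_def
    by (simp only: tensor_lift_tens[OF F], simp only: tensor_lift_tens[OF G],
        simp only: tensor_lift_tens[OF H])
qed

lemma kcrd_sext:
  fixes x :: "('e, 'k::field) tensor"
  assumes j: "j < nw"
  shows "kcrd bW j (scalar_extension \<mu> x y z) = (\<Sum>a<ne. \<Sum>b<ne. \<Sum>c<ne.
    of_int (mcoef a b c j) * (kcrd bE a x * kcrd bE b y * kcrd bE c z))"
proof -
  have "scalar_extension \<mu> x y z = scalar_extension \<mu> (\<Sum>a<ne. bE ! a \<otimes>\<^sub>\<int> kcrd bE a x)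
      (\<Sum>b<ne. bE ! b \<otimes>\<^sub>\<int> kcrd bE b y) (\<Sum>c<ne. bE ! c \<otimes>\<^sub>\<int> kcrd bE c z)"
    by (simp only: kcrd_expand[OF bE, symmetric])
  also have "\<dots> = (\<Sum>a<ne. \<Sum>b<ne. \<Sum>c<ne. \<mu> (bE ! a \<otimes>\<^sub>\<int> bE ! b \<otimes>\<^sub>\<int> bE ! c) \<otimes>\<^sub>\<int>
      (kcrd bE a x * kcrd bE b y * kcrd bE c z))"
    by (simp only: additive.sum[OF sext_additive1], simp only: additive.sum[OF sext_additive2],
        simp only: additive.sum[OF sext_additive3] sext_tens)
  finally show ?thesis
    by (simp only: additive.sum[OF additive_kcrd[OF bW j]] kcrd_tens[OF bW j] mcoef_def)
qed

lemma kscale_sext: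
  fixes x :: "('e, 'k::field) tensor"
  shows
  "kscale c (scalar_extension \<mu> x y z) = scalar_extension \<mu> (kscale c x) y z"
  "kscale c (scalar_extension \<mu> x y z) = scalar_extension \<mu> x (kscale c y) z"
  "kscale c (scalar_extension \<mu> x y z) = scalar_extension \<mu> x y (kscale c z)"
  by (rule kcrd_eqI[OF bW], simp add: kcrd_kscale bW bE kcrd_sext sum_distrib_left mult_ac)+

end

section \<open>The tensor product underlying the operator rng\<close>

lemma tscale_tscale [simp]: "tscale c (tscale d x) = tscale (c * d) x"
  and tscale_1 [simp]: "tscale 1 x = x"
  and tscale_add_left: "tscale (c + d) x = tscale c x + tscale d x"
  and tscale_add_right: "tscale c (x + y) = tscale c x + tscale c y"
  by (simp_all add: tscale_def kscale_add_left kscale_add_right)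

lemma additive_tscale: "Modules.additive (tscale c)"
  by (simp add: Modules.additive_def tscale_add_right)

lemmas tscale_zero [simp] = additive.zero[OF additive_tscale]

lemma balanced_op_tens: "balanced_multiadditive op_tens"
proof -
  have *: "abs_op_tensor x = abs_op_tensor y + abs_op_tensor z" if "x - y - z \<in> op_tensor_null" for x y z
    using that by (simp add: plus_op_tensor.abs_eq op_tensor.abs_eq_iff op_tensor_rel_def algebra_simps)
  have **: "abs_op_tensor x = abs_op_tensor y" if "x - y \<in> op_tensor_null" for x y
    using that by (simp add: op_tensor.abs_eq_iff op_tensor_rel_def)
  show ?thesis
    unfolding balanced_multiadditive_def op_tens_def
    by (intro conjI allI; (rule * | rule **); unfold op_tensor_null_def; rule zmod.span_base; fast)
qed

lemmas op_tens_add =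
  balanced_op_tens[unfolded balanced_multiadditive_def, THEN conjunct1, rule_format]
  balanced_op_tens[unfolded balanced_multiadditive_def, THEN conjunct2, THEN conjunct1, rule_format]
  balanced_op_tens[unfolded balanced_multiadditive_def, THEN conjunct2, THEN conjunct2, THEN conjunct1,
    rule_format]
  balanced_op_tens[unfolded balanced_multiadditive_def, THEN conjunct2, THEN conjunct2, THEN conjunct2,
    THEN conjunct1, rule_format]

lemma op_tens_balance:
  "op_tens (tscale c a) \<alpha> b \<beta> = op_tens a (c * \<alpha>) b \<beta>"
  "op_tens a \<alpha> (tscale c b) \<beta> = op_tens a (c * \<alpha>) b \<beta>"
  "op_tens a \<alpha> b (c * \<beta>) = op_tens a (c * \<alpha>) b \<beta>"
  using balanced_op_tens[unfolded balanced_multiadditive_def] by metis+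

text \<open>As \<Gamma> = k, the fourfold tensor product is just T \<otimes> T; a pure tensor is
  normalised by putting 1 into both scalar slots.\<close>

definition ptens :: "('e::ab_group_add, 'w::ab_group_add, 'k::field) tspace \<Rightarrow> ('e, 'w, 'k) tspace \<Rightarrow>
    ('e, 'w, 'k) op_tensor" where
  "ptens x y = op_tens x 1 y 1"

lemma op_tens_eq_ptens: "op_tens a \<alpha> b \<beta> = ptens (tscale (\<alpha> * \<beta>) a) b"
proof -
  have "op_tens a \<alpha> b \<beta> = op_tens a \<alpha> b (\<beta> * 1)" by simp
  also have "\<dots> = op_tens a ((\<alpha> * \<beta>) * 1) b 1"
    unfolding op_tens_balance(3) by (simp add: mult.commute)
  also have "\<dots> = ptens (tscale (\<alpha> * \<beta>) a) b"
    unfolding ptens_def op_tens_balance(1) ..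
  finally show ?thesis .
qed

lemma additive_ptens1: "Modules.additive (\<lambda>x. ptens x y)"
  and additive_ptens2: "Modules.additive (ptens x)"
  by (simp_all add: Modules.additive_def ptens_def op_tens_add)

lemma ptens_tscale_right: "ptens x (tscale c y) = ptens (tscale c x) y"
  by (simp only: ptens_def op_tens_balance)

lemmas ptens_add_left = additive.add[OF additive_ptens1]
  and ptens_add_right = additive.add[OF additive_ptens2]
  and ptens_zero_left [simp] = additive.zero[OF additive_ptens1]
  and ptens_zero_right [simp] = additive.zero[OF additive_ptens2]
  and ptens_sum_left = additive.sum[OF additive_ptens1]
  and ptens_sum_right = additive.sum[OF additive_ptens2]

lemma op_tensor_induct [case_names zero ptens diff]:
  assumes "P 0" "\<And>x y. P (ptens x y)" "\<And>s t. P s \<Longrightarrow> P t \<Longrightarrow> P (s - t)"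
  shows "P t"
proof -
  obtain x where "t = abs_op_tensor x"
    by (rule that[OF Quotient3_abs_rep[OF Quotient3_op_tensor, symmetric]])
  moreover have "P (abs_op_tensor x)"
  proof (rule frag_induction[of x UNIV "\<lambda>x. P (abs_op_tensor x)"])
    show "P (abs_op_tensor 0)" using assms(1) by (simp add: zero_op_tensor_def)
    show "P (abs_op_tensor (frag_of u))" for u
    proof -
      obtain a \<alpha> b \<beta> where "u = (a, \<alpha>, b, \<beta>)" by (cases u) auto
      then have "abs_op_tensor (frag_of u) = op_tens a \<alpha> b \<beta>" by (simp add: op_tens_def)
      then show ?thesis using assms(2) by (simp add: op_tens_eq_ptens)
    qed
    show "P (abs_op_tensor (a - b))" if "P (abs_op_tensor a)" "P (abs_op_tensor b)" for a b
      using assms(3)[OF that] by (simp add: minus_op_tensor.abs_eq)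
  qed simp
  ultimately show ?thesis by simp
qed

lemma op_tensor_ext:
  assumes "Modules.additive f" "Modules.additive g" "\<And>a b. f (ptens a b) = g (ptens a b)"
  shows "f t = g t"
proof -
  interpret f: additive f by fact
  interpret g: additive g by fact
  show ?thesis
    by (induction t rule: op_tensor_induct) (simp_all add: f.zero g.zero f.diff g.diff assms(3))
qed

text \<open>All scalars can be moved into the first factor, so a balanced map on the four slots
  amounts to a biadditive \<open>g\<close> on T \<times> T across which scalars may pass.\<close>

lemma balanced_multiadditiveI:
  assumes "\<And>a. Modules.additive (g a)" "\<And>b. Modules.additive (\<lambda>a. g a b)"
    and "\<And>c a b. g a (tscale c b) = g (tscale c a) b"
    and "\<And>a \<alpha> b \<beta>. f a \<alpha> b \<beta> = g (tscale (\<alpha> * \<beta>) a) b"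
  shows "balanced_multiadditive f"
  unfolding balanced_multiadditive_def assms(4)
  by (simp add: additive.add[OF assms(1)] additive.add[OF assms(2)] assms(3) tscale_add_right
      tscale_add_left distrib_right distrib_left mult_ac)

lemma balanced_op_scale:
  "balanced_multiadditive (\<lambda>a \<alpha> b \<beta>. op_tens (tscale c a) \<alpha> b \<beta>)"
  by (rule balanced_multiadditiveI[of "\<lambda>a b. ptens (tscale c a) b"])
    (simp_all add: additive_ptens2 additive_comp[OF additive_ptens1 additive_tscale]
      ptens_tscale_right op_tens_eq_ptens mult_ac)

lemma additive_op_scale: "Modules.additive (op_scale c)"
  unfolding op_scale_def by (rule additive_op_lift[OF balanced_op_scale])

lemma op_scale_ptens: "op_scale c (ptens a b) = ptens (tscale c a) b"
  unfolding op_scale_def ptens_def by (rule op_lift_tens[OF balanced_op_scale])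

lemmas op_scale_add_right = additive.add[OF additive_op_scale]
  and op_scale_zero [simp] = additive.zero[OF additive_op_scale]
  and op_scale_diff = additive.diff[OF additive_op_scale]
  and op_scale_sum = additive.sum[OF additive_op_scale]

lemma op_scale_op_scale [simp]: "op_scale c (op_scale d t) = op_scale (c * d) t"
  by (rule op_tensor_ext) (simp_all add: additive_comp additive_op_scale op_scale_ptens)

lemma op_scale_1 [simp]: "op_scale 1 t = t"
  by (rule op_tensor_ext) (simp_all add: additive_op_scale additive_id op_scale_ptens)

lemma op_scale_add_left: "op_scale (c + d) t = op_scale c t + op_scale d t"
  by (rule op_tensor_ext)
    (simp_all add: additive_plus additive_op_scale op_scale_ptens tscale_add_left ptens_add_left)

lemma op_scale_diff_left: "op_scale (c - d) t = op_scale c t - op_scale d t"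
  using op_scale_add_left[of "c - d" d t] by simp

lemma op_scale_0_left [simp]: "op_scale 0 t = 0"
  using op_scale_add_left[of 0 0 t] by simp

lemma op_scale_minus_1: "op_scale (- 1) t = - t"
  using op_scale_add_left[of 1 "- 1" t] by (simp add: eq_neg_iff_add_eq_0 add.commute)

lemma op_tens_eq_op_scale: "op_tens a \<alpha> b \<beta> = op_scale (\<alpha> * \<beta>) (ptens a b)"
  by (simp add: op_scale_ptens op_tens_eq_ptens)

section \<open>Functionals on T \<otimes> T\<close>

definition klinear :: "(('e::ab_group_add, 'w::ab_group_add, 'k::field) tspace \<Rightarrow> 'k) \<Rightarrow> bool" where
  "klinear f \<longleftrightarrow> Modules.additive f \<and> (\<forall>c x. f (tscale c x) = c * f x)"

text \<open>The functional f \<otimes> g, with the entries of the two \<Gamma> slots acting as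
  factors.\<close>

definition pfun :: "(('e::ab_group_add, 'w::ab_group_add, 'k::field) tspace \<Rightarrow> 'k) \<Rightarrow>
    (('e, 'w, 'k) tspace \<Rightarrow> 'k) \<Rightarrow> ('e, 'w, 'k) op_tensor \<Rightarrow> 'k" where
  "pfun f g = op_lift (\<lambda>a \<alpha> b \<beta>. \<alpha> * \<beta> * f a * g b)"

lemma
  assumes "klinear f" "klinear g"
  shows additive_pfun: "Modules.additive (pfun f g)"
    and pfun_ptens: "pfun f g (ptens a b) = f a * g b"
    and pfun_op_scale: "pfun f g (op_scale c t) = c * pfun f g t"
proof -
  note lin = assms[unfolded klinear_def]
  have f: "f (x + y) = f x + f y" "f (tscale c x) = c * f x"
    and g: "g (x + y) = g x + g y" "g (tscale c x) = c * g x" for x y c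
    using lin additive.add[of f] additive.add[of g] by blast+
  have bal: "balanced_multiadditive (\<lambda>a \<alpha> b \<beta>. \<alpha> * \<beta> * f a * g b)"
    by (rule balanced_multiadditiveI[of "\<lambda>a b. f a * g b"])
      ((rule additive.intro)?, simp add: f g algebra_simps)+
  show add: "Modules.additive (pfun f g)"
    unfolding pfun_def by (rule additive_op_lift[OF bal])
  show p: "pfun f g (ptens a b) = f a * g b" for a b
    unfolding pfun_def ptens_def by (simp add: op_lift_tens[OF bal])
  show "pfun f g (op_scale c t) = c * pfun f g t"
  proof (rule op_tensor_ext)
    show "Modules.additive (\<lambda>t. pfun f g (op_scale c t))"
      by (rule additive_comp[OF add additive_op_scale])
    show "Modules.additive (\<lambda>t. c * pfun f g t)" by (rule additive_cmult[OF add])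
  qed (simp add: p op_scale_ptens f)
qed

section \<open>Multiplication and action on pure tensors\<close>

context ternary
begin

abbreviation sext :: "('e, 'w, 'k::field) trilinear" where
  "sext \<equiv> scalar_extension \<mu>"

lemma tprod_facts:
  shows additive_tprod1: "Modules.additive (\<lambda>r. tprod sext r n s m t)"
    and additive_tprod2: "Modules.additive (\<lambda>s. tprod sext r n s m t)"
    and additive_tprod3: "Modules.additive (tprod sext r n s m)"
    and tprod_tscale1: "tprod sext (tscale c r) n s m t = tscale c (tprod sext r n s m t)"
    and tprod_tscale2: "tprod sext r n (tscale c s) m t = tscale c (tprod sext r n s m t)"
    and tprod_tscale3: "tprod sext r n s m (tscale c t) = tscale c (tprod sext r n s m t)"
    and tprod_scalars: "tprod sext r n s m t = tscale (n * m) (tprod sext r 1 s 1 t)"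
    and fst_tprod [simp]: "fst (tprod sext r n s m t) = 0"
  by (simp_all add: tprod_def tscale_def Modules.additive_def kscale_add_right mult_ac
      additive.add[OF sext_additive1] additive.add[OF sext_additive2] additive.add[OF sext_additive3]
      kscale_sext[symmetric])

lemma tprod_zero:
  "fst r = 0 \<Longrightarrow> tprod sext r n s m t = 0"
  "fst s = 0 \<Longrightarrow> tprod sext r n s m t = 0"
  "fst t = 0 \<Longrightarrow> tprod sext r n s m t = 0"
  by (simp_all add: tprod_def additive.zero[OF sext_additive1] additive.zero[OF sext_additive2]
      additive.zero[OF sext_additive3] zero_prod_def)

lemma balanced_op_mult_inner:
  "balanced_multiadditive (\<lambda>c \<gamma> d \<delta>. op_tens (tprod sext a \<alpha> b \<beta> c) \<gamma> d \<delta>)"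
  by (rule balanced_multiadditiveI[of "\<lambda>c d. ptens (tprod sext a \<alpha> b \<beta> c) d"])
    (simp_all add: additive_ptens2 additive_comp[OF additive_ptens1 additive_tprod3]
      ptens_tscale_right op_tens_eq_ptens tprod_tscale3)

lemma op_mult_inner_ptens:
  "op_lift (\<lambda>c \<gamma> d \<delta>. op_tens (tprod sext a \<alpha> b \<beta> c) \<gamma> d \<delta>) (ptens c d) =
    ptens (tprod sext a \<alpha> b \<beta> c) d"
  unfolding ptens_def by (rule op_lift_tens[OF balanced_op_mult_inner])

lemma additive_op_mult_inner:
  "Modules.additive (op_lift (\<lambda>c \<gamma> d \<delta>. op_tens (tprod sext a \<alpha> b \<beta> c) \<gamma> d \<delta>))"
  by (rule additive_op_lift[OF balanced_op_mult_inner])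

text \<open>The values of the outer lift are themselves lifts in the second factor, so additivity in
  \<open>a\<close> and \<open>b\<close> is checked on pure tensors of that factor.\<close>

lemma balanced_op_mult:
  "balanced_multiadditive (\<lambda>a \<alpha> b \<beta>. op_lift (\<lambda>c \<gamma> d \<delta>. op_tens (tprod sext a \<alpha> b \<beta> c) \<gamma> d \<delta>) t)"
proof (rule balanced_multiadditiveI[of "\<lambda>a b. op_lift (\<lambda>c \<gamma> d \<delta>. op_tens (tprod sext a 1 b 1 c) \<gamma> d \<delta>) t"])
  let ?L = "\<lambda>a \<alpha> b \<beta>. op_lift (\<lambda>c \<gamma> d \<delta>. op_tens (tprod sext a \<alpha> b \<beta> c) \<gamma> d \<delta>)"
  show "Modules.additive (\<lambda>b. ?L a 1 b 1 t)" for a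
  proof
    show "?L a 1 (b + b') 1 t = ?L a 1 b 1 t + ?L a 1 b' 1 t" for b b'
      by (rule op_tensor_ext[of "?L a 1 (b + b') 1" "\<lambda>t. ?L a 1 b 1 t + ?L a 1 b' 1 t"])
        ((rule additive_op_mult_inner additive_plus)+, simp only: op_mult_inner_ptens, simp only: additive.add[OF additive_tprod2] ptens_add_left)
  qed
  show "Modules.additive (\<lambda>a. ?L a 1 b 1 t)" for b
  proof
    show "?L (a + a') 1 b 1 t = ?L a 1 b 1 t + ?L a' 1 b 1 t" for a a'
      by (rule op_tensor_ext[of "?L (a + a') 1 b 1" "\<lambda>t. ?L a 1 b 1 t + ?L a' 1 b 1 t"])
        ((rule additive_op_mult_inner additive_plus)+, simp only: op_mult_inner_ptens, simp only: additive.add[OF additive_tprod1] ptens_add_left)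
  qed
  show "?L a 1 (tscale c b) 1 t = ?L (tscale c a) 1 b 1 t" for a b c
    by (simp only: tprod_tscale1 tprod_tscale2)
  show "?L a \<alpha> b \<beta> t = ?L (tscale (\<alpha> * \<beta>) a) 1 b 1 t" for a \<alpha> b \<beta>
    by (simp only: tprod_tscale1 tprod_scalars[of a \<alpha> b \<beta>])
qed

lemma op_mult_ptens_left:
  "op_mult sext (ptens a b) t = op_lift (\<lambda>c \<gamma> d \<delta>. op_tens (tprod sext a 1 b 1 c) \<gamma> d \<delta>) t"
  unfolding op_mult_def ptens_def by (rule op_lift_tens[OF balanced_op_mult])

lemma op_mult_ptens: "op_mult sext (ptens a b) (ptens c d) = ptens (tprod sext a 1 b 1 c) d"
  by (simp add: op_mult_ptens_left op_mult_inner_ptens)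

lemma additive_op_mult_left: "Modules.additive (\<lambda>s. op_mult sext s t)"
  unfolding op_mult_def by (rule additive_op_lift[OF balanced_op_mult])

text \<open>The second factor is hidden inside the outer lift; for a pure first factor the product
  is a single lift, hence additive.\<close>

lemma additive_op_mult_right: "Modules.additive (op_mult sext s)"
proof
  fix t t'
  show "op_mult sext s (t + t') = op_mult sext s t + op_mult sext s t'"
    by (rule op_tensor_ext)
      (simp_all add: additive_plus additive_op_mult_left op_mult_ptens_left
        additive.add[OF additive_op_mult_inner])
qed

lemma balanced_op_action: "balanced_multiadditive (\<lambda>a \<alpha> b \<beta> x. tprod sext a \<alpha> b \<beta> x)"
proof (rule balanced_multiadditiveI[of "\<lambda>a b x. tprod sext a 1 b 1 x"])
  show "(\<lambda>x. tprod sext a \<alpha> b \<beta> x) = (\<lambda>x. tprod sext (tscale (\<alpha> * \<beta>) a) 1 b 1 x)" for a \<alpha> b \<beta>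
    by (rule ext) (simp only: tprod_tscale1 tprod_scalars[of a \<alpha> b \<beta>])
qed (simp_all add: Modules.additive_def fun_eq_iff additive.add[OF additive_tprod1]
    additive.add[OF additive_tprod2] tprod_tscale1 tprod_tscale2)

lemma additive_op_action: "Modules.additive (op_action sext)"
  unfolding op_action_def by (rule additive_op_lift[OF balanced_op_action])

lemma op_action_ptens: "op_action sext (ptens a b) = tprod sext a 1 b 1"
  unfolding op_action_def ptens_def by (rule op_lift_tens[OF balanced_op_action])

section \<open>Coordinates on T \<otimes> T outside W \<otimes> W\<close>

definition tE :: "nat \<Rightarrow> ('e, 'w, 'k::field) tspace \<Rightarrow> 'k" where
  "tE i x = kcrd bE i (fst x)"

definition tW :: "nat \<Rightarrow> ('e, 'w, 'k::field) tspace \<Rightarrow> 'k" where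
  "tW j x = kcrd bW j (snd x)"

lemma klinear_tE: "i < ne \<Longrightarrow> klinear (tE i)"
  and klinear_tW: "j < nw \<Longrightarrow> klinear (tW j)"
  using additive_kcrd[OF bE] additive_kcrd[OF bW]
  by (simp_all add: klinear_def tE_def tW_def tscale_def kcrd_kscale bE bW additive_comp
      Modules.additive_def)

abbreviation "cEE a b \<equiv> pfun (tE a) (tE b)"
abbreviation "cWE j d \<equiv> pfun (tW j) (tE d)"
abbreviation "cEW a j \<equiv> pfun (tE a) (tW j)"

definition uE :: "nat \<Rightarrow> ('e, 'w, 'k::field) tspace" where
  "uE i = (bE ! i \<otimes>\<^sub>\<int> 1, 0)"

definition uW :: "nat \<Rightarrow> ('e, 'w, 'k::field) tspace" where
  "uW j = (0, bW ! j \<otimes>\<^sub>\<int> 1)"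

lemma t_u [simp]:
  "a < ne \<Longrightarrow> b < ne \<Longrightarrow> tE a (uE b) = (if a = b then 1 else 0)"
  "a < nw \<Longrightarrow> b < nw \<Longrightarrow> tW a (uW b) = (if a = b then 1 else 0)"
  "a < ne \<Longrightarrow> tE a (uW j) = 0"
  "j < nw \<Longrightarrow> tW j (uE a) = 0"
  by (simp_all add: tE_def tW_def uE_def uW_def kcrd_tens bE bW crd_nth
      additive.zero[OF additive_kcrd])

lemma fst_expand: "(fst x, 0) = (\<Sum>i<ne. tscale (tE i x) (uE i))"
proof -
  have "Modules.additive (\<lambda>y. (y, 0) :: ('e, 'w, 'a) tspace)" by (simp add: Modules.additive_def)
  from additive.sum[OF this] show ?thesis
    by (subst kcrd_expand[OF bE, of "fst x"]) (simp add: tE_def uE_def tscale_def)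
qed

lemma snd_expand: "(0, snd x) = (\<Sum>j<nw. tscale (tW j x) (uW j))"
proof -
  have "Modules.additive (\<lambda>y. (0, y) :: ('e, 'w, 'a) tspace)" by (simp add: Modules.additive_def)
  from additive.sum[OF this] show ?thesis
    by (subst kcrd_expand[OF bW, of "snd x"]) (simp add: tW_def uW_def tscale_def)
qed

lemma tE_tprod [simp]: "i < ne \<Longrightarrow> tE i (tprod sext r n s m t) = 0"
  by (simp add: tE_def additive.zero[OF additive_kcrd[OF bE]])

lemma tW_tprod:
  "j < nw \<Longrightarrow> tW j (tprod sext r n s m t) = n * m * (\<Sum>a<ne. \<Sum>b<ne. \<Sum>c<ne.
    of_int (mcoef a b c j) * (tE a r * tE b s * tE c t))"
  by (simp add: tW_def tE_def tprod_def kcrd_kscale bW kcrd_sext)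

text \<open>The element with prescribed coordinates in E \<otimes> E, W \<otimes> E and E \<otimes>
  W and with none in W \<otimes> W, the block that will fall into the ideal.\<close>

definition section_map :: "(nat \<Rightarrow> nat \<Rightarrow> 'k) \<Rightarrow> (nat \<Rightarrow> nat \<Rightarrow> 'k) \<Rightarrow> (nat \<Rightarrow> nat \<Rightarrow> 'k::field) \<Rightarrow>
    ('e, 'w, 'k) op_tensor" where
  "section_map f g h = (\<Sum>a<ne. \<Sum>b<ne. op_scale (f a b) (ptens (uE a) (uE b))) +
    (\<Sum>j<nw. \<Sum>d<ne. op_scale (g j d) (ptens (uW j) (uE d))) +
    (\<Sum>a<ne. \<Sum>j<nw. op_scale (h a j) (ptens (uE a) (uW j)))"

lemma coords_section_map:
  shows "a < ne \<Longrightarrow> b < ne \<Longrightarrow> cEE a b (section_map f g h) = f a b"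
    and "j < nw \<Longrightarrow> b < ne \<Longrightarrow> cWE j b (section_map f g h) = g j b"
    and "a < ne \<Longrightarrow> j < nw \<Longrightarrow> cEW a j (section_map f g h) = h a j"
  unfolding section_map_def
  by (simp_all add: additive.add[OF additive_pfun] additive.sum[OF additive_pfun] pfun_op_scale pfun_ptens
      klinear_tE klinear_tW if_distrib[where f = "\<lambda>x. _ * x"] if_distrib[where f = "\<lambda>x. x * _"] sum.delta cong: if_cong)

text \<open>Bilinear expansion along T = E \<oplus> W gives four terms, three of which are rebuilt
  from their coordinates.\<close>

lemma ptens_section_map:
  "ptens x y - section_map (\<lambda>a b. cEE a b (ptens x y)) (\<lambda>j d. cWE j d (ptens x y))
    (\<lambda>a j. cEW a j (ptens x y)) = ptens (0, snd x) (0, snd y)"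
proof -
  have 1: "ptens (fst x, 0) (fst y, 0) = (\<Sum>a<ne. \<Sum>b<ne. op_scale (tE a x * tE b y) (ptens (uE a) (uE b)))"
    unfolding fst_expand
    by (simp only: ptens_sum_left, simp only: ptens_sum_right ptens_tscale_right tscale_tscale op_scale_ptens mult.commute)
  have 2: "ptens (0, snd x) (fst y, 0) = (\<Sum>a<nw. \<Sum>b<ne. op_scale (tW a x * tE b y) (ptens (uW a) (uE b)))"
    unfolding fst_expand snd_expand
    by (simp only: ptens_sum_left, simp only: ptens_sum_right ptens_tscale_right tscale_tscale op_scale_ptens mult.commute)
  have 3: "ptens (fst x, 0) (0, snd y) = (\<Sum>a<ne. \<Sum>b<nw. op_scale (tE a x * tW b y) (ptens (uE a) (uW b)))"
    unfolding fst_expand snd_expand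
    by (simp only: ptens_sum_left, simp only: ptens_sum_right ptens_tscale_right tscale_tscale op_scale_ptens mult.commute)
  have "ptens x y = ptens ((fst x, 0) + (0, snd x)) ((fst y, 0) + (0, snd y))" by simp
  also have "\<dots> = ptens (0, snd x) (0, snd y) +
      (ptens (fst x, 0) (fst y, 0) + ptens (0, snd x) (fst y, 0) + ptens (fst x, 0) (0, snd y))"
    by (simp only: ptens_add_left ptens_add_right add_ac)
  also have "ptens (fst x, 0) (fst y, 0) + ptens (0, snd x) (fst y, 0) + ptens (fst x, 0) (0, snd y) =
      section_map (\<lambda>a b. cEE a b (ptens x y)) (\<lambda>j d. cWE j d (ptens x y)) (\<lambda>a j. cEW a j (ptens x y))"
    unfolding 1 2 3 section_map_def by (simp add: pfun_ptens klinear_tE klinear_tW)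
  finally show ?thesis unfolding diff_eq_eq .
qed

end

section \<open>The ideal of the operator rng\<close>

context ternary
begin

lemma section_map_diff:
  "section_map (\<lambda>a b. f a b - f' a b) (\<lambda>a b. g a b - g' a b) (\<lambda>a b. h a b - h' a b) =
    section_map f g h - section_map f' g' h'"
  by (simp add: section_map_def op_scale_diff_left sum_subtractf)

lemma section_map_add:
  "section_map (\<lambda>a b. f a b + f' a b) (\<lambda>a b. g a b + g' a b) (\<lambda>a b. h a b + h' a b) =
    section_map f g h + section_map f' g' h'"
  by (simp add: section_map_def op_scale_add_left sum.distrib)

lemma section_map_scale:
  "section_map (\<lambda>a b. c * f a b) (\<lambda>a b. c * g a b) (\<lambda>a b. c * h a b) = op_scale c (section_map f g h)"
  by (simp add: section_map_def op_scale_add_right op_scale_sum)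

lemma section_map_cong:
  assumes "\<And>a b. a < ne \<Longrightarrow> b < ne \<Longrightarrow> f a b = f' a b" "\<And>j b. j < nw \<Longrightarrow> b < ne \<Longrightarrow> g j b = g' j b"
    and "\<And>a j. a < ne \<Longrightarrow> j < nw \<Longrightarrow> h a j = h' a j"
  shows "section_map f g h = section_map f' g' h'"
  unfolding section_map_def by (simp add: assms)

abbreviation J :: "('e, 'w, 'k::field) op_tensor set" where
  "J \<equiv> op_ideal sext"

lemma op_ideal_two_sided: "op_two_sided_ideal sext J"
  unfolding op_ideal_def by (rule hull_in) (auto simp: op_two_sided_ideal_def)

lemma J_0: "0 \<in> J"
  and J_add: "s \<in> J \<Longrightarrow> t \<in> J \<Longrightarrow> s + t \<in> J"
  and J_scale: "t \<in> J \<Longrightarrow> op_scale c t \<in> J"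
  and J_mult_left: "t \<in> J \<Longrightarrow> op_mult sext s t \<in> J"
  using op_ideal_two_sided by (auto simp: op_two_sided_ideal_def)

lemma J_minus: "t \<in> J \<Longrightarrow> - t \<in> J"
  using J_scale[of t "- 1"] by (simp add: op_scale_minus_1)

lemma J_diff: "s \<in> J \<Longrightarrow> t \<in> J \<Longrightarrow> s - t \<in> J"
  using J_add[OF _ J_minus] by simp

lemma J_sum: "(\<And>i. i \<in> I \<Longrightarrow> f i \<in> J) \<Longrightarrow> sum f I \<in> J"
  by (induction I rule: infinite_finite_induct) (auto intro: J_0 J_add)

definition gen :: "('e, 'w, 'k::field) tspace \<Rightarrow> ('e, 'w, 'k) tspace \<Rightarrow> ('e, 'w, 'k) tspace \<Rightarrow>
    ('e, 'w, 'k) tspace \<Rightarrow> ('e, 'w, 'k) op_tensor" where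
  "gen a b c d = ptens (tprod sext a 1 b 1 c) d - ptens a (tprod sext b 1 c 1 d)"

text \<open>Scalars can be pulled out of every slot, and both terms of a relation collect the same
  product of scalars.\<close>

lemma generator_eq_scale_gen:
  "op_tens (tprod sext a \<alpha> b \<beta> c) \<gamma> d \<delta> - op_tens a \<alpha> (tprod sext b \<beta> c \<gamma> d) \<delta> =
    op_scale (\<alpha> * \<beta> * \<gamma> * \<delta>) (gen a b c d)"
  unfolding op_tens_eq_op_scale gen_def op_scale_diff op_scale_ptens
    tprod_scalars[of a \<alpha> b \<beta> c] tprod_scalars[of b \<beta> c \<gamma> d]
  by (simp add: ptens_tscale_right mult_ac)

lemma gen_in_J: "gen a b c d \<in> J"
proof -
  have "op_tens (tprod sext a 1 b 1 c) 1 d 1 - op_tens a 1 (tprod sext b 1 c 1 d) 1 \<in> J"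
    unfolding op_ideal_def by (rule hull_inc) blast
  then show ?thesis by (simp add: generator_eq_scale_gen)
qed

text \<open>Multiplying a generator from the left kills its first term, because the ternary product
  takes values in \<open>W\<close> and vanishes as soon as one argument lies in \<open>W\<close>.\<close>

lemma tprod_tprod_in_J: "ptens (tprod sext a 1 b 1 c) (tprod sext d 1 f 1 g) \<in> J"
proof -
  have "op_mult sext (ptens a b) (gen c d f g) \<in> J" by (rule J_mult_left[OF gen_in_J])
  also have "op_mult sext (ptens a b) (gen c d f g) = - ptens (tprod sext a 1 b 1 c) (tprod sext d 1 f 1 g)"
    by (simp add: gen_def additive.diff[OF additive_op_mult_right] op_mult_ptens tprod_zero)
  finally show ?thesis using J_minus by fastforce
qed

text \<open>This is how surjectivity reaches every field: \<open>w\<close> is \<open>\<mu> t\<close>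
  for some tensor \<open>t\<close>, and splitting \<open>t\<close> into pure tensors reduces
  \<open>w \<otimes>\<^sub>\<int> c\<close> to differences of values of the ternary product.\<close>

lemma kW_induct [case_names zero sext diff]:
  assumes "P 0" "\<And>x y z. P (sext x y z)" "\<And>s t. P s \<Longrightarrow> P t \<Longrightarrow> P (s - t)"
  shows "P (u :: ('w, 'k::field) tensor)"
proof (induction u rule: tensor_induct)
  case (tens w c)
  obtain t where "w = \<mu> t" using surj by blast
  moreover have "P (\<mu> t \<otimes>\<^sub>\<int> c)"
  proof (induction t rule: tensor_induct)
    case (tens s z)
    show ?case
    proof (induction s rule: tensor_induct)
      case (tens x y)
      \<comment> \<open>The scalar \<open>c\<close> is absorbed by the third argument.\<close>
      show ?case using assms(2)[of "x \<otimes>\<^sub>\<int> 1" "y \<otimes>\<^sub>\<int> 1" "z \<otimes>\<^sub>\<int> c"] by (simp add: sext_tens)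
    qed (use assms in \<open>simp_all add: additive.zero[OF mu] additive.diff[OF mu]
      additive.diff[OF additive_tens_left]\<close>)
  qed (use assms in \<open>simp_all add: additive.zero[OF mu] additive.diff[OF mu]
      additive.diff[OF additive_tens_left]\<close>)
  ultimately show ?case by simp
qed (use assms in simp_all)

text \<open>Both factors reduce to values of the ternary product, and the tensor of two such values
  is, up to sign, a left multiple of a relation.\<close>

lemma WW_in_J: "ptens (0, u) (0, v) \<in> J"
proof (induction u rule: kW_induct)
  case zero
  then show ?case by (simp add: zero_prod_def[symmetric] J_0)
next
  case (diff s t)
  have "((0, s - t) :: ('e, 'w, 'a) tspace) = (0, s) - (0, t)" by simp
  then show ?case using diff by (simp only: additive.diff[OF additive_ptens1] J_diff)
next
  case (sext x y z)
  show ?case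
  proof (induction v rule: kW_induct)
    case zero
    then show ?case by (simp add: zero_prod_def[symmetric] J_0)
  next
    case (diff s t)
    have "((0, s - t) :: ('e, 'w, 'a) tspace) = (0, s) - (0, t)" by simp
    then show ?case using diff by (simp only: additive.diff[OF additive_ptens2] J_diff)
  next
    case (sext x' y' z')
    show ?case
      using tprod_tprod_in_J[of "(x, 0)" "(y, 0)" "(z, 0)" "(x', 0)" "(y', 0)" "(z', 0)"]
      by (simp add: tprod_def)
  qed
qed

abbreviation residual :: "('e, 'w, 'k::field) op_tensor \<Rightarrow> ('e, 'w, 'k) op_tensor" where
  "residual t \<equiv> t - section_map (\<lambda>a b. cEE a b t) (\<lambda>j d. cWE j d t) (\<lambda>a j. cEW a j t)"

text \<open>The residual is additive in \<open>t\<close>, and on a pure tensor it is the W \<otimes>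
  W term. Modulo the ideal an element is thus determined by its other three blocks of
  coordinates.\<close>

lemma residual_in_J: "residual t \<in> J"
proof (induction t rule: op_tensor_induct)
  case zero
  have "section_map (\<lambda>a b. cEE a b 0) (\<lambda>j d. cWE j d 0) (\<lambda>a j. cEW a j 0) =
      (0 :: ('e, 'w, 'a) op_tensor)"
    by (simp add: section_map_def additive.zero[OF additive_pfun] klinear_tE klinear_tW)
  then show ?case by (simp add: J_0)
next
  case (ptens x y)
  then show ?case unfolding ptens_section_map by (rule WW_in_J)
next
  case (diff s t)
  have eq: "section_map (\<lambda>a b. cEE a b (s - t)) (\<lambda>j d. cWE j d (s - t)) (\<lambda>a j. cEW a j (s - t)) =
      section_map (\<lambda>a b. cEE a b s - cEE a b t) (\<lambda>j d. cWE j d s - cWE j d t) (\<lambda>a j. cEW a j s - cEW a j t)"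
    by (rule section_map_cong)
      (simp_all add: additive.diff[OF additive_pfun] klinear_tE klinear_tW)
  have "residual (s - t) = residual s - residual t"
    unfolding eq section_map_diff by (simp add: algebra_simps)
  then show ?case using J_diff[OF diff] by (simp only:)
qed

section \<open>The mixed coordinates and the image of B\<close>

abbreviation kB :: "'k::field mat" where
  "kB \<equiv> map_mat of_int (B_mat bE bW \<mu>)"

abbreviation kTh :: "'k::field mat" where
  "kTh \<equiv> map_mat of_int (Theta_mat bE bW \<mu>)"

abbreviation "nm \<equiv> nw * ne + ne * nw"
abbreviation "nq \<equiv> ne * ne * ne * ne"

text \<open>The coordinates on \<open>(W \<otimes> E) \<oplus> (E \<otimes> W)\<close>, in the order of the rows of \<open>B_mat\<close>.\<close>

definition mid :: "('e, 'w, 'k::field) op_tensor \<Rightarrow> 'k vec" where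
  "mid t = vec nm (\<lambda>r. if r < nw * ne then cWE (r div ne) (r mod ne) t
    else cEW ((r - nw * ne) div nw) ((r - nw * ne) mod nw) t)"

lemma mid_carrier [simp]: "mid t \<in> carrier_vec nm"
  by (simp add: mid_def)

lemma dim_mid [simp]: "dim_vec (mid t) = nm"
  by (simp add: mid_def)

lemma mid_index:
  "j < nw \<Longrightarrow> i < ne \<Longrightarrow> mid t $ (j * ne + i) = cWE j i t"
  "j < nw \<Longrightarrow> i < ne \<Longrightarrow> mid t $ (nw * ne + (i * nw + j)) = cEW i j t"
  using mult_add_less[of j nw i ne] mult_add_less[of i ne j nw]
  by (simp_all add: mid_def mult_add_div_mod)

lemma mid_vec_eqI:
  assumes "v \<in> carrier_vec nm" "w \<in> carrier_vec nm"
    and "\<And>i j. j < nw \<Longrightarrow> i < ne \<Longrightarrow> v $ (j * ne + i) = w $ (j * ne + i)"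
    and "\<And>i j. j < nw \<Longrightarrow> i < ne \<Longrightarrow> v $ (nw * ne + (i * nw + j)) = w $ (nw * ne + (i * nw + j))"
  shows "v = w"
proof (rule eq_vecI)
  fix r assume "r < dim_vec w"
  then have r: "r < nm" using assms by simp
  show "v $ r = w $ r"
  proof (cases "r < nw * ne")
    case True
    then have "r div ne < nw" "r mod ne < ne"
      by (simp_all add: div_mod_less)
    from assms(3)[OF this] show ?thesis by simp
  next
    case False
    define r' where "r' = r - nw * ne"
    have "r' < ne * nw" "r = nw * ne + r'" using r False by (auto simp: r'_def)
    moreover from this have "r' div nw < ne" "r' mod nw < nw"
      by (auto simp: less_mult_imp_div_less intro!: mod_less_divisor)
    ultimately show ?thesis using assms(4)[of "r' mod nw" "r' div nw"] by simp
  qed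
qed (use assms in simp)

lemma mid_add: "mid (s + t) = mid s + mid t"
  by (rule mid_vec_eqI)
    (simp_all add: mid_index mult_add_less trans_less_add1 additive.add[OF additive_pfun] klinear_tE klinear_tW)

lemma mid_scale: "mid (op_scale c t) = c \<cdot>\<^sub>v mid t"
  by (rule mid_vec_eqI)
    (simp_all add: mid_index mult_add_less trans_less_add1 pfun_op_scale klinear_tE klinear_tW)

lemma mid_zero_iff: "mid t = 0\<^sub>v nm \<longleftrightarrow>
    (\<forall>j<nw. \<forall>i<ne. cWE j i t = 0) \<and> (\<forall>i<ne. \<forall>j<nw. cEW i j t = 0)"
proof
  assume *: "mid t = 0\<^sub>v nm"
  then show "(\<forall>j<nw. \<forall>i<ne. cWE j i t = 0) \<and> (\<forall>i<ne. \<forall>j<nw. cEW i j t = 0)"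
    by (simp add: mid_index[symmetric] mult_add_less trans_less_add1)
next
  assume "(\<forall>j<nw. \<forall>i<ne. cWE j i t = 0) \<and> (\<forall>i<ne. \<forall>j<nw. cEW i j t = 0)"
  then show "mid t = 0\<^sub>v nm"
    by (intro mid_vec_eqI) (simp_all add: mid_index mult_add_less trans_less_add1)
qed

lemma coords_zero_in_J:
  assumes "\<And>a b. a < ne \<Longrightarrow> b < ne \<Longrightarrow> cEE a b t = 0" "mid t = 0\<^sub>v nm"
  shows "t \<in> J"
proof -
  have "section_map (\<lambda>a b. cEE a b t) (\<lambda>j d. cWE j d t) (\<lambda>a j. cEW a j t) = 0"
    using assms by (simp add: section_map_def mid_zero_iff)
  then show ?thesis using residual_in_J[of t] by simp
qed

lemma sum_ix4: "(\<Sum>k<nq. f k) = (\<Sum>a<ne. \<Sum>b<ne. \<Sum>c<ne. \<Sum>d<ne. f (ix4 a b c d))"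
  by (simp only: sum_mult_nat ix4_def)

text \<open>Each row of B carries a Kronecker delta, in the last index for the upper block and in
  the first index for the lower one, so a fourfold sum collapses to a threefold one.\<close>

lemma kB_mult_index:
  fixes x :: "'k::field vec"
  assumes x: "x \<in> carrier_vec nq" and ij: "j < nw" "i < ne"
  shows "(kB *\<^sub>v x) $ (j * ne + i) =
      (\<Sum>a<ne. \<Sum>b<ne. \<Sum>c<ne. of_int (mcoef a b c j) * x $ (ix4 a b c i))"
    and "(kB *\<^sub>v x) $ (nw * ne + (i * nw + j)) =
      - (\<Sum>b<ne. \<Sum>c<ne. \<Sum>d<ne. of_int (mcoef b c d j) * x $ (ix4 i b c d))"
proof -
  have row: "(kB *\<^sub>v x) $ r = (\<Sum>a<ne. \<Sum>b<ne. \<Sum>c<ne. \<Sum>d<ne.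
      of_int (B_mat bE bW \<mu> $$ (r, ix4 a b c d)) * x $ (ix4 a b c d))" if "r < nm" for r
  proof -
    have "(kB *\<^sub>v x) $ r = (\<Sum>k<nq. of_int (B_mat bE bW \<mu> $$ (r, k)) * x $ k)"
      using that x by (simp add: scalar_prod_def atLeast0LessThan)
    then show ?thesis unfolding sum_ix4 .
  qed
  have "j * ne + i < nm" using ij by (simp add: mult_add_less trans_less_add1)
  from row[OF this] show "(kB *\<^sub>v x) $ (j * ne + i) =
      (\<Sum>a<ne. \<Sum>b<ne. \<Sum>c<ne. of_int (mcoef a b c j) * x $ (ix4 a b c i))"
    using ij by (simp add: B_mat_index if_distrib[where f = of_int] if_distrib[where f = "\<lambda>x. x * _"] cong: if_cong)
  have "nw * ne + (i * nw + j) < nm" using ij by (simp add: mult_add_less)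
  then have "(kB *\<^sub>v x) $ (nw * ne + (i * nw + j)) =
    (\<Sum>a<ne. if i = a then - (\<Sum>b<ne. \<Sum>c<ne. \<Sum>d<ne. of_int (mcoef b c d j) * x $ (ix4 a b c d)) else 0)"
    unfolding row[OF \<open>nw * ne + (i * nw + j) < nm\<close>]
    by (intro sum.cong refl) (use ij in \<open>auto simp: B_mat_index sum_negf\<close>)
  then show "(kB *\<^sub>v x) $ (nw * ne + (i * nw + j)) =
      - (\<Sum>b<ne. \<Sum>c<ne. \<Sum>d<ne. of_int (mcoef b c d j) * x $ (ix4 i b c d))"
    using ij by simp
qed

lemma kB_mat: "kB \<in> carrier_mat nm nq"
  by (rule carrier_matI) simp_all

lemma kB_carrier [simp]: "kB *\<^sub>v x \<in> carrier_vec nm"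
  by (rule carrier_vecI) simp

lemma cEE_gen: "a' < ne \<Longrightarrow> b' < ne \<Longrightarrow> cEE a' b' (gen a b c d) = 0"
  by (simp add: gen_def additive.diff[OF additive_pfun] pfun_ptens klinear_tE)

lemma cWE_gen: "j < nw \<Longrightarrow> i < ne \<Longrightarrow> cWE j i (gen a b c d) = tW j (tprod sext a 1 b 1 c) * tE i d"
  and cEW_gen: "j < nw \<Longrightarrow> i < ne \<Longrightarrow> cEW i j (gen a b c d) = - (tE i a * tW j (tprod sext b 1 c 1 d))"
  by (simp_all add: gen_def additive.diff[OF additive_pfun] pfun_ptens klinear_tE klinear_tW)

lemma mid_gen: "\<exists>x\<in>carrier_vec nq. mid (gen a b c d) = kB *\<^sub>v x"
proof
  \<comment> \<open>The coordinates of a \<otimes> b \<otimes> c \<otimes> d, taken from the E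
    components and listed in the order of the columns of B; the nested \<open>div\<close> and
    \<open>mod\<close> invert \<open>ix4\<close>.\<close>
  define x where "x = vec nq (\<lambda>k. tE (k div ne div ne div ne) a * tE (k div ne div ne mod ne) b *
    tE (k div ne mod ne) c * tE (k mod ne) d)"
  show x: "x \<in> carrier_vec nq" by (simp add: x_def)
  have xi: "x $ ix4 i j k l = tE i a * tE j b * tE k c * tE l d"
    if "i < ne" "j < ne" "k < ne" "l < ne" for i j k l
    using that ix4_less[OF that] by (simp add: x_def ix4_def mult_add_div_mod)
  show "mid (gen a b c d) = kB *\<^sub>v x"
  proof (rule mid_vec_eqI)
    fix i j assume ij: "j < nw" "i < ne"
    show "mid (gen a b c d) $ (j * ne + i) = (kB *\<^sub>v x) $ (j * ne + i)"
      unfolding mid_index(1)[OF ij] kB_mult_index(1)[OF x ij]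
      using ij by (simp add: cWE_gen tW_tprod xi sum_distrib_left sum_distrib_right mult_ac)
    show "mid (gen a b c d) $ (nw * ne + (i * nw + j)) = (kB *\<^sub>v x) $ (nw * ne + (i * nw + j))"
      unfolding mid_index(2)[OF ij] kB_mult_index(2)[OF x ij]
      using ij by (simp add: cEW_gen tW_tprod xi sum_distrib_left sum_distrib_right mult_ac)
  qed simp_all
qed

lemma tW_tprod_uE:
  "a < ne \<Longrightarrow> b < ne \<Longrightarrow> c < ne \<Longrightarrow> j < nw \<Longrightarrow>
    tW j (tprod sext (uE a) 1 (uE b) 1 (uE c)) = of_int (mcoef a b c j)"
  by (simp add: tW_def tprod_def uE_def sext_tens kcrd_tens bW mcoef_def)

text \<open>Relations between basis elements weighted by the entries of \<open>x\<close>: an element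
  of the ideal whose mixed part is the image of \<open>x\<close> under B.\<close>

definition gen_sum :: "'k::field vec \<Rightarrow> ('e, 'w, 'k) op_tensor" where
  "gen_sum x = (\<Sum>a<ne. \<Sum>b<ne. \<Sum>c<ne. \<Sum>d<ne.
    op_scale (x $ ix4 a b c d) (gen (uE a) (uE b) (uE c) (uE d)))"

lemma gen_sum_in_J: "gen_sum x \<in> J"
  unfolding gen_sum_def by (intro J_sum J_scale gen_in_J)

lemma cEE_gen_sum: "a < ne \<Longrightarrow> b < ne \<Longrightarrow> cEE a b (gen_sum x) = 0"
  by (simp add: gen_sum_def additive.sum[OF additive_pfun] klinear_tE pfun_op_scale cEE_gen)

lemma mid_gen_sum:
  assumes x: "x \<in> carrier_vec nq"
  shows "mid (gen_sum x) = kB *\<^sub>v x"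
proof (rule mid_vec_eqI)
  fix i j assume ij: "j < nw" "i < ne"
  show "mid (gen_sum x) $ (j * ne + i) = (kB *\<^sub>v x) $ (j * ne + i)"
    unfolding mid_index(1)[OF ij] kB_mult_index(1)[OF x ij]
    using ij by (simp add: gen_sum_def additive.sum[OF additive_pfun] klinear_tE klinear_tW
        pfun_op_scale cWE_gen tW_tprod_uE if_distrib[where f = "\<lambda>x. _ * x"] cong: if_cong) (simp add: mult.commute)
  have "mid (gen_sum x) $ (nw * ne + (i * nw + j)) = (\<Sum>a<ne. \<Sum>b<ne. \<Sum>c<ne. \<Sum>d<ne.
      if i = a then - (of_int (mcoef b c d j) * x $ ix4 i b c d) else 0)"
    unfolding mid_index(2)[OF ij]
    using ij by (simp add: gen_sum_def additive.sum[OF additive_pfun] klinear_tE klinear_tW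
        pfun_op_scale cEW_gen tW_tprod_uE) (intro sum.cong refl, auto)
  also have "\<dots> = (\<Sum>a<ne. if i = a then
      - (\<Sum>b<ne. \<Sum>c<ne. \<Sum>d<ne. of_int (mcoef b c d j) * x $ ix4 i b c d) else 0)"
    by (intro sum.cong refl) (auto simp: sum_negf)
  finally show "mid (gen_sum x) $ (nw * ne + (i * nw + j)) = (kB *\<^sub>v x) $ (nw * ne + (i * nw + j))"
    using ij by (simp add: kB_mult_index[OF x])
qed simp_all

section \<open>Identification of the ideal\<close>

text \<open>The W \<otimes> W coordinates are left free, since that block belongs to the ideal
  entirely.\<close>

definition ideal_model :: "('e, 'w, 'k::field) op_tensor set" where
  "ideal_model = {t. (\<forall>a<ne. \<forall>b<ne. cEE a b t = 0) \<and> (\<exists>x\<in>carrier_vec nq. mid t = kB *\<^sub>v x)}"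

lemma op_mult_ext:
  assumes "Modules.additive f" "\<And>t. Modules.additive (\<lambda>s. g s t)" "\<And>s. Modules.additive (g s)"
    and "\<And>a b c d. f (ptens (tprod sext a 1 b 1 c) d) = g (ptens a b) (ptens c d)"
  shows "f (op_mult sext s t) = g s t"
proof (rule op_tensor_ext[of "\<lambda>s. f (op_mult sext s t)" "\<lambda>s. g s t"])
  show "Modules.additive (\<lambda>s. f (op_mult sext s t))"
    by (rule additive_comp[OF assms(1) additive_op_mult_left])
  show "f (op_mult sext (ptens a b) t) = g (ptens a b) t" for a b
  proof (rule op_tensor_ext[of "\<lambda>t. f (op_mult sext (ptens a b) t)" "g (ptens a b)"])
    show "Modules.additive (\<lambda>t. f (op_mult sext (ptens a b) t))"
      by (rule additive_comp[OF assms(1) additive_op_mult_right])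
  qed (simp_all only: assms op_mult_ptens)
qed (rule assms)

text \<open>A product has its first factor in W, so nothing appears in E \<otimes> E or E \<otimes>
  W. The ternary product that yields this factor reads E components only, which leaves the E
  \<otimes> E coordinates of \<open>s\<close> and \<open>t\<close>.\<close>

lemma coords_op_mult:
  fixes s t :: "('e, 'w, 'k::field) op_tensor"
  shows "a < ne \<Longrightarrow> b < ne \<Longrightarrow> cEE a b (op_mult sext s t) = 0"
    and "a < ne \<Longrightarrow> j < nw \<Longrightarrow> cEW a j (op_mult sext s t) = 0"
    and "j < nw \<Longrightarrow> d < ne \<Longrightarrow> cWE j d (op_mult sext s t) =
      (\<Sum>a<ne. \<Sum>b<ne. \<Sum>c<ne. of_int (mcoef a b c j) * cEE a b s * cEE c d t)"
proof -
  have 0: "Modules.additive (\<lambda>_. 0)" by (simp add: Modules.additive_def)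
  show "cEE a b (op_mult sext s t) = 0" if "a < ne" "b < ne"
    by (rule op_mult_ext[where g = "\<lambda>_ _. 0"]) (use that in \<open>simp_all add: 0 additive_pfun klinear_tE pfun_ptens\<close>)
  show "cEW a j (op_mult sext s t) = 0" if "a < ne" "j < nw"
    by (rule op_mult_ext[where g = "\<lambda>_ _. 0"]) (use that in \<open>simp_all add: 0 additive_pfun klinear_tE klinear_tW pfun_ptens\<close>)
  show "cWE j d (op_mult sext s t) =
      (\<Sum>a<ne. \<Sum>b<ne. \<Sum>c<ne. of_int (mcoef a b c j) * cEE a b s * cEE c d t)"
    if "j < nw" "d < ne"
  proof (rule op_mult_ext)
    have a: "x \<in> {..<ne} \<Longrightarrow> y \<in> {..<ne} \<Longrightarrow> Modules.additive (cEE x y)" for x y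
      by (simp add: additive_pfun klinear_tE)
    show "Modules.additive (\<lambda>s. \<Sum>a<ne. \<Sum>b<ne. \<Sum>c<ne. of_int (mcoef a b c j) * cEE a b s * cEE c d t)"
      for t :: "('e, 'w, 'k) op_tensor"
      by (intro additive_sum_fun additive.intro) (simp add: additive.add[OF a] algebra_simps)
    show "Modules.additive (\<lambda>t. \<Sum>a<ne. \<Sum>b<ne. \<Sum>c<ne. of_int (mcoef a b c j) * cEE a b s * cEE c d t)"
      for s :: "('e, 'w, 'k) op_tensor"
      by (intro additive_sum_fun additive.intro) (use that in \<open>simp add: additive.add[OF a] algebra_simps\<close>)
  qed (use that in \<open>simp_all add: additive_pfun klinear_tE klinear_tW pfun_ptens tW_tprod
      sum_distrib_left sum_distrib_right mult_ac\<close>)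
qed

text \<open>If one factor has no E \<otimes> E coordinates, the product lies in W \<otimes> W, so
  closure under multiplication adds nothing to the mixed part.\<close>

lemma op_mult_in_ideal_model:
  assumes "(\<forall>a<ne. \<forall>b<ne. cEE a b s = 0) \<or> (\<forall>a<ne. \<forall>b<ne. cEE a b t = 0)"
  shows "op_mult sext s t \<in> ideal_model"
proof -
  have "mid (op_mult sext s t) = 0\<^sub>v nm"
    unfolding mid_zero_iff using assms by (auto simp: coords_op_mult intro!: sum.neutral)
  also have "\<dots> = kB *\<^sub>v 0\<^sub>v nq" by (intro eq_vecI) (auto simp: scalar_prod_def)
  finally show ?thesis
    unfolding ideal_model_def
    by (intro CollectI conjI allI impI bexI[of _ "0\<^sub>v nq"]) (simp_all add: coords_op_mult)
qed

text \<open>One inclusion holds because the model is a two-sided ideal containing the relations. For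
  the other, subtracting \<open>gen_sum x\<close> removes the mixed coordinates, and what is left
  lies in W \<otimes> W.\<close>

lemma op_ideal_eq: "(J :: ('e, 'w, 'k::field) op_tensor set) = ideal_model"
proof
  show "(J :: ('e, 'w, 'k) op_tensor set) \<subseteq> ideal_model"
    unfolding op_ideal_def
  proof (rule hull_minimal)
    have scale: "op_scale c t \<in> ideal_model" if "t \<in> ideal_model" for c t
    proof -
      from that obtain x where t: "\<And>a b. a < ne \<Longrightarrow> b < ne \<Longrightarrow> cEE a b t = 0" "x \<in> carrier_vec nq" "mid t = kB *\<^sub>v x"
        by (auto simp: ideal_model_def)
      have "kB *\<^sub>v (c \<cdot>\<^sub>v x) = c \<cdot>\<^sub>v (kB *\<^sub>v x)"
        by (rule mult_mat_vec[OF kB_mat t(2)])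
      then show ?thesis
        unfolding ideal_model_def using t
        by (auto simp: mid_scale pfun_op_scale klinear_tE intro!: bexI[of _ "c \<cdot>\<^sub>v x"])
    qed
    have gen: "gen a b c d \<in> ideal_model" for a b c d
      unfolding ideal_model_def by (simp add: cEE_gen mid_gen)
    show "{op_tens (tprod sext a \<alpha> b \<beta> c) \<gamma> d \<delta> - op_tens a \<alpha> (tprod sext b \<beta> c \<gamma> d) \<delta> |
        a \<alpha> b \<beta> c \<gamma> d \<delta>. True} \<subseteq> ideal_model"
      unfolding generator_eq_scale_gen using scale[OF gen] by blast
    have "0 \<in> ideal_model" using scale[OF gen, of 0] by simp
    moreover have "s + t \<in> ideal_model" if "s \<in> ideal_model" "t \<in> ideal_model" for s t
    proof -
      from that obtain x y where
        s: "\<And>a b. a < ne \<Longrightarrow> b < ne \<Longrightarrow> cEE a b s = 0" "x \<in> carrier_vec nq" "mid s = kB *\<^sub>v x" and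
        t: "\<And>a b. a < ne \<Longrightarrow> b < ne \<Longrightarrow> cEE a b t = 0" "y \<in> carrier_vec nq" "mid t = kB *\<^sub>v y"
        by (auto simp: ideal_model_def)
      have "kB *\<^sub>v (x + y) = kB *\<^sub>v x + kB *\<^sub>v y"
        by (rule mult_add_distrib_mat_vec[OF kB_mat s(2) t(2)])
      then show ?thesis
        unfolding ideal_model_def using s t
        by (auto simp: mid_add additive.add[OF additive_pfun] klinear_tE intro!: bexI[of _ "x + y"])
    qed
    moreover have "op_mult sext s t \<in> ideal_model \<and> op_mult sext t s \<in> ideal_model"
      if "t \<in> ideal_model" for s t
      using that by (auto simp: ideal_model_def[symmetric] intro!: op_mult_in_ideal_model)
        (auto simp: ideal_model_def)
    ultimately show "op_two_sided_ideal sext ideal_model"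
      using scale by (auto simp: op_two_sided_ideal_def)
  qed
  show "ideal_model \<subseteq> (J :: ('e, 'w, 'k) op_tensor set)"
  proof
    fix t :: "('e, 'w, 'k) op_tensor" assume "t \<in> ideal_model"
    then obtain x where t: "\<And>a b. a < ne \<Longrightarrow> b < ne \<Longrightarrow> cEE a b t = 0" "x \<in> carrier_vec nq" "mid t = kB *\<^sub>v x"
      by (auto simp: ideal_model_def)
    have "mid (t - gen_sum x) = 0\<^sub>v nm"
    proof -
      have "mid t = mid (t - gen_sum x) + mid (gen_sum x)" by (simp flip: mid_add)
      then have "mid (t - gen_sum x) + kB *\<^sub>v x = kB *\<^sub>v x" using t by (simp add: mid_gen_sum)
      then have "mid (t - gen_sum x) $ i + (kB *\<^sub>v x) $ i = (kB *\<^sub>v x) $ i" if "i < nm" for i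
        using that by (metis index_add_vec(1) carrier_vecD kB_carrier)
      then show ?thesis by (intro eq_vecI) (auto simp: mid_def)
    qed
    moreover have "cEE a b (t - gen_sum x) = 0" if "a < ne" "b < ne" for a b
      using that t by (simp add: additive.diff[OF additive_pfun] klinear_tE cEE_gen_sum)
    ultimately have "t - gen_sum x \<in> J" by (intro coords_zero_in_J)
    from J_add[OF this gen_sum_in_J[of x]] show "t \<in> J" by simp
  qed
qed

end

section \<open>The defect\<close>

text \<open>Rank-nullity for a linear map \<open>F\<close> from ker Th \<oplus> k^n2 onto
  \<open>D\<close> with kernel 0 \<oplus> im B. An abstract \<open>D\<close> keeps the linear
  algebra apart from the record of cosets.\<close>

lemma dim_kernel_quotient:
  fixes Th B :: "'k::field mat" and D :: "('k, 'd, 'z) module_scheme"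
  assumes Th: "Th \<in> carrier_mat r n1" and B: "B \<in> carrier_mat n2 q"
    and D: "vectorspace class_ring D"
    and closed: "\<And>v. v \<in> carrier_vec (n1 + n2) \<Longrightarrow> Th *\<^sub>v vec_first v n1 = 0\<^sub>v r \<Longrightarrow> F v \<in> carrier D"
    and add: "\<And>v w. v \<in> carrier_vec (n1 + n2) \<Longrightarrow> w \<in> carrier_vec (n1 + n2) \<Longrightarrow>
      F (v + w) = F v \<oplus>\<^bsub>D\<^esub> F w"
    and smult: "\<And>c v. v \<in> carrier_vec (n1 + n2) \<Longrightarrow> F (c \<cdot>\<^sub>v v) = c \<odot>\<^bsub>D\<^esub> F v"
    and surj: "\<And>X. X \<in> carrier D \<Longrightarrow>
      \<exists>v\<in>carrier_vec (n1 + n2). Th *\<^sub>v vec_first v n1 = 0\<^sub>v r \<and> F v = X"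
    and zero: "\<And>v. v \<in> carrier_vec (n1 + n2) \<Longrightarrow> F v = \<zero>\<^bsub>D\<^esub> \<longleftrightarrow>
      vec_first v n1 = 0\<^sub>v n1 \<and> (\<exists>x\<in>carrier_vec q. vec_last v n2 = B *\<^sub>v x)"
  shows "vectorspace.dim class_ring D + vec_space.rank r Th + vec_space.rank n2 B = n1 + n2"
proof -
  \<comment> \<open>\<open>M\<close> is the block row of Th and 0, \<open>C\<close> the block column
    of 0 and B: the kernel of \<open>M\<close> is the domain of \<open>F\<close>, and the column
    space of \<open>C\<close> is the kernel of \<open>F\<close>.\<close>
  define M where "M = mat r (n1 + n2) (\<lambda>(i, k). if k < n1 then Th $$ (i, k) else 0)"
  define C where "C = mat (n1 + n2) q (\<lambda>(i, k). if i < n1 then 0 else B $$ (i - n1, k))"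
  have M: "M \<in> carrier_mat r (n1 + n2)" and C: "C \<in> carrier_mat (n1 + n2) q"
    by (simp_all add: M_def C_def)
  have Mv: "M *\<^sub>v v = Th *\<^sub>v vec_first v n1" if v: "v \<in> carrier_vec (n1 + n2)" for v
  proof (rule eq_vecI)
    fix i assume "i < dim_vec (Th *\<^sub>v vec_first v n1)"
    then have i: "i < r" using Th by simp
    have "(M *\<^sub>v v) $ i = (\<Sum>k<n1 + n2. M $$ (i, k) * v $ k)"
      using i M v by (simp add: scalar_prod_def atLeast0LessThan)
    also have "\<dots> = (\<Sum>k<n1. Th $$ (i, k) * v $ k)"
      unfolding sum_lessThan_add using i by (simp add: M_def)
    also have "\<dots> = (Th *\<^sub>v vec_first v n1) $ i"
      using i Th by (simp add: scalar_prod_def atLeast0LessThan vec_first_def)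
    finally show "(M *\<^sub>v v) $ i = (Th *\<^sub>v vec_first v n1) $ i" .
  qed (use M Th in simp)
  have kerM: "mat_kernel M = {v \<in> carrier_vec (n1 + n2). Th *\<^sub>v vec_first v n1 = 0\<^sub>v r}"
    using Mv by (auto simp: mat_kernel[OF M])
  have Cx: "C *\<^sub>v x = 0\<^sub>v n1 @\<^sub>v (B *\<^sub>v x)" if x: "x \<in> carrier_vec q" for x
  proof (rule eq_vecI)
    fix i assume "i < dim_vec (0\<^sub>v n1 @\<^sub>v (B *\<^sub>v x))"
    then have i: "i < n1 + n2" using B by simp
    have "(C *\<^sub>v x) $ i = (\<Sum>k<q. C $$ (i, k) * x $ k)"
      using i C x by (simp add: scalar_prod_def atLeast0LessThan)
    also have "\<dots> = (0\<^sub>v n1 @\<^sub>v (B *\<^sub>v x)) $ i"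
    proof (cases "i < n1")
      case True
      then show ?thesis using B by (simp add: C_def)
    next
      case False
      then show ?thesis using B i x by (simp add: C_def scalar_prod_def atLeast0LessThan)
    qed
    finally show "(C *\<^sub>v x) $ i = (0\<^sub>v n1 @\<^sub>v (B *\<^sub>v x)) $ i" .
  qed (use B C in simp)
  interpret R: vec_space "TYPE('k)" r .
  interpret N: vec_space "TYPE('k)" "n1 + n2" .
  have rankM: "R.rank M = R.rank Th"
  proof -
    \<comment> \<open>Appending zero columns does not change the column space.\<close>
    have "R.col_space M = R.col_space Th"
    proof
      show "R.col_space M \<subseteq> R.col_space Th"
        using Mv M Th by (auto simp: R.col_space_eq[OF M] R.col_space_eq[OF Th])
      show "R.col_space Th \<subseteq> R.col_space M"
      proof
        fix y assume "y \<in> R.col_space Th"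
        then obtain x where x: "x \<in> carrier_vec n1" "y = Th *\<^sub>v x"
          using Th by (auto simp: R.col_space_eq[OF Th])
        have "vec_first (x @\<^sub>v 0\<^sub>v n2) n1 = x"
          using x by (intro eq_vecI) (auto simp: vec_first_def)
        then have "y = M *\<^sub>v (x @\<^sub>v 0\<^sub>v n2)" using Mv[of "x @\<^sub>v 0\<^sub>v n2"] x by simp
        moreover have "x @\<^sub>v 0\<^sub>v n2 \<in> carrier_vec (n1 + n2)" using x by simp
        ultimately show "y \<in> R.col_space M"
          using M by (auto simp: R.col_space_eq[OF M])
      qed
    qed
    then show ?thesis by (simp add: R.rank_def R.col_space_def)
  qed
  have rankC: "N.rank C = vec_space.rank n2 B"
  proof -
    \<comment> \<open>Zero rows do not change the kernel, and both matrices have \<open>q\<close>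
      columns, so rank-nullity gives equal ranks.\<close>
    have "mat_kernel C = mat_kernel B"
    proof -
      have "C *\<^sub>v x = 0\<^sub>v (n1 + n2) \<longleftrightarrow> B *\<^sub>v x = 0\<^sub>v n2" if x: "x \<in> carrier_vec q" for x
      proof -
        have "0\<^sub>v (n1 + n2) = 0\<^sub>v n1 @\<^sub>v (0\<^sub>v n2 :: 'k vec)" by (intro eq_vecI) auto
        then show ?thesis
          unfolding Cx[OF x] using B x append_vec_eq[of "0\<^sub>v n1" n1 "0\<^sub>v n1" "B *\<^sub>v x" "0\<^sub>v n2"] by simp
      qed
      then show ?thesis using B by (auto simp: mat_kernel[OF C] mat_kernel[OF B])
    qed
    then have "kernel_dim C = kernel_dim B" using B C by (simp add: kernel_dim_def)
    then show ?thesis using rank_plus_kernel_dim[OF C] rank_plus_kernel_dim[OF B] by simp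
  qed
  interpret K: kernel r "n1 + n2" M by unfold_locales (rule M)
  interpret D: vectorspace class_ring D by (rule D)
  have lm: "linear_map class_ring K.VK D F"
    unfolding linear_map_def mod_hom_def mod_hom_axioms_def LinearCombinations.module_hom_def
    using K.Ker.vectorspace_axioms K.Ker.module_axioms D.vectorspace_axioms D.module_axioms
      closed add smult
    by (auto simp: kerM)
  interpret T: linear_map class_ring K.VK D F by (rule lm)
  have imT: "T.imT = F ` mat_kernel M" unfolding T.im_def by simp
  have kerT: "T.kerT = {v \<in> mat_kernel M. F v = \<zero>\<^bsub>D\<^esub>}" unfolding T.ker_def by simp
  have "T.imT = carrier D"
  proof
    show "T.imT \<subseteq> carrier D" unfolding imT using closed by (auto simp: kerM)
    show "carrier D \<subseteq> T.imT"
    proof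
      fix X assume "X \<in> carrier D"
      from surj[OF this] show "X \<in> T.imT" unfolding imT by (auto simp: kerM)
    qed
  qed
  then have im: "vectorspace.dim class_ring (D\<lparr>carrier := T.imT\<rparr>) = D.dim" by simp
  have "T.kerT = N.span (set (cols C))"
  proof -
    have "v \<in> T.kerT \<longleftrightarrow> v \<in> N.col_space C" for v
    proof
      assume "v \<in> T.kerT"
      then have v: "v \<in> carrier_vec (n1 + n2)" "F v = \<zero>\<^bsub>D\<^esub>"
        unfolding kerT by (auto simp: kerM)
      with zero[OF v(1)] obtain x where x: "x \<in> carrier_vec q" "vec_first v n1 = 0\<^sub>v n1" "vec_last v n2 = B *\<^sub>v x"
        by blast
      have "v = vec_first v n1 @\<^sub>v vec_last v n2" by (rule vec_first_last_append[OF v(1), symmetric])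
      also have "\<dots> = C *\<^sub>v x" unfolding x(2,3) Cx[OF x(1)] ..
      finally have "v = C *\<^sub>v x" .
      then show "v \<in> N.col_space C" using v x C by (auto simp: N.col_space_eq[OF C])
    next
      assume "v \<in> N.col_space C"
      then obtain x where x: "x \<in> carrier_vec q" "v = C *\<^sub>v x" "v \<in> carrier_vec (n1 + n2)"
        using C by (auto simp: N.col_space_eq[OF C])
      have "vec_first v n1 = 0\<^sub>v n1" "vec_last v n2 = B *\<^sub>v x"
        unfolding x(2) Cx[OF x(1)] using B by (auto simp: vec_first_def vec_last_def)
      moreover have "Th *\<^sub>v 0\<^sub>v n1 = 0\<^sub>v r" using Th by (intro eq_vecI) auto
      ultimately show "v \<in> T.kerT"
        unfolding kerT using zero[OF x(3)] x by (auto simp: kerM)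
    qed
    then show ?thesis by (auto simp: N.col_space_def)
  qed
  then have ker: "vectorspace.dim class_ring (K.VK\<lparr>carrier := T.kerT\<rparr>) = N.rank C"
    by (simp add: N.rank_def)
  have "K.Ker.fin_dim"
    using kernel_basis_exists[OF M] unfolding K.Ker.fin_dim_def K.Ker.basis_def by blast
  from T.rank_nullity[OF this] have "D.dim + N.rank C = K.dim"
    unfolding im ker .
  moreover have "R.rank M + K.dim = n1 + n2"
    using rank_plus_kernel_dim[OF M] by simp
  ultimately show ?thesis using rankM rankC by simp
qed

section \<open>Cosets and the regular representation\<close>

context ternary
begin

lemma mem_op_coset: "u \<in> op_coset sext t \<longleftrightarrow> u - t \<in> J"
  unfolding op_coset_def by (auto simp: image_iff intro: bexI[of _ "u - t"])

lemma self_mem_op_coset: "t \<in> op_coset sext t"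
  by (simp add: mem_op_coset J_0)

lemma op_coset_eq_iff: "op_coset sext s = op_coset sext t \<longleftrightarrow> s - t \<in> J"
proof
  assume "op_coset sext s = op_coset sext t"
  then show "s - t \<in> J" using self_mem_op_coset[of s] mem_op_coset by blast
next
  assume st: "s - t \<in> J"
  show "op_coset sext s = op_coset sext t"
  proof (rule Set.set_eqI)
    fix u
    have "u - t = (u - s) + (s - t)" "u - s = (u - t) - (s - t)" by simp_all
    then show "u \<in> op_coset sext s \<longleftrightarrow> u \<in> op_coset sext t"
      unfolding mem_op_coset using J_add J_diff st by metis
  qed
qed

text \<open>Addition of cosets is defined as a union over representatives; all members of this union
  coincide because the ideal is closed under addition.\<close>

lemma UN_op_coset_add:
  "(\<Union>s'\<in>op_coset sext s. \<Union>t'\<in>op_coset sext t. op_coset sext (s' + t')) = op_coset sext (s + t)"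
proof -
  have "op_coset sext (s' + t') = op_coset sext (s + t)"
    if "s' \<in> op_coset sext s" "t' \<in> op_coset sext t" for s' t'
  proof -
    have "s' + t' - (s + t) = (s' - s) + (t' - t)" by simp
    with that J_add show ?thesis by (simp only: op_coset_eq_iff mem_op_coset)
  qed
  then show ?thesis using self_mem_op_coset by blast
qed

lemma UN_op_coset_scale:
  "(\<Union>t'\<in>op_coset sext t. op_coset sext (op_scale c t')) = op_coset sext (op_scale c t)"
proof -
  have "op_coset sext (op_scale c t') = op_coset sext (op_scale c t)" if "t' \<in> op_coset sext t" for t'
    using that J_scale by (simp only: op_coset_eq_iff mem_op_coset flip: op_scale_diff)
  then show ?thesis using self_mem_op_coset by blast
qed

lemma fst_op_action: "fst (op_action sext t x) = 0"
  by (rule op_tensor_ext)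
    (simp_all add: Modules.additive_def additive.add[OF additive_op_action] op_action_ptens)

text \<open>The sum over \<open>c\<close> is moved outermost so that the inner double sum becomes an
  entry of \<Theta> applied to the E \<otimes> E coordinates of \<open>t\<close>.\<close>

lemma tW_op_action:
  assumes j: "j < nw"
  shows "tW j (op_action sext t x) =
    (\<Sum>c<ne. (\<Sum>a<ne. \<Sum>b<ne. of_int (mcoef a b c j) * cEE a b t) * tE c x)"
proof -
  have "tW j (op_action sext t x) =
      (\<Sum>a<ne. \<Sum>b<ne. \<Sum>c<ne. of_int (mcoef a b c j) * cEE a b t * tE c x)"
  proof (rule op_tensor_ext[of "\<lambda>t. tW j (op_action sext t x)"])
    have "Modules.additive (tW j :: ('e, 'w, 'a) tspace \<Rightarrow> 'a)" 
      by (rule klinear_tW[OF j, unfolded klinear_def, THEN conjunct1])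
    from additive.add[OF this] show "Modules.additive (\<lambda>t. tW j (op_action sext t x) :: 'a)"
      by (intro additive.intro) (simp only: additive.add[OF additive_op_action] plus_fun_apply)
    have a: "i \<in> {..<ne} \<Longrightarrow> k \<in> {..<ne} \<Longrightarrow> Modules.additive (cEE i k)" for i k
      by (simp add: additive_pfun klinear_tE)
    show "Modules.additive (\<lambda>t. \<Sum>a<ne. \<Sum>b<ne. \<Sum>c<ne. of_int (mcoef a b c j) * cEE a b t * tE c x)"
      by (intro additive_sum_fun additive.intro) (simp add: additive.add[OF a] algebra_simps)
  qed (simp add: op_action_ptens tW_tprod[OF j] pfun_ptens klinear_tE mult_ac)
  also have "\<dots> = (\<Sum>a<ne. \<Sum>c<ne. \<Sum>b<ne. of_int (mcoef a b c j) * cEE a b t * tE c x)"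
    by (rule sum.cong[OF refl]) (rule sum.swap)
  also have "\<dots> = (\<Sum>c<ne. \<Sum>a<ne. \<Sum>b<ne. of_int (mcoef a b c j) * cEE a b t * tE c x)"
    by (rule sum.swap)
  finally show ?thesis by (simp only: sum_distrib_right)
qed

definition vEE :: "('e, 'w, 'k::field) op_tensor \<Rightarrow> 'k vec" where
  "vEE t = vec (ne * ne) (\<lambda>k. cEE (k div ne) (k mod ne) t)"

lemma vEE_carrier [simp]: "vEE t \<in> carrier_vec (ne * ne)" "dim_vec (vEE t) = ne * ne"
  by (simp_all add: vEE_def)

lemma vEE_index: "a < ne \<Longrightarrow> b < ne \<Longrightarrow> vEE t $ (a * ne + b) = cEE a b t"
  by (simp add: vEE_def mult_add_less mult_add_div_mod)

lemma vEE_zero_iff: "vEE t = 0\<^sub>v (ne * ne) \<longleftrightarrow> (\<forall>a<ne. \<forall>b<ne. cEE a b t = 0)"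
proof
  assume "vEE t = 0\<^sub>v (ne * ne)"
  then show "\<forall>a<ne. \<forall>b<ne. cEE a b t = 0" by (simp add: vEE_index[symmetric] mult_add_less)
next
  assume "\<forall>a<ne. \<forall>b<ne. cEE a b t = 0"
  then show "vEE t = 0\<^sub>v (ne * ne)" by (intro eq_vecI) (auto simp: vEE_def div_mod_less)
qed

lemma kTh_mult_index:
  assumes "c < ne" "j < nw"
  shows "(kTh *\<^sub>v vEE t) $ (c * nw + j) = (\<Sum>a<ne. \<Sum>b<ne. of_int (mcoef a b c j) * cEE a b t)"
proof -
  have "(kTh *\<^sub>v vEE t) $ (c * nw + j) =
      (\<Sum>k<ne * ne. of_int (Theta_mat bE bW \<mu> $$ (c * nw + j, k)) * vEE t $ k)"
    using assms mult_add_less[of c ne j nw] by (simp add: scalar_prod_def atLeast0LessThan)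
  then show ?thesis
    unfolding sum_mult_nat using assms by (simp add: Theta_mat_index vEE_index)
qed

text \<open>The action takes values in W, and each coordinate of the value is a linear form in the E
  coordinates of the argument, with entries of \<open>kTh\<close> times \<open>vEE t\<close> as
  coefficients. Testing on the basis vectors \<open>uE c\<close> recovers these
  coefficients.\<close>

lemma op_action_zero_iff:
  "op_action sext t = (\<lambda>_. 0) \<longleftrightarrow> kTh *\<^sub>v vEE t = 0\<^sub>v (ne * nw)"
proof
  assume *: "op_action sext t = (\<lambda>_. 0)"
  show "kTh *\<^sub>v vEE t = 0\<^sub>v (ne * nw)"
  proof (rule eq_vecI)
    fix r assume "r < dim_vec (0\<^sub>v (ne * nw))"
    then have r: "r < ne * nw" by simp
    define c j where "c = r div nw" and "j = r mod nw"
    have cj: "c < ne" "j < nw" "r = c * nw + j"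
      using div_mod_less[OF r] by (simp_all add: c_def j_def)
    have "0 = tW j (op_action sext t (uE c))"
      using cj by (simp add: * tW_def additive.zero[OF additive_kcrd[OF bW]])
    also have "\<dots> = (kTh *\<^sub>v vEE t) $ r"
      unfolding tW_op_action[OF cj(2)] cj(3) kTh_mult_index[OF cj(1,2)]
      using cj by (simp add: if_distrib[where f = "\<lambda>x. _ * x"] cong: if_cong)
    finally show "(kTh *\<^sub>v vEE t) $ r = 0\<^sub>v (ne * nw) $ r" using r by simp
  qed simp
next
  assume *: "kTh *\<^sub>v vEE t = 0\<^sub>v (ne * nw)"
  show "op_action sext t = (\<lambda>_. 0)"
  proof
    fix x
    have "snd (op_action sext t x) = 0"
    proof (rule kcrd_eqI[OF bW])
      fix j assume j: "j < nw"
      have "(\<Sum>a<ne. \<Sum>b<ne. of_int (mcoef a b c j) * cEE a b t) = 0" if "c < ne" for c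
        using kTh_mult_index[OF that j, of t] * that j by (simp add: mult_add_less)
      then have "tW j (op_action sext t x) = 0" unfolding tW_op_action[OF j] by simp
      then show "kcrd bW j (snd (op_action sext t x)) = kcrd bW j 0"
        using j by (simp add: tW_def additive.zero[OF additive_kcrd[OF bW]])
    qed
    then show "op_action sext t x = 0" using fst_op_action by (simp add: prod_eq_iff)
  qed
qed

text \<open>Elements of the ideal have no E \<otimes> E coordinates, and the action sees only
  those.\<close>

lemma op_action_J: "t \<in> J \<Longrightarrow> op_action sext t = (\<lambda>_. 0)"
proof -
  assume "t \<in> J"
  then have "vEE t = 0\<^sub>v (ne * ne)" by (simp add: vEE_zero_iff op_ideal_eq ideal_model_def)
  then have "kTh *\<^sub>v vEE t = 0\<^sub>v (ne * nw)" by (intro eq_vecI) (auto simp: scalar_prod_def)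
  then show "op_action sext t = (\<lambda>_. 0)" by (simp add: op_action_zero_iff)
qed

text \<open>The action is constant on a coset, so \<open>the_elem\<close> is applied to a
  singleton.\<close>

lemma regular_representation_op_coset:
  "regular_representation sext (op_coset sext t) = op_action sext t"
proof -
  have "op_action sext u = op_action sext t" if "u \<in> op_coset sext t" for u
    using that op_action_J[of "u - t"]
    by (simp add: mem_op_coset additive.diff[OF additive_op_action] fun_eq_iff)
  then have "op_action sext ` op_coset sext t = {op_action sext t}"
    using self_mem_op_coset[of t] by blast
  then show ?thesis by (simp add: regular_representation_def)
qed

abbreviation defect :: "('k::field, ('e, 'w, 'k) op_tensor set) module" where
  "defect \<equiv> operator_defect sext"

lemma defect_simps [simp]:
  shows carrier_defect: "carrier defect = {op_coset sext t | t. op_action sext t = (\<lambda>_. 0)}"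
    and zero_defect: "\<zero>\<^bsub>defect\<^esub> = op_coset sext 0"
    and add_defect: "op_coset sext s \<oplus>\<^bsub>defect\<^esub> op_coset sext t = op_coset sext (s + t)"
    and smult_defect: "c \<odot>\<^bsub>defect\<^esub> op_coset sext t = op_coset sext (op_scale c t)"
  by (auto simp: operator_defect_def operator_rng_def regular_representation_op_coset
      UN_op_coset_add UN_op_coset_scale)

lemma op_action_op_scale: "op_action sext (op_scale c t) x = tscale c (op_action sext t x)"
  by (rule op_tensor_ext)
    (simp_all add: Modules.additive_def additive.add[OF additive_op_action]
      additive.add[OF additive_op_scale] tscale_add_right op_scale_ptens op_action_ptens tprod_tscale1)

lemma vectorspace_defect: "vectorspace class_ring (defect :: ('k::field, _) module)"
proof (rule vs_criteria)
  show "field (class_ring :: 'k ring)" by (rule class_field)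
  have 0: "op_action sext (0 :: ('e, 'w, 'k) op_tensor) = (\<lambda>_. 0)"
    by (simp add: fun_eq_iff additive.zero[OF additive_op_action])
  have add: "op_action sext (s + t) = (\<lambda>_. 0)"
    if "op_action sext s = (\<lambda>_. 0)" "op_action sext t = (\<lambda>_. 0)" for s t :: "('e, 'w, 'k) op_tensor"
    using that by (simp add: fun_eq_iff additive.add[OF additive_op_action])
  have sc: "op_action sext (op_scale c t) = (\<lambda>_. 0)"
    if "op_action sext t = (\<lambda>_. 0)" for c and t :: "('e, 'w, 'k) op_tensor"
    using that by (simp add: fun_eq_iff op_action_op_scale)
  show "\<zero>\<^bsub>defect\<^esub> \<in> carrier (defect :: ('k, _) module)"
    using 0 by auto
  show "\<forall>v w. v \<in> carrier (defect :: ('k, _) module) \<and> w \<in> carrier defect \<longrightarrow> v \<oplus>\<^bsub>defect\<^esub> w \<in> carrier defect"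
    using add by auto
  show "\<forall>c v. c \<in> carrier class_ring \<and> v \<in> carrier (defect :: ('k, _) module) \<longrightarrow>
      c \<odot>\<^bsub>defect\<^esub> v \<in> carrier defect"
    using sc by auto
  show "\<forall>v\<in>carrier (defect :: ('k, _) module). \<exists>neg_v\<in>carrier defect. v \<oplus>\<^bsub>defect\<^esub> neg_v = \<zero>\<^bsub>defect\<^esub>"
  proof
    fix v assume "v \<in> carrier (defect :: ('k, _) module)"
    then obtain t where t: "v = op_coset sext t" "op_action sext t = (\<lambda>_. 0)" by auto
    then show "\<exists>neg_v\<in>carrier defect. v \<oplus>\<^bsub>defect\<^esub> neg_v = \<zero>\<^bsub>defect\<^esub>"
      using sc[OF t(2), of "- 1"]
      by (intro bexI[of _ "op_coset sext (- t)"]) (auto simp: op_scale_minus_1)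
  qed
qed (auto simp: class_ring_simps add_ac op_scale_add_left op_scale_add_right
    simp flip: additive.add[OF additive_op_action])

section \<open>Dimension of the defect\<close>

text \<open>The vector is laid out in blocks for E \<otimes> E, W \<otimes> E and E \<otimes> W; the
  last two follow the order of the rows of \<open>B_mat\<close>.\<close>

definition vec_section :: "'k::field vec \<Rightarrow> ('e, 'w, 'k) op_tensor" where
  "vec_section v = section_map (\<lambda>a b. v $ (a * ne + b)) (\<lambda>j d. v $ (ne * ne + (j * ne + d)))
    (\<lambda>a j. v $ (ne * ne + (nw * ne + (a * nw + j))))"

lemma vec_section_add:
  assumes "v \<in> carrier_vec (ne * ne + nm)" "w \<in> carrier_vec (ne * ne + nm)"
  shows "vec_section (v + w) = vec_section v + vec_section w"
  unfolding vec_section_def section_map_add[symmetric]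
  by (rule section_map_cong) (use assms in \<open>simp_all add: mult_add_less trans_less_add1\<close>)

lemma vec_section_scale:
  assumes "v \<in> carrier_vec (ne * ne + nm)"
  shows "vec_section (c \<cdot>\<^sub>v v) = op_scale c (vec_section v)"
  unfolding vec_section_def section_map_scale[symmetric]
  by (rule section_map_cong) (use assms in \<open>simp_all add: mult_add_less trans_less_add1\<close>)

lemma vEE_vec_section: "vEE (vec_section v) = vec_first v (ne * ne)"
  by (rule eq_vecI) (auto simp: vEE_def vec_first_def vec_section_def coords_section_map div_mod_less)

lemma mid_vec_section:
  assumes "v \<in> carrier_vec (ne * ne + nm)"
  shows "mid (vec_section v) = vec_last v nm"
  by (rule mid_vec_eqI)
    (use assms in \<open>simp_all add: mid_index vec_last_def vec_section_def coords_section_map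
      mult_add_less trans_less_add1\<close>)

text \<open>Sending \<open>v\<close> to the coset of \<open>vec_section v\<close> is onto the defect
  because an element differs from the section of its coordinates by its residual, and a coset is
  zero exactly if the coordinates are those of an element of the ideal.\<close>

lemma defect_dim_formula:
  "defect_dim (sext :: ('e, 'w, 'k::field) trilinear) + field_rank TYPE('k) (Theta_mat bE bW \<mu>) +
    field_rank TYPE('k) (B_mat bE bW \<mu>) = ne * ne + nm"
  unfolding defect_dim_def field_rank_def dim_Theta_mat dim_B_mat
proof (rule dim_kernel_quotient[where F = "\<lambda>v. op_coset sext (vec_section v)" and q = nq])
  show "kTh \<in> carrier_mat (ne * nw) (ne * ne)" "kB \<in> carrier_mat nm nq"
    by (rule carrier_matI; simp)+
  show "vectorspace class_ring (defect :: ('k, _) module)" by (rule vectorspace_defect)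
  fix v :: "'k vec" assume v: "v \<in> carrier_vec (ne * ne + nm)"
  show "op_coset sext (vec_section v) \<in> carrier defect" if "kTh *\<^sub>v vec_first v (ne * ne) = 0\<^sub>v (ne * nw)"
    using that by (auto simp: op_action_zero_iff vEE_vec_section)
  show "op_coset sext (vec_section (v + w)) = op_coset sext (vec_section v) \<oplus>\<^bsub>defect\<^esub> op_coset sext (vec_section w)"
    if "w \<in> carrier_vec (ne * ne + nm)" for w
    using v that by (simp add: vec_section_add)
  show "op_coset sext (vec_section (c \<cdot>\<^sub>v v)) = c \<odot>\<^bsub>defect\<^esub> op_coset sext (vec_section v)" for c
    using v by (simp add: vec_section_scale)
  show "op_coset sext (vec_section v) = \<zero>\<^bsub>defect\<^esub> \<longleftrightarrow>
      vec_first v (ne * ne) = 0\<^sub>v (ne * ne) \<and> (\<exists>x\<in>carrier_vec nq. vec_last v nm = kB *\<^sub>v x)"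
    unfolding vEE_vec_section[symmetric] vEE_zero_iff mid_vec_section[OF v, symmetric]
    by (simp add: op_coset_eq_iff op_ideal_eq ideal_model_def)
next
  fix X assume "X \<in> carrier (defect :: ('k, _) module)"
  then obtain t where X: "X = op_coset sext t" and t: "op_action sext t = (\<lambda>_. 0)" by auto
  define v where "v = vEE t @\<^sub>v mid t"
  have v: "v \<in> carrier_vec (ne * ne + nm)" by (simp add: v_def)
  have sec: "vec_section v = section_map (\<lambda>a b. cEE a b t) (\<lambda>j d. cWE j d t) (\<lambda>a j. cEW a j t)"
    unfolding vec_section_def
    by (rule section_map_cong)
      (simp_all add: v_def vEE_index mid_index mult_add_less trans_less_add1)
  have "op_coset sext t = op_coset sext (vec_section v)"
    unfolding op_coset_eq_iff sec by (rule residual_in_J)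
  moreover have "kTh *\<^sub>v vec_first v (ne * ne) = 0\<^sub>v (ne * nw)"
  proof -
    have "vec_first v (ne * ne) = vEE t"
      by (intro eq_vecI) (auto simp: vec_first_def v_def)
    then show ?thesis using t by (simp add: op_action_zero_iff)
  qed
  ultimately show "\<exists>v\<in>carrier_vec (ne * ne + nm). kTh *\<^sub>v vec_first v (ne * ne) = 0\<^sub>v (ne * nw) \<and>
      op_coset sext (vec_section v) = X"
    using v X by auto
qed

text \<open>The total \<open>ne * ne + nm\<close> is the same over both fields and cancels. The
  subtractions of natural numbers do not truncate, since a rank modulo p never exceeds the rational
  rank.\<close>

lemma defect_jump_eq:
  "defect_jump TYPE('p::prime_card) \<mu> =
    int (rat_rank (Theta_mat bE bW \<mu>) - field_rank TYPE('p mod_ring) (Theta_mat bE bW \<mu>)) +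
    int (rat_rank (B_mat bE bW \<mu>) - field_rank TYPE('p mod_ring) (B_mat bE bW \<mu>))"
  using defect_dim_formula[where 'k = "'p mod_ring"] defect_dim_formula[where 'k = rat]
    field_rank_le_rat_rank[of "Theta_mat bE bW \<mu>", where 'k = "'p mod_ring"]
    field_rank_le_rat_rank[of "B_mat bE bW \<mu>", where 'k = "'p mod_ring"]
  by (simp add: defect_jump_def rat_rank_eq_field_rank)

end

theorem theorem13p4:
  fixes \<mu> :: "('e::ab_group_add) tensor3 \<Rightarrow> 'w::ab_group_add"
    and bE :: "'e list" and bW :: "'w list" and p :: nat
  assumes "zbasis bE" and "zbasis bW"
    and "(UNIV :: 'e set) \<noteq> {0}" and "(UNIV :: 'w set) \<noteq> {0}"
    and "Modules.additive \<mu>" and "surj \<mu>"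
    and "p = CARD('p::prime_card)"
  shows "(defect_jump TYPE('p) \<mu> \<noteq> 0 \<longleftrightarrow> int p dvd operator_discriminant bE bW \<mu>) \<and>
    (\<forall>\<alpha> \<beta>. smith_invariant_factors (Theta_mat bE bW \<mu>) \<alpha> \<longrightarrow>
            smith_invariant_factors (B_mat bE bW \<mu>) \<beta> \<longrightarrow>
       defect_jump TYPE('p) \<mu> =
         int (card {i. i < length \<alpha> \<and> int p dvd \<alpha> ! i} +
              card {j. j < length \<beta> \<and> int p dvd \<beta> ! j}))"
proof -
  interpret ternary bE bW \<mu> by (rule ternary.intro) (rule assms)+
  have "prime (int p)" using prime_card[where 'a = 'p] assms(7) by simp
  \<comment> \<open>Primality separates the two factors of the discriminant.\<close>
  then have "int p dvd operator_discriminant bE bW \<mu> \<longleftrightarrow>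
      int p dvd minors_gcd (Theta_mat bE bW \<mu>) \<or> int p dvd minors_gcd (B_mat bE bW \<mu>)"
    unfolding operator_discriminant_def by (rule prime_dvd_mult_iff)
  \<comment> \<open>The jump is a sum of two nonnegative rank drops, so it is nonzero exactly if one
    of them is.\<close>
  also have "\<dots> \<longleftrightarrow> defect_jump TYPE('p) \<mu> \<noteq> 0"
    unfolding assms(7) dvd_minors_gcd_iff defect_jump_eq by auto
  finally have "defect_jump TYPE('p) \<mu> \<noteq> 0 \<longleftrightarrow> int p dvd operator_discriminant bE bW \<mu>" ..
  then show ?thesis
    using smith_rank_drop[where 'p = 'p] by (auto simp: defect_jump_eq assms(7))
qed

end
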